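(* Let $\vec G$ be an orientation of the Coxeter diagram $s_0\overset{4}{-}s_1-\cdots-s_{n-1}$ of $B_n$ and let $Q(\vec G)$ be a centrally symmetric polygon as described below. Then the Cambrian lattice $\mathcal C(\vec G)$ is isomorphic to the partial order on centrally symmetric triangulations of $Q(\vec G)$ whose cover relations are diameter flips or symmetric pairs of diagonal flips, where going up in a cover relation corresponds to increasing the slope of the diameter or of each diagonal being flipped.
   Context: $B_n$: signed permutations with generators $s_0=(-1\ 1)$, $s_i=(i\ i{+}1)(-i{-}1\ {-i})$; weak order $v\le w$ iff $I(v)\subseteq I(w)$ ($I(w)$ the reflections $t$ with $\ell(tw)<\ell(w)$). $\Theta(\vec G)$: smallest lattice congruence of the weak order with $t$ congruent to the element with word $tsts\cdots$ of $m(s,t)-1$ letters for each directed edge $s\to t$ ($m(s_0,s_1)=4$, otherwise $3$); $\mathcal C(\vec G)$ is the quotient. Up/down: for $b\in[n-1]$, $b$ is up if $s_b\to s_{b-1}$ and down if $s_{b-1}\to s_b$; $n$ is declared up or down arbitrarily; $-b$ is down iff $b$ is up. $Q(\vec G)$: convex $(2n+2)$-gon with vertices $v_i$, $i\in\{\pm1,\dots,\pm(n+1)\}$, $v_{-i}=-v_i$, $x$-coordinates strictly increasing in the order $-n-1<\dots<-1<1<\dots<n+1$, $v_{\pm(n+1)}$ on the $x$-axis, $v_i$ above the axis iff $i$ up; slopes measured in these coordinates. A diagonal joins non-adjacent vertices; a diameter is a diagonal $v_iv_{-i}$; a centrally symmetric triangulation is a triangulation invariant under $v\mapsto-v$; a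 diagonal flip replaces a diagonal by the other diagonal of the quadrilateral formed by removing it. *)

theory Defs
  imports "HOL-Analysis.Analysis" "HOL-Combinatorics.Permutations"
begin

definition signed_idx :: "nat \<Rightarrow> int set" where
  "signed_idx n = {i. 1 \<le> \<bar>i\<bar> \<and> \<bar>i\<bar> \<le> int n}"

definition Bn :: "nat \<Rightarrow> (int \<Rightarrow> int) set" where
  "Bn n = {w. w permutes signed_idx n \<and> (\<forall>i. w (- i) = - w i)}"

fun gen :: "nat \<Rightarrow> int \<Rightarrow> int" where
  "gen 0 = (\<lambda>x. if x = 1 then -1 else if x = -1 then 1 else x)"
| "gen (Suc i) = (let k = int (Suc i) in
     (\<lambda>x. if x = k then k + 1 else if x = k + 1 then k
          else if x = - k then - k - 1 else if x = - k - 1 then - k else x))"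

definition wprod :: "nat list \<Rightarrow> int \<Rightarrow> int" where
  "wprod ws = foldr (\<lambda>i f. gen i \<circ> f) ws id"

definition len :: "nat \<Rightarrow> (int \<Rightarrow> int) \<Rightarrow> nat" where
  "len n w = (LEAST k. \<exists>ws. length ws = k \<and> (\<forall>i\<in>set ws. i < n) \<and> wprod ws = w)"

definition reflections :: "nat \<Rightarrow> (int \<Rightarrow> int) set" where
  "reflections n = {u \<circ> gen i \<circ> inv u | u i. u \<in> Bn n \<and> i < n}"

definition invset :: "nat \<Rightarrow> (int \<Rightarrow> int) \<Rightarrow> (int \<Rightarrow> int) set" where
  "invset n w = {t \<in> reflections n. len n (t \<circ> w) < len n w}"

definition wle :: "nat \<Rightarrow> (int \<Rightarrow> int) \<Rightarrow> (int \<Rightarrow> int) \<Rightarrow> bool" where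
  "wle n v w \<longleftrightarrow> invset n v \<subseteq> invset n w"

definition wjoin :: "nat \<Rightarrow> (int \<Rightarrow> int) \<Rightarrow> (int \<Rightarrow> int) \<Rightarrow> (int \<Rightarrow> int)" where
  "wjoin n x y = (THE z. z \<in> Bn n \<and> wle n x z \<and> wle n y z \<and>
                    (\<forall>u\<in>Bn n. wle n x u \<and> wle n y u \<longrightarrow> wle n z u))"

definition wmeet :: "nat \<Rightarrow> (int \<Rightarrow> int) \<Rightarrow> (int \<Rightarrow> int) \<Rightarrow> (int \<Rightarrow> int)" where
  "wmeet n x y = (THE z. z \<in> Bn n \<and> wle n z x \<and> wle n z y \<and>
                    (\<forall>u\<in>Bn n. wle n u x \<and> wle n u y \<longrightarrow> wle n u z))"

definition lattice_cong :: "nat \<Rightarrow> ((int \<Rightarrow> int) \<times> (int \<Rightarrow> int)) set \<Rightarrow> bool" where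
  "lattice_cong n \<Theta> \<longleftrightarrow> equiv (Bn n) \<Theta> \<and>
     (\<forall>x y z. (x, y) \<in> \<Theta> \<longrightarrow> z \<in> Bn n \<longrightarrow>
        (wjoin n x z, wjoin n y z) \<in> \<Theta> \<and> (wmeet n x z, wmeet n y z) \<in> \<Theta>)"

fun alt :: "(int \<Rightarrow> int) \<Rightarrow> (int \<Rightarrow> int) \<Rightarrow> nat \<Rightarrow> int \<Rightarrow> int" where
  "alt t s 0 = id"
| "alt t s (Suc k) = t \<circ> alt s t k"

text \<open>Orientation: for 1 <= b <= n-1, ori b means s_b -> s_(b-1) (b up);
  otherwise s_(b-1) -> s_b.  m(s_0,s_1) = 4, all other m = 3.
  A directed edge s -> t yields the pair (t, tst... with m-1 letters).\<close>
definition cong_gens :: "nat \<Rightarrow> (nat \<Rightarrow> bool) \<Rightarrow> ((int \<Rightarrow> int) \<times> (int \<Rightarrow> int)) set" where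
  "cong_gens n ori = {(let s = (if ori b then gen b else gen (b - 1));
                          t = (if ori b then gen (b - 1) else gen b);
                          m = (if b = 1 then 4 else 3 :: nat)
                      in (t, alt t s (m - 1))) | b. 1 \<le> b \<and> b \<le> n - 1}"

definition camb_cong :: "nat \<Rightarrow> (nat \<Rightarrow> bool) \<Rightarrow> ((int \<Rightarrow> int) \<times> (int \<Rightarrow> int)) set" where
  "camb_cong n ori = \<Inter>{\<Theta>. lattice_cong n \<Theta> \<and> cong_gens n ori \<subseteq> \<Theta>}"

definition camb_classes :: "nat \<Rightarrow> (nat \<Rightarrow> bool) \<Rightarrow> (int \<Rightarrow> int) set set" where
  "camb_classes n ori = Bn n // camb_cong n ori"

definition camb_le :: "nat \<Rightarrow> (int \<Rightarrow> int) set \<Rightarrow> (int \<Rightarrow> int) set \<Rightarrow> bool" where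
  "camb_le n X Y \<longleftrightarrow> (\<exists>x\<in>X. \<exists>y\<in>Y. wle n x y)"

definition covers :: "('a \<Rightarrow> 'a \<Rightarrow> bool) \<Rightarrow> 'a set \<Rightarrow> 'a \<Rightarrow> 'a \<Rightarrow> bool" where
  "covers le A x y \<longleftrightarrow> le x y \<and> x \<noteq> y \<and>
     \<not> (\<exists>z\<in>A. le x z \<and> le z y \<and> z \<noteq> x \<and> z \<noteq> y)"

definition is_up :: "nat \<Rightarrow> (nat \<Rightarrow> bool) \<Rightarrow> bool \<Rightarrow> int \<Rightarrow> bool" where
  "is_up n ori upn i =
     (let b = nat \<bar>i\<bar>; u = (if b = n then upn else ori b) in if i > 0 then u else \<not> u)"

definition poly_verts :: "nat \<Rightarrow> int set" where
  "poly_verts n = {i. 1 \<le> \<bar>i\<bar> \<and> \<bar>i\<bar> \<le> int n + 1}"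

definition Qpoly :: "nat \<Rightarrow> (int \<Rightarrow> bool) \<Rightarrow> (int \<Rightarrow> real \<times> real) \<Rightarrow> bool" where
  "Qpoly n up v \<longleftrightarrow>
     (\<forall>i\<in>poly_verts n. v (- i) = - v i) \<and>
     (\<forall>i\<in>poly_verts n. \<forall>j\<in>poly_verts n. i < j \<longrightarrow> fst (v i) < fst (v j)) \<and>
     snd (v (int n + 1)) = 0 \<and> snd (v (- int n - 1)) = 0 \<and>
     (\<forall>i\<in>poly_verts n. \<bar>i\<bar> \<le> int n \<longrightarrow> (snd (v i) > 0 \<longleftrightarrow> up i)) \<and>
     (\<forall>i\<in>poly_verts n. v i \<notin> convex hull (v ` (poly_verts n - {i})))"

definition cross :: "real \<times> real \<Rightarrow> real \<times> real \<Rightarrow> real \<times> real \<Rightarrow> real" where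
  "cross a b c = (fst b - fst a) * (snd c - snd a) - (snd b - snd a) * (fst c - fst a)"

text \<open>Adjacent vertices = endpoints of a boundary edge of the convex polygon.\<close>
definition adjacent :: "nat \<Rightarrow> (int \<Rightarrow> real \<times> real) \<Rightarrow> int \<Rightarrow> int \<Rightarrow> bool" where
  "adjacent n v i j \<longleftrightarrow>
     (\<forall>k\<in>poly_verts n - {i, j}. cross (v i) (v j) (v k) > 0) \<or>
     (\<forall>k\<in>poly_verts n - {i, j}. cross (v i) (v j) (v k) < 0)"

definition is_diagonal :: "nat \<Rightarrow> (int \<Rightarrow> real \<times> real) \<Rightarrow> int set \<Rightarrow> bool" where
  "is_diagonal n v d \<longleftrightarrow> (\<exists>i j. d = {i, j} \<and> i \<in> poly_verts n \<and> j \<in> poly_verts n \<and>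
                                 i \<noteq> j \<and> \<not> adjacent n v i j)"

definition is_diameter :: "int set \<Rightarrow> bool" where
  "is_diameter d \<longleftrightarrow> (\<exists>i. d = {i, - i})"

definition seg :: "(int \<Rightarrow> real \<times> real) \<Rightarrow> int set \<Rightarrow> (real \<times> real) set" where
  "seg v d = \<Union>{closed_segment (v i) (v j) | i j. d = {i, j}}"

definition crossing :: "(int \<Rightarrow> real \<times> real) \<Rightarrow> int set \<Rightarrow> int set \<Rightarrow> bool" where
  "crossing v d e \<longleftrightarrow> d \<inter> e = {} \<and> seg v d \<inter> seg v e \<noteq> {}"

definition triangulation :: "nat \<Rightarrow> (int \<Rightarrow> real \<times> real) \<Rightarrow> int set set \<Rightarrow> bool" where
  "triangulation n v T \<longleftrightarrow>
     (\<forall>d\<in>T. is_diagonal n v d) \<and>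
     (\<forall>d\<in>T. \<forall>e\<in>T. \<not> crossing v d e) \<and>
     (\<forall>d. is_diagonal n v d \<and> d \<notin> T \<longrightarrow> (\<exists>e\<in>T. crossing v d e))"

definition neg_diag :: "int set \<Rightarrow> int set" where
  "neg_diag d = uminus ` d"

definition cs_triangulations :: "nat \<Rightarrow> (int \<Rightarrow> real \<times> real) \<Rightarrow> int set set set" where
  "cs_triangulations n v = {T. triangulation n v T \<and> neg_diag ` T = T}"

definition slope :: "(int \<Rightarrow> real \<times> real) \<Rightarrow> int set \<Rightarrow> real" where
  "slope v d = (THE s. \<exists>i j. d = {i, j} \<and> i < j \<and>
                    s = (snd (v j) - snd (v i)) / (fst (v j) - fst (v i)))"

text \<open>Flip of d in T: d replaced by the other diagonal d' of its quadrilateral,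
  i.e. the unique d' not in T such that (T - {d}) + d' is again a triangulation.\<close>
definition flip :: "nat \<Rightarrow> (int \<Rightarrow> real \<times> real) \<Rightarrow> int set set \<Rightarrow> int set \<Rightarrow> int set
                     \<Rightarrow> int set set \<Rightarrow> bool" where
  "flip n v T d d' T' \<longleftrightarrow> triangulation n v T \<and> d \<in> T \<and> d' \<notin> T \<and>
      T' = insert d' (T - {d}) \<and> triangulation n v T'"

definition flip_up :: "nat \<Rightarrow> (int \<Rightarrow> real \<times> real) \<Rightarrow> (int set set \<times> int set set) set" where
  "flip_up n v = {(T, T'). T \<in> cs_triangulations n v \<and> T' \<in> cs_triangulations n v \<and>
     ((\<exists>d d'. is_diameter d \<and> flip n v T d d' T' \<and> slope v d < slope v d') \<or>
      (\<exists>d d' T1. \<not> is_diameter d \<and> flip n v T d d' T1 \<and>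
                 flip n v T1 (neg_diag d) (neg_diag d') T' \<and>
                 slope v d < slope v d' \<and> slope v (neg_diag d) < slope v (neg_diag d')))}"

end

theory Submission
  imports Defs
begin

text \<open>A symmetric linear order on the labels sweeps a monotone path from the lower to the upper boundary
  of the polygon, deleting down vertices and inserting up vertices; the edges of all these paths form a
  centrally symmetric triangulation, and every such triangulation arises. The triangulation
  determines, and is determined by, the set of uncontracted join-irreducibles below the order,
  and dually by the uncontracted meet-irreducibles above it. Hence equality of triangulations is
  compatible with meets and joins.

  This congruence is the Cambrian one: a cover swapping adjacent values \<open>a < c\<close> keeps the triangulation
  iff some \<open>b\<close> between them is up and to the left or down and to the right. Joins and meets with
  suitable elements deduce such a collapse from one of smaller height \<open>c - a\<close>, down to the
  generating collapses.

  A cover that changes the triangulation replaces one diagonal, together with its mirror image, by a steeper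
  one. Conversely, if \<open>T\<close> and \<open>T'\<close> differ by such a flip, then they are the only centrally symmetric
  triangulations containing \<open>T \<inter> T'\<close>. Every class in the interval between the classes of
  \<open>T\<close> and \<open>T'\<close>, and also their meet, yields a triangulation containing \<open>T \<inter> T'\<close>; therefore
  the two classes form a cover.\<close>

section \<open>Inversions and length of signed permutations\<close>

text \<open>One mechanism links all parts: a chord lies on some path iff certain labels precede
  certain others, and two chords cross iff they demand opposite orders of one pair of labels.
  Crossing, maximality and forcing thus become statements about inversions. Joins and meets are
  transitive closures of inversions or non-inversions, and the demands survive them because a chain
  violating a demand contains a single link that violates one.

  The laborious half is to show that the generating collapses suffice. Shortening a contracted swap
  of \<open>a < c\<close> requires a value between \<open>a\<close> and \<open>c\<close>, other than
  the witness \<open>b\<close>, next to the pair; values standing elsewhere have to be brought there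
  by moves that respect the collapse. The obstacle is the center, where positions \<open>1\<close>
  and \<open>-1\<close> carry opposite values: near it the pair itself supplies the values
  \<open>-a\<close> and \<open>-c\<close>, so swaps with \<open>k = 0\<close> and
  \<open>k = 1\<close> get arguments of their own, and there the generators enter.\<close>

lemma signed_idx_iff: "i \<in> signed_idx n \<longleftrightarrow> i \<noteq> 0 \<and> \<bar>i\<bar> \<le> int n"
  by (auto simp: signed_idx_def)

lemma finite_signed_idx [simp]: "finite (signed_idx n)"
proof -
  have "signed_idx n \<subseteq> {- int n..int n}" by (auto simp: signed_idx_iff)
  then show ?thesis using finite_subset by blast
qed

lemma signed_idx_uminus [simp]: "- i \<in> signed_idx n \<longleftrightarrow> i \<in> signed_idx n"
  by (auto simp: signed_idx_iff)

lemma Bn_permutes: "w \<in> Bn n \<Longrightarrow> w permutes signed_idx n"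
  by (simp add: Bn_def)

lemma Bn_odd: "w \<in> Bn n \<Longrightarrow> w (- i) = - w i"
  by (simp add: Bn_def)

lemma Bn_inj [simp]: "w \<in> Bn n \<Longrightarrow> w i = w j \<longleftrightarrow> i = j"
  by (meson Bn_permutes permutes_inj injD)

lemma Bn_in [simp]: "w \<in> Bn n \<Longrightarrow> w i \<in> signed_idx n \<longleftrightarrow> i \<in> signed_idx n"
  by (meson Bn_permutes permutes_in_image)

lemma Bn_outside: "w \<in> Bn n \<Longrightarrow> i \<notin> signed_idx n \<Longrightarrow> w i = i"
  by (meson Bn_permutes permutes_not_in)

lemma Bn_bij: "w \<in> Bn n \<Longrightarrow> bij w"
  by (meson Bn_permutes permutes_bij)

lemma Bn_inv_f [simp]: "w \<in> Bn n \<Longrightarrow> inv w (w i) = i"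
  by (meson Bn_permutes permutes_inverses(2))

lemma Bn_f_inv [simp]: "w \<in> Bn n \<Longrightarrow> w (inv w i) = i"
  by (meson Bn_permutes permutes_inverses(1))

lemma id_Bn [simp]: "id \<in> Bn n"
  by (simp add: Bn_def permutes_id)

lemma comp_Bn [simp]: "u \<in> Bn n \<Longrightarrow> w \<in> Bn n \<Longrightarrow> u \<circ> w \<in> Bn n"
  by (simp add: Bn_def permutes_compose)

lemma inv_Bn [simp]: "w \<in> Bn n \<Longrightarrow> inv w \<in> Bn n"
  by (smt (verit, best) Bn_def Bn_f_inv Bn_inj Bn_odd mem_Collect_eq permutes_inv)

lemma inv_eq_iff [simp]: "w \<in> Bn n \<Longrightarrow> inv w i = inv w j \<longleftrightarrow> i = j"
  by (metis Bn_f_inv)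

lemma inv_in [simp]: "w \<in> Bn n \<Longrightarrow> inv w i \<in> signed_idx n \<longleftrightarrow> i \<in> signed_idx n"
  by (rule Bn_in) simp

lemma inv_odd: "w \<in> Bn n \<Longrightarrow> inv w (- i) = - inv w i"
  by (rule Bn_odd[OF inv_Bn])

lemma finite_Bn [simp]: "finite (Bn n)"
  by (rule finite_subset[OF _ finite_permutations[of "signed_idx n"]]) (auto simp: Bn_def)

section \<open>Generators as swaps of adjacent positions\<close>

definition lo :: "nat \<Rightarrow> int" where "lo k = (if k = 0 then -1 else int k)"

definition hi :: "nat \<Rightarrow> int" where "hi k = int k + 1"

lemma lo_less_hi [simp]: "lo k < hi k"
  by (simp add: lo_def hi_def)

lemma lo_in [simp]: "k < n \<Longrightarrow> lo k \<in> signed_idx n"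
  and hi_in [simp]: "k < n \<Longrightarrow> hi k \<in> signed_idx n"
  by (auto simp: lo_def hi_def signed_idx_iff)

text \<open>Zero is not a position, so \<open>lo 0 = -1\<close> and \<open>hi 0 = 1\<close> are
  neighbors and one formula serves all generators. For \<open>k = 0\<close> the pair of positions is
  its own mirror image.\<close>

lemma gen_eq: "gen k x = (if x = lo k then hi k else if x = hi k then lo k
    else if x = - lo k then - hi k else if x = - hi k then - lo k else x)"
  by (cases k) (auto simp: lo_def hi_def Let_def)

declare gen.simps [simp del]

lemma gen_odd: "gen k (- x) = - gen k x"
  by (auto simp: gen_eq lo_def hi_def)

lemma gen_gen [simp]: "gen k (gen k x) = x"
  by (auto simp: gen_eq lo_def hi_def)

lemma gen_comp_gen [simp]: "gen k \<circ> gen k = id"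
  by (rule ext) simp

lemma gen_Bn [simp]:
  assumes "k < n"
  shows "gen k \<in> Bn n"
proof -
  have "gen k permutes signed_idx n"
    unfolding permutes_def
  proof (intro conjI allI impI)
    fix x assume "x \<notin> signed_idx n"
    with assms show "gen k x = x"
      by (auto simp: gen_eq lo_def hi_def signed_idx_iff)
  next
    fix y show "\<exists>!x. gen k x = y" by (metis gen_gen)
  qed
  then show ?thesis by (simp add: Bn_def gen_odd)
qed

lemma inv_gen [simp]: "inv (gen k) = gen k"
  by (rule inv_unique_comp) simp_all

lemma gen_lo [simp]: "gen k (lo k) = hi k"
  and gen_hi [simp]: "gen k (hi k) = lo k"
  by (auto simp: gen_eq)

lemma gen_less_iff:
  assumes "i < j" "i \<noteq> 0" "j \<noteq> 0"
  shows "gen k j < gen k i \<longleftrightarrow> (i = lo k \<and> j = hi k) \<or> (i = - hi k \<and> j = - lo k)"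
  using assms by (auto simp: gen_eq lo_def hi_def)

text \<open>Reflections multiply on the left in the weak order, so inversions are recorded by values
  and not by positions. A pair and its mirror image \<open>(- c, - a)\<close> belong to the same
  reflection.\<close>

definition Inv :: "nat \<Rightarrow> (int \<Rightarrow> int) \<Rightarrow> (int \<times> int) set" where
  "Inv n w = {(a, c). a \<in> signed_idx n \<and> c \<in> signed_idx n \<and> a < c \<and> inv w c < inv w a}"

lemma Inv_iff: "(a, c) \<in> Inv n w \<longleftrightarrow>
    a \<in> signed_idx n \<and> c \<in> signed_idx n \<and> a < c \<and> inv w c < inv w a"
  by (simp add: Inv_def)

lemma finite_Inv [simp]: "finite (Inv n w)"
  by (rule finite_subset[of _ "signed_idx n \<times> signed_idx n"]) (auto simp: Inv_iff)

lemma Inv_sym: "w \<in> Bn n \<Longrightarrow> (- c, - a) \<in> Inv n w \<longleftrightarrow> (a, c) \<in> Inv n w"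
  by (auto simp: Inv_iff inv_odd)

lemma Inv_trans: "(a, b) \<in> Inv n w \<Longrightarrow> (b, c) \<in> Inv n w \<Longrightarrow> (a, c) \<in> Inv n w"
  by (auto simp: Inv_iff)

lemma Inv_cotrans:
  "(a, c) \<in> Inv n w \<Longrightarrow> a < b \<Longrightarrow> b < c \<Longrightarrow> b \<in> signed_idx n \<Longrightarrow> (a, b) \<in> Inv n w \<or> (b, c) \<in> Inv n w"
  by (auto simp: Inv_iff)

lemma Inv_id [simp]: "Inv n id = {}"
  by (auto simp: Inv_iff)

lemma inv_comp_gen: "w \<in> Bn n \<Longrightarrow> inv (w \<circ> gen k) = gen k \<circ> inv w"
  by (subst o_inv_distrib) (auto simp: Bn_bij intro: o_bij[of "gen k" "gen k"])

text \<open>Right multiplication by \<open>gen k\<close> exchanges two neighbors and their mirror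
  images; all other pairs of entries keep their relative order.\<close>

lemma Inv_step:
  assumes w: "w \<in> Bn n" and k: "k < n" and asc: "w (lo k) < w (hi k)"
  shows "Inv n (w \<circ> gen k) = Inv n w \<union> {(w (lo k), w (hi k)), (- w (hi k), - w (lo k))}"
    and "(w (lo k), w (hi k)) \<notin> Inv n w" "(- w (hi k), - w (lo k)) \<notin> Inv n w"
proof -
  show "(w (lo k), w (hi k)) \<notin> Inv n w" "(- w (hi k), - w (lo k)) \<notin> Inv n w"
    using w by (auto simp: Inv_iff inv_odd not_less intro: less_imp_le)
  show "Inv n (w \<circ> gen k) = Inv n w \<union> {(w (lo k), w (hi k)), (- w (hi k), - w (lo k))}"
  proof (intro set_eqI)
    fix p :: "int \<times> int"
    obtain a c where p: "p = (a, c)" by fastforce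
    have lohi: "w (lo k) \<in> signed_idx n" "w (hi k) \<in> signed_idx n"
      using w k by simp_all
    show "p \<in> Inv n (w \<circ> gen k) \<longleftrightarrow> p \<in> Inv n w \<union> {(w (lo k), w (hi k)), (- w (hi k), - w (lo k))}"
    proof (cases "a \<in> signed_idx n \<and> c \<in> signed_idx n \<and> a < c")
      case False
      then show ?thesis using lohi asc by (auto simp: p Inv_iff)
    next
      case True
      define i j where "i = inv w a" and "j = inv w c"
      have ij: "a = w i" "c = w j" "i \<in> signed_idx n" "j \<in> signed_idx n" "i \<noteq> j"
        using True w by (auto simp: i_def j_def)
      have nz: "i \<noteq> 0" "j \<noteq> 0" using ij by (auto simp: signed_idx_iff)
      have e1: "p \<in> Inv n (w \<circ> gen k) \<longleftrightarrow> gen k j < gen k i"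
        using True w by (simp add: p Inv_iff inv_comp_gen i_def j_def)
      have e2: "p \<in> Inv n w \<longleftrightarrow> j < i"
        using True by (simp add: p Inv_iff i_def j_def)
      have e3: "p = (w (lo k), w (hi k)) \<longleftrightarrow> i = lo k \<and> j = hi k"
        "p = (- w (hi k), - w (lo k)) \<longleftrightarrow> i = - hi k \<and> j = - lo k"
        using w by (simp_all add: p ij flip: Bn_odd[OF w])
      have asc': "w i < w j" using True ij by simp
      show ?thesis
      proof (cases "i < j")
        case True
        then show ?thesis using gen_less_iff[of i j k] nz e1 e2 e3 by auto
      next
        case False
        then have "j < i" using ij by simp
        have "\<not> (j = lo k \<and> i = hi k)" using asc asc' by auto
        moreover have "\<not> (j = - hi k \<and> i = - lo k)" using asc asc' by (auto simp: Bn_odd[OF w])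
        ultimately have "\<not> gen k i < gen k j"
          using gen_less_iff[of j i k] nz \<open>j < i\<close> by auto
        moreover have "gen k i \<noteq> gen k j" using ij by (metis gen_gen)
        ultimately show ?thesis using e1 e2 \<open>j < i\<close> by auto
      qed
    qed
  qed
qed

text \<open>Ascending from \<open>w 1 > 0\<close> bounds the positive entries from below, descending
  from \<open>w n \<le> n\<close> bounds them from above.\<close>

lemma Bn_monotone_eq_id:
  assumes w: "w \<in> Bn n" and asc: "\<And>k. k < n \<Longrightarrow> w (lo k) < w (hi k)"
  shows "w = id"
proof -
  have ge: "int k < n \<Longrightarrow> w (int k + 1) \<ge> int k + 1" for k :: nat
  proof (induction k)
    case 0
    then have "w (-1) < w 1" using asc[of 0] by (auto simp: lo_def hi_def)
    then show ?case by (simp add: Bn_odd[OF w])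
  next
    case (Suc k)
    then have "w (int k + 1) < w (int k + 2)"
      using asc[of "Suc k"] by (auto simp: lo_def hi_def add.commute)
    then show ?case using Suc by (simp add: add.commute)
  qed
  have le: "k < n \<Longrightarrow> w (int (n - k)) \<le> int (n - k)" for k :: nat
  proof (induction k)
    case 0
    have "w (int n) \<in> signed_idx n" using 0 unfolding Bn_in[OF w] by (simp add: signed_idx_iff)
    then have "\<bar>w (int n)\<bar> \<le> int n" unfolding signed_idx_iff by blast
    then show ?case by simp
  next
    case (Suc k)
    have "w (lo (n - Suc k)) < w (hi (n - Suc k))" using Suc by (intro asc) auto
    moreover have "lo (n - Suc k) = int (n - Suc k)" "hi (n - Suc k) = int (n - k)"
      using Suc.prems by (auto simp: lo_def hi_def)
    moreover have "int (n - k) = int (n - Suc k) + 1" using Suc.prems by simp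
    ultimately show ?case using Suc by simp
  qed
  have pos: "w i = i" if "i > 0" "i \<le> int n" for i
    using ge[of "nat (i - 1)"] le[of "nat (int n - i)"] that by (simp add: nat_diff_distrib')
  show ?thesis
  proof (rule ext)
    fix i
    consider "i \<notin> signed_idx n" | "i > 0" "i \<le> int n" | "- i > 0" "- i \<le> int n"
      unfolding signed_idx_iff by linarith
    then show "w i = id i"
    proof cases
      case 1
      then show ?thesis using Bn_outside[OF w] by simp
    next
      case 2
      then show ?thesis using pos by simp
    next
      case 3
      then have "w (- i) = - i" by (rule pos)
      then show ?thesis using Bn_odd[OF w, of i] by simp
    qed
  qed
qed

lemma Bn_descent:
  assumes w: "w \<in> Bn n" and "w \<noteq> id"
  obtains k where "k < n" "w (hi k) < w (lo k)"
  using Bn_monotone_eq_id[OF w] assms Bn_inj[OF w] lo_less_hi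
  by (metis linorder_less_linear order_less_irrefl)

section \<open>Words, reflections and the exchange condition\<close>

lemma wprod_Nil: "wprod [] = id" and wprod_Cons: "wprod (i # ws) = gen i \<circ> wprod ws"
  by (simp_all add: wprod_def)

lemma wprod_append: "wprod (us @ ws) = wprod us \<circ> wprod ws"
  by (induction us) (simp_all add: wprod_Nil wprod_Cons o_assoc)

lemma wprod_Bn: "set ws \<subseteq> {..<n} \<Longrightarrow> wprod ws \<in> Bn n"
  by (induction ws) (auto simp: wprod_Nil wprod_Cons simp del: id_apply)

lemma comp_gen_gen [simp]: "u \<circ> gen k \<circ> gen k = u"
  by (simp add: comp_assoc)

lemma Bn_word:
  assumes "w \<in> Bn n"
  shows "\<exists>ws. set ws \<subseteq> {..<n} \<and> wprod ws = w"
  using assms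
proof (induction "card (Inv n w)" arbitrary: w rule: less_induct)
  case less
  show ?case
  proof (cases "w = id")
    case True
    then show ?thesis by (intro exI[of _ "[]"]) (simp add: wprod_Nil)
  next
    case False
    then obtain k where k: "k < n" "w (hi k) < w (lo k)"
      using Bn_descent less.prems by metis
    define u where "u = w \<circ> gen k"
    have u: "u \<in> Bn n" "u (lo k) < u (hi k)" "u \<circ> gen k = w"
      using less.prems k by (auto simp: u_def)
    have "Inv n u \<subset> Inv n w"
      using Inv_step[OF u(1) k(1) u(2)] unfolding u(3) by blast
    then have "card (Inv n u) < card (Inv n w)" by (intro psubset_card_mono) auto
    then obtain ws where "set ws \<subseteq> {..<n}" "wprod ws = u"
      using less.hyps u(1) by blast
    then show ?thesis using k u(3) by (intro exI[of _ "ws @ [k]"]) (simp add: wprod_append wprod_Cons wprod_Nil)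
  qed
qed

lemma len_le: "set ws \<subseteq> {..<n} \<Longrightarrow> len n (wprod ws) \<le> length ws"
  unfolding len_def by (rule Least_le) auto

lemma len_word:
  assumes "w \<in> Bn n"
  obtains ws where "set ws \<subseteq> {..<n}" "wprod ws = w" "length ws = len n w"
proof -
  obtain ws where ws: "set ws \<subseteq> {..<n}" "wprod ws = w" using Bn_word[OF assms] by blast
  have "\<exists>ws'. length ws' = len n w \<and> (\<forall>i\<in>set ws'. i < n) \<and> wprod ws' = w"
    unfolding len_def by (rule LeastI[of _ "length ws"]) (use ws in auto)
  then show ?thesis using that by (auto simp: subset_iff)
qed

text \<open>The case \<open>c = - a\<close> is allowed and gives the reflection that changes a
  single sign.\<close>

definition refl_swap :: "int \<Rightarrow> int \<Rightarrow> int \<Rightarrow> int" where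
  "refl_swap a c x = (if x = a then c else if x = c then a
     else if x = - a then - c else if x = - c then - a else x)"

lemma refl_swap_swap: "a \<noteq> 0 \<Longrightarrow> c \<noteq> 0 \<Longrightarrow> refl_swap a c (refl_swap a c x) = x"
  by (auto simp: refl_swap_def)

lemma refl_swap_minus: "a \<noteq> 0 \<Longrightarrow> c \<noteq> 0 \<Longrightarrow> refl_swap (- c) (- a) = refl_swap a c"
  by (rule ext) (auto simp: refl_swap_def)

lemma comp_gen_refl_swap:
  assumes w: "w \<in> Bn n" and k: "k < n"
  shows "w \<circ> gen k = refl_swap (w (lo k)) (w (hi k)) \<circ> w"
proof (rule ext)
  fix x
  have "w (gen k x) = refl_swap (w (lo k)) (w (hi k)) (w x)"
    unfolding gen_eq refl_swap_def Bn_odd[OF w, symmetric] Bn_inj[OF w] by simp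
  then show "(w \<circ> gen k) x = (refl_swap (w (lo k)) (w (hi k)) \<circ> w) x" by simp
qed

lemma Bn_not_less:
  "w \<in> Bn n \<Longrightarrow> \<not> w (lo k) < w (hi k) \<longleftrightarrow> w (hi k) < w (lo k)"
  by (metis Bn_inj lo_less_hi linorder_less_linear order_less_irrefl order_less_asym)

lemma Inv_new_letter:
  assumes u: "u \<in> Bn n" and k: "k < n"
    and new: "(a, c) \<in> Inv n (u \<circ> gen k)" "(a, c) \<notin> Inv n u"
  shows "u \<circ> gen k = refl_swap a c \<circ> u"
proof -
  have asc: "u (lo k) < u (hi k)"
  proof (rule ccontr)
    assume "\<not> u (lo k) < u (hi k)"
    then have "Inv n (u \<circ> gen k) \<subseteq> Inv n u"
      using Inv_step(1)[of "u \<circ> gen k" n k] u k by (auto simp: Bn_not_less)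
    then show False using new by auto
  qed
  have ac: "a \<noteq> 0" "c \<noteq> 0" using new by (auto simp: Inv_iff signed_idx_iff)
  have "(a, c) = (u (lo k), u (hi k)) \<or> (a, c) = (- u (hi k), - u (lo k))"
    using new Inv_step(1)[OF u k asc] by auto
  then have "refl_swap a c = refl_swap (u (lo k)) (u (hi k))"
    using refl_swap_minus ac by (metis Pair_inject minus_equation_iff)
  then show ?thesis using comp_gen_refl_swap[OF u k] by simp
qed

text \<open>Along the prefixes of the word, the pair \<open>(a, c)\<close> becomes inverted at some
  letter. There, multiplying by the letter on the right amounts to multiplying by the reflection on
  the left, so deleting the letter multiplies the whole product by the reflection.\<close>

lemma exchange:
  assumes "set ws \<subseteq> {..<n}" "(a, c) \<in> Inv n (wprod ws)"
  shows "\<exists>us k vs. ws = us @ k # vs \<and> wprod us \<circ> gen k = refl_swap a c \<circ> wprod us"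
  using assms
proof (induction ws rule: rev_induct)
  case Nil
  then have "(a, c) \<in> Inv n id" by (simp only: wprod_Nil)
  then show ?case by (simp only: Inv_id) simp
next
  case (snoc k ws)
  have u: "wprod ws \<in> Bn n" and k: "k < n" using snoc.prems wprod_Bn by auto
  have prod: "wprod (ws @ [k]) = wprod ws \<circ> gen k"
    by (simp add: wprod_append wprod_Cons wprod_Nil)
  show ?case
  proof (cases "(a, c) \<in> Inv n (wprod ws)")
    case True
    then obtain us j vs where "ws = us @ j # vs" "wprod us \<circ> gen j = refl_swap a c \<circ> wprod us"
      using snoc.IH snoc.prems(1) by (auto simp del: comp_apply)
    then show ?thesis by (intro exI[of _ us] exI[of _ j] exI[of _ "vs @ [k]"]) simp
  next
    case False
    then have "wprod ws \<circ> gen k = refl_swap a c \<circ> wprod ws"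
      using Inv_new_letter[OF u k] snoc.prems(2) unfolding prod by blast
    then show ?thesis by (intro exI[of _ ws] exI[of _ k] exI[of _ "[]"] conjI) simp_all
  qed
qed

lemma Inv_reflection:
  assumes "w \<in> Bn n" "(a, c) \<in> Inv n w"
  shows "refl_swap a c \<in> reflections n"
proof -
  obtain ws where ws: "set ws \<subseteq> {..<n}" "wprod ws = w" using Bn_word[OF assms(1)] by blast
  obtain us k vs where us: "ws = us @ k # vs" "wprod us \<circ> gen k = refl_swap a c \<circ> wprod us"
    using exchange[OF ws(1)] assms(2) ws(2) by blast
  have u: "wprod us \<in> Bn n" "k < n" using us(1) ws(1) wprod_Bn by auto
  then have "refl_swap a c = wprod us \<circ> gen k \<circ> inv (wprod us)"
    unfolding us(2) by (auto simp: fun_eq_iff)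
  then show ?thesis unfolding reflections_def mem_Collect_eq using u
    by (intro exI[of _ "wprod us"] exI[of _ k]) simp
qed

lemma reflection_swap:
  assumes "t \<in> reflections n"
  obtains a c where "a \<in> signed_idx n" "c \<in> signed_idx n" "a < c" "t = refl_swap a c"
proof -
  obtain u k where u: "u \<in> Bn n" "k < n" "t = u \<circ> gen k \<circ> inv u"
    using assms by (auto simp: reflections_def)
  define a c where "a = min (u (lo k)) (u (hi k))" and "c = max (u (lo k)) (u (hi k))"
  have "t = refl_swap (u (lo k)) (u (hi k)) \<circ> (u \<circ> inv u)"
    using comp_gen_refl_swap[OF u(1,2)] u(3) by (simp add: o_assoc)
  also have "u \<circ> inv u = id" using u by (auto simp: fun_eq_iff)
  also have "refl_swap (u (lo k)) (u (hi k)) = refl_swap a c"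
    by (rule ext) (auto simp: refl_swap_def a_def c_def min_def max_def)
  finally have "t = refl_swap a c" by simp
  moreover have "u (lo k) \<noteq> u (hi k)"
    using u(1) by (metis Bn_inj lo_less_hi order_less_irrefl)
  then have "a < c" by (auto simp: a_def c_def)
  moreover have "a \<in> signed_idx n" "c \<in> signed_idx n"
    using u by (auto simp: a_def c_def min_def max_def)
  ultimately show ?thesis using that by blast
qed

lemma refl_swap_Bn:
  assumes "a \<in> signed_idx n" "c \<in> signed_idx n"
  shows "refl_swap a c \<in> Bn n"
proof -
  have nz: "a \<noteq> 0" "c \<noteq> 0" using assms by (auto simp: signed_idx_iff)
  have "refl_swap a c permutes signed_idx n"
    unfolding permutes_def
  proof (intro conjI allI impI)
    fix x assume "x \<notin> signed_idx n"
    then show "refl_swap a c x = x" using assms by (auto simp: refl_swap_def)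
  next
    fix y show "\<exists>!x. refl_swap a c x = y" by (metis refl_swap_swap nz)
  qed
  moreover have "refl_swap a c (- x) = - refl_swap a c x" for x
    using nz by (auto simp: refl_swap_def)
  ultimately show ?thesis by (simp add: Bn_def)
qed

text \<open>The exchange condition gives one direction. For the other, a pair not inverted in
  \<open>w\<close> is inverted in \<open>refl_swap a c \<circ> w\<close>, and the reflection is an
  involution.\<close>

lemma Inv_len:
  assumes w: "w \<in> Bn n" and ac: "a \<in> signed_idx n" "c \<in> signed_idx n" "a < c"
  shows "(a, c) \<in> Inv n w \<longleftrightarrow> len n (refl_swap a c \<circ> w) < len n w"
proof -
  have nz: "a \<noteq> 0" "c \<noteq> 0" using ac by (auto simp: signed_idx_iff)
  have less: "len n (refl_swap a c \<circ> u) < len n u" if u: "u \<in> Bn n" "(a, c) \<in> Inv n u" for u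
  proof -
    obtain ws where ws: "set ws \<subseteq> {..<n}" "wprod ws = u" "length ws = len n u"
      using len_word[OF u(1)] by blast
    then obtain us k vs where us: "ws = us @ k # vs"
      "wprod us \<circ> gen k = refl_swap a c \<circ> wprod us"
      using exchange u(2) by blast
    have "wprod us = refl_swap a c \<circ> (wprod us \<circ> gen k)"
      unfolding us(2) by (auto simp: fun_eq_iff refl_swap_swap[OF nz])
    then have "wprod (us @ vs) = refl_swap a c \<circ> u"
      unfolding ws(2)[symmetric] us(1) wprod_append wprod_Cons by (simp add: o_assoc)
    then show ?thesis using len_le[of "us @ vs" n] ws us(1) by simp
  qed
  have "(a, c) \<in> Inv n (refl_swap a c \<circ> w)" if "(a, c) \<notin> Inv n w"
  proof -
    have inv_swap: "inv (refl_swap a c) = refl_swap a c"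
      by (rule inv_unique_comp) (auto simp: fun_eq_iff refl_swap_swap[OF nz])
    have "inv (refl_swap a c \<circ> w) = inv w \<circ> refl_swap a c"
      using refl_swap_Bn[OF ac(1,2)] w by (simp add: o_inv_distrib Bn_bij inv_swap)
    moreover have "inv w a \<noteq> inv w c" using w ac by simp
    ultimately show ?thesis
      using that ac nz by (auto simp: Inv_iff refl_swap_def)
  qed
  moreover have "refl_swap a c \<circ> (refl_swap a c \<circ> w) = w"
    by (auto simp: fun_eq_iff refl_swap_swap[OF nz])
  ultimately show ?thesis
    using less[of w] less[of "refl_swap a c \<circ> w"] w refl_swap_Bn[OF ac(1,2)]
    by (metis comp_Bn order_less_asym)
qed

lemma wle_iff:
  assumes v: "v \<in> Bn n" and w: "w \<in> Bn n"
  shows "wle n v w \<longleftrightarrow> Inv n v \<subseteq> Inv n w"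
proof
  assume le: "wle n v w"
  show "Inv n v \<subseteq> Inv n w"
  proof (rule subrelI)
    fix a c assume ac: "(a, c) \<in> Inv n v"
    then have "refl_swap a c \<in> invset n v"
      using Inv_reflection[OF v] Inv_len[OF v] by (auto simp: invset_def Inv_iff)
    then have "refl_swap a c \<in> invset n w" using le by (auto simp: wle_def)
    then show "(a, c) \<in> Inv n w"
      using ac Inv_len[OF w] by (auto simp: invset_def Inv_iff[of a c n v])
  qed
next
  assume sub: "Inv n v \<subseteq> Inv n w"
  show "wle n v w"
    unfolding wle_def
  proof
    fix t assume t: "t \<in> invset n v"
    then obtain a c where ac: "a \<in> signed_idx n" "c \<in> signed_idx n" "a < c" "t = refl_swap a c"
      using reflection_swap[of t n] unfolding invset_def by blast
    then have "(a, c) \<in> Inv n v" using t Inv_len[OF v] by (auto simp: invset_def)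
    then have "(a, c) \<in> Inv n w" using sub by blast
    then show "t \<in> invset n w" using t ac Inv_len[OF w] by (auto simp: invset_def)
  qed
qed

text \<open>A descent of \<open>inv v \<circ> w\<close> is a pair of neighbors of \<open>w\<close>
  that \<open>v\<close> orders the other way.\<close>

lemma Inv_inject:
  assumes v: "v \<in> Bn n" and w: "w \<in> Bn n" and eq: "Inv n v = Inv n w"
  shows "v = w"
proof -
  define u where "u = inv v \<circ> w"
  have u: "u \<in> Bn n" using v w by (simp add: u_def)
  have "u (lo k) < u (hi k)" if "k < n" for k
  proof (rule ccontr)
    assume "\<not> u (lo k) < u (hi k)"
    then have less: "u (hi k) < u (lo k)" using u by (simp add: Bn_not_less)
    have inI: "w (lo k) \<in> signed_idx n" "w (hi k) \<in> signed_idx n" using that w by auto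
    show False
    proof (cases "w (lo k) < w (hi k)")
      case True
      then have "(w (lo k), w (hi k)) \<in> Inv n v" using less inI by (auto simp: Inv_iff u_def)
      then show False unfolding eq using w lo_less_hi[of k] by (simp add: Inv_iff)
    next
      case False
      then have "w (hi k) < w (lo k)" using w by (simp add: Bn_not_less)
      then have "(w (hi k), w (lo k)) \<in> Inv n w" using w inI by (simp add: Inv_iff)
      then have "(w (hi k), w (lo k)) \<in> Inv n v" using eq by simp
      then show False using less by (auto simp: Inv_iff u_def)
    qed
  qed
  then have "u = id" using Bn_monotone_eq_id u by blast
  then show ?thesis using v unfolding u_def by (metis Bn_f_inv comp_apply ext id_apply)
qed

section \<open>The weak order is a lattice\<close>

definition idx_pairs :: "nat \<Rightarrow> (int \<times> int) set" where
  "idx_pairs n = {(a, c). a \<in> signed_idx n \<and> c \<in> signed_idx n \<and> a < c}"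

lemma idx_pairs_iff: "(a, c) \<in> idx_pairs n \<longleftrightarrow> a \<in> signed_idx n \<and> c \<in> signed_idx n \<and> a < c"
  by (simp add: idx_pairs_def)

text \<open>These conditions characterize the inversion sets of signed permutations
  (\<open>biclosed_Inv\<close>, \<open>biclosed_realize\<close>). They are stable under complement,
  which makes meets dual to joins.\<close>

definition biclosed :: "nat \<Rightarrow> (int \<times> int) set \<Rightarrow> bool" where
  "biclosed n K \<longleftrightarrow> K \<subseteq> idx_pairs n \<and> trans K \<and>
     (\<forall>a b c. (a, c) \<in> K \<longrightarrow> b \<in> signed_idx n \<longrightarrow> a < b \<longrightarrow> b < c \<longrightarrow> (a, b) \<in> K \<or> (b, c) \<in> K) \<and>
     (\<forall>a c. (a, c) \<in> K \<longrightarrow> (- c, - a) \<in> K)"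

lemma biclosedD:
  assumes "biclosed n K"
  shows "(a, c) \<in> K \<Longrightarrow> a \<in> signed_idx n \<and> c \<in> signed_idx n \<and> a < c"
    and "(a, b) \<in> K \<Longrightarrow> (b, c) \<in> K \<Longrightarrow> (a, c) \<in> K"
    and "(a, c) \<in> K \<Longrightarrow> b \<in> signed_idx n \<Longrightarrow> a < b \<Longrightarrow> b < c \<Longrightarrow> (a, b) \<in> K \<or> (b, c) \<in> K"
    and "(a, c) \<in> K \<Longrightarrow> (- c, - a) \<in> K"
  using assms unfolding biclosed_def idx_pairs_def trans_def by blast+

lemma biclosed_Inv: "w \<in> Bn n \<Longrightarrow> biclosed n (Inv n w)"
  unfolding biclosed_def trans_def
  by (auto simp: Inv_sym intro: Inv_trans dest: Inv_cotrans) (auto simp: Inv_iff idx_pairs_iff)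

lemma biclosed_compl:
  assumes K: "biclosed n K"
  shows "biclosed n (idx_pairs n - K)"
  unfolding biclosed_def trans_def
proof (intro conjI allI impI)
  fix a b c
  show "idx_pairs n - K \<subseteq> idx_pairs n" by blast
  { assume "(a, b) \<in> idx_pairs n - K" "(b, c) \<in> idx_pairs n - K"
    then show "(a, c) \<in> idx_pairs n - K"
      using biclosedD(3)[OF K, of a c b] by (auto simp: idx_pairs_iff) }
  { assume "(a, c) \<in> idx_pairs n - K" "b \<in> signed_idx n" "a < b" "b < c"
    then show "(a, b) \<in> idx_pairs n - K \<or> (b, c) \<in> idx_pairs n - K"
      using biclosedD(2)[OF K, of a b c] by (auto simp: idx_pairs_iff) }
  { assume "(a, c) \<in> idx_pairs n - K"
    then show "(- c, - a) \<in> idx_pairs n - K"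
      using biclosedD(4)[OF K, of "- c" "- a"] by (auto simp: idx_pairs_iff) }
qed

lemma adjacent_positions:
  assumes "i \<in> signed_idx n" "j \<in> signed_idx n" "i < j"
    and none: "\<And>m. m \<in> signed_idx n \<Longrightarrow> i < m \<Longrightarrow> m < j \<Longrightarrow> False"
  shows "\<exists>k<n. i = lo k \<and> j = hi k \<or> i = - hi k \<and> j = - lo k"
proof -
  have j: "j = (if i = -1 then 1 else i + 1)"
    using none[of "i + 1"] none[of 1] assms(1-3) unfolding signed_idx_iff by (smt (verit))
  consider "i = -1" | "i > 0" | "i < -1" using assms(1) unfolding signed_idx_iff by linarith
  then show ?thesis
  proof cases
    case 1
    then show ?thesis using j assms by (intro exI[of _ 0]) (auto simp: lo_def hi_def signed_idx_iff)
  next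
    case 2
    then show ?thesis using j assms
      by (intro exI[of _ "nat i"]) (auto simp: lo_def hi_def signed_idx_iff)
  next
    case 3
    then show ?thesis using j assms
      by (intro exI[of _ "nat (- j)"]) (auto simp: lo_def hi_def signed_idx_iff)
  qed
qed

text \<open>Among the pairs of \<open>K\<close> not yet inverted, one whose entries are closest in
  \<open>w\<close> consists of neighbors: an entry between them would yield a closer pair, by
  transitivity if its value lies outside and by cotransitivity if it lies inside.\<close>

lemma biclosed_step:
  assumes w: "w \<in> Bn n" and K: "biclosed n K" and sub: "Inv n w \<subset> K"
  obtains k where "k < n" "w (lo k) < w (hi k)" "(w (lo k), w (hi k)) \<in> K"
    "Inv n (w \<circ> gen k) \<subseteq> K"
proof -
  obtain p0 where "p0 \<in> K - Inv n w" using sub by blast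
  then obtain p where p: "p \<in> K - Inv n w"
    and least: "\<And>q. q \<in> K - Inv n w \<Longrightarrow>
      nat (inv w (snd p) - inv w (fst p)) \<le> nat (inv w (snd q) - inv w (fst q))"
    using ex_has_least_nat[of "\<lambda>p. p \<in> K - Inv n w" p0 "\<lambda>p. nat (inv w (snd p) - inv w (fst p))"]
    by blast
  obtain a c where ac: "p = (a, c)" by fastforce
  have K_ac: "(a, c) \<in> K" "a \<in> signed_idx n" "c \<in> signed_idx n" "a < c" "inv w a < inv w c"
    using p w biclosedD(1)[OF K, of a c] inv_eq_iff[OF w, of a c]
    by (auto simp: ac Inv_iff simp del: inv_eq_iff)
  have none: False if m: "m \<in> signed_idx n" "inv w a < m" "m < inv w c" for m
  proof -
    define b where "b = w m"
    have b: "b \<in> signed_idx n" "inv w b = m" "b \<noteq> a" "b \<noteq> c"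
      using w m by (auto simp: b_def)
    have closer: False if "(x, y) \<in> K" "x < y" "inv w a \<le> inv w x" "inv w x < inv w y"
      "inv w y \<le> inv w c" "(x, y) \<noteq> (a, c)" for x y
    proof -
      have "(x, y) \<in> K - Inv n w" using that by (auto simp: Inv_iff)
      from least[OF this] that K_ac have "inv w x = inv w a" "inv w y = inv w c"
        by (auto simp: ac)
      then show False using that w by auto
    qed
    consider "b < a" | "a < b" "b < c" | "c < b" using b by linarith
    then show False
    proof cases
      case 1
      then have "(b, a) \<in> Inv n w" using b m K_ac by (auto simp: Inv_iff)
      then have "(b, a) \<in> K" using sub by blast
      then have "(b, c) \<in> K" using biclosedD(2)[OF K] K_ac by blast
      then show False using closer[of b c] b m K_ac 1 by auto
    next
      case 2
      then have "(a, b) \<in> K \<or> (b, c) \<in> K" using biclosedD(3)[OF K] K_ac b by blast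
      then show False using closer[of b c] closer[of a b] b m K_ac 2 by auto
    next
      case 3
      then have "(c, b) \<in> Inv n w" using b m K_ac by (auto simp: Inv_iff)
      then have "(c, b) \<in> K" using sub by blast
      then have "(a, b) \<in> K" using biclosedD(2)[OF K] K_ac by blast
      then show False using closer[of a b] b m K_ac 3 by auto
    qed
  qed
  have "inv w a \<in> signed_idx n" "inv w c \<in> signed_idx n" using K_ac w by auto
  from adjacent_positions[OF this K_ac(5)] none obtain k where k: "k < n"
    "inv w a = lo k \<and> inv w c = hi k \<or> inv w a = - hi k \<and> inv w c = - lo k"
    by blast
  have lohi: "(a = w (lo k) \<and> c = w (hi k)) \<or> (a = - w (hi k) \<and> c = - w (lo k))"
    using k(2) Bn_f_inv[OF w, of a] Bn_f_inv[OF w, of c] by (auto simp: Bn_odd[OF w])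
  then have "(w (lo k), w (hi k)) \<in> K" "(- w (hi k), - w (lo k)) \<in> K" "w (lo k) < w (hi k)"
    using K_ac biclosedD(4)[OF K] by force+
  then show ?thesis
    using that[OF k(1)] Inv_step(1)[OF w k(1)] sub by auto
qed

lemma biclosed_realize:
  assumes K: "biclosed n K"
  obtains w where "w \<in> Bn n" "Inv n w = K"
proof -
  define S where "S = {w \<in> Bn n. Inv n w \<subseteq> K}"
  have fin: "finite S" and ne: "id \<in> S" by (auto simp: S_def simp del: id_apply)
  obtain w where w: "w \<in> S" and wmax: "\<And>u. u \<in> S \<Longrightarrow> card (Inv n u) \<le> card (Inv n w)"
    using obtains_MAX[of S "\<lambda>w. card (Inv n w)"] fin ne
    by (metis Max_ge empty_iff finite_imageI imageI)
  have "Inv n w = K"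
  proof (rule ccontr)
    assume "Inv n w \<noteq> K"
    then have "w \<in> Bn n" "Inv n w \<subset> K" using w by (auto simp: S_def)
    then obtain k where k: "k < n" "w (lo k) < w (hi k)" "Inv n (w \<circ> gen k) \<subseteq> K"
      using biclosed_step[OF _ K] by blast
    have "Inv n w \<subset> Inv n (w \<circ> gen k)"
      using Inv_step[OF _ k(1,2)] w by (auto simp: S_def)
    then have "card (Inv n w) < card (Inv n (w \<circ> gen k))" by (intro psubset_card_mono) auto
    moreover have "w \<circ> gen k \<in> S" using w k by (simp add: S_def)
    ultimately show False using wmax by fastforce
  qed
  then show ?thesis using that w by (auto simp: S_def)
qed

text \<open>The main point is cotransitivity: a chain from \<open>a\<close> to \<open>c\<close>
  either visits \<open>b\<close> or has a link jumping over \<open>b\<close>, and that link splits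
  within \<open>R\<close>.\<close>

lemma biclosed_trancl:
  assumes R: "R \<subseteq> idx_pairs n"
    and cotrans: "\<And>a b c. (a, c) \<in> R \<Longrightarrow> b \<in> signed_idx n \<Longrightarrow> a < b \<Longrightarrow> b < c \<Longrightarrow> (a, b) \<in> R \<or> (b, c) \<in> R"
    and sym: "\<And>a c. (a, c) \<in> R \<Longrightarrow> (- c, - a) \<in> R"
  shows "biclosed n (R\<^sup>+)"
  unfolding biclosed_def
proof (intro conjI allI impI)
  show "R\<^sup>+ \<subseteq> idx_pairs n"
  proof (rule subrelI)
    fix a c assume "(a, c) \<in> R\<^sup>+"
    then show "(a, c) \<in> idx_pairs n"
      using R by (induction rule: trancl_induct) (force simp: idx_pairs_iff)+
  qed
  show "trans (R\<^sup>+)" by simp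
  fix a b c
  assume ac: "(a, c) \<in> R\<^sup>+"
  then show "(- c, - a) \<in> R\<^sup>+"
    by (induction rule: trancl_induct) (auto dest: sym intro: trancl_into_trancl2)
  assume b: "b \<in> signed_idx n" "a < b" "b < c"
  from ac b(3) show "(a, b) \<in> R\<^sup>+ \<or> (b, c) \<in> R\<^sup>+"
  proof (induction rule: trancl_induct)
    case (base y)
    then show ?case using cotrans b by blast
  next
    case (step y z)
    show ?case
    proof (cases "b < y")
      case True
      then show ?thesis using step by (meson trancl.trancl_into_trancl)
    next
      case False
      then consider "b = y" | "y < b" by linarith
      then show ?thesis
        using step cotrans[OF step.hyps(2) b(1)] by (cases; meson r_into_trancl' trancl.trancl_into_trancl)
    qed
  qed
qed

text \<open>Non-inversions grow downwards in the weak order and play for meets the role that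
  \<open>Inv\<close> plays for joins.\<close>

definition Ninv :: "nat \<Rightarrow> (int \<Rightarrow> int) \<Rightarrow> (int \<times> int) set" where
  "Ninv n w = idx_pairs n - Inv n w"

lemma Ninv_iff:
  assumes "w \<in> Bn n"
  shows "(a, c) \<in> Ninv n w \<longleftrightarrow>
    a \<in> signed_idx n \<and> c \<in> signed_idx n \<and> a < c \<and> inv w a < inv w c"
  using inv_eq_iff[OF assms, of a c] by (auto simp: Ninv_def Inv_iff idx_pairs_iff simp del: inv_eq_iff)

lemma Inv_subset_pairs: "Inv n w \<subseteq> idx_pairs n"
  by (auto simp: Inv_iff idx_pairs_iff)

lemma trancl_least: "R \<subseteq> K \<Longrightarrow> trans K \<Longrightarrow> R\<^sup>+ \<subseteq> K"
  by (metis trancl_id trancl_mono subsetI)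

lemma wle_refl [simp]: "wle n x x"
  by (simp add: wle_def)

lemma wle_trans: "wle n x y \<Longrightarrow> wle n y z \<Longrightarrow> wle n x z"
  by (auto simp: wle_def)

lemma wle_antisym: "x \<in> Bn n \<Longrightarrow> y \<in> Bn n \<Longrightarrow> wle n x y \<Longrightarrow> wle n y x \<Longrightarrow> x = y"
  by (auto simp: wle_iff intro: Inv_inject)

text \<open>The union of two inversion sets is cotransitive but need not be transitive; its closure
  is the least biclosed set containing both.\<close>

lemma wjoin_Inv:
  assumes x: "x \<in> Bn n" and y: "y \<in> Bn n"
  shows "wjoin n x y \<in> Bn n" "Inv n (wjoin n x y) = (Inv n x \<union> Inv n y)\<^sup>+"
proof -
  have "biclosed n ((Inv n x \<union> Inv n y)\<^sup>+)"
    using Inv_subset_pairs x y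
    by (intro biclosed_trancl) (blast, (auto dest: Inv_cotrans simp: Inv_sym)+)
  then obtain z where z: "z \<in> Bn n" "Inv n z = (Inv n x \<union> Inv n y)\<^sup>+"
    by (rule biclosed_realize)
  have upper: "wle n x z" "wle n y z" using z x y by (auto simp: wle_iff)
  have least: "wle n z u" if "u \<in> Bn n" "wle n x u" "wle n y u" for u
    using that z x y trancl_least[of "Inv n x \<union> Inv n y" "Inv n u"] biclosed_Inv[of u n]
    by (simp add: wle_iff biclosed_def)
  have "wjoin n x y = z"
    unfolding wjoin_def
  proof (rule the_equality)
    fix u assume "u \<in> Bn n \<and> wle n x u \<and> wle n y u \<and>
       (\<forall>z\<in>Bn n. wle n x z \<and> wle n y z \<longrightarrow> wle n u z)"
    then show "u = z" using z(1) upper least[of u] by (blast intro: wle_antisym)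
  qed (use z upper least in blast)
  then show "wjoin n x y \<in> Bn n" "Inv n (wjoin n x y) = (Inv n x \<union> Inv n y)\<^sup>+"
    using z by auto
qed

lemma wmeet_Ninv:
  assumes x: "x \<in> Bn n" and y: "y \<in> Bn n"
  shows "wmeet n x y \<in> Bn n" "Ninv n (wmeet n x y) = (Ninv n x \<union> Ninv n y)\<^sup>+"
proof -
  have N: "biclosed n (Ninv n u)" if "u \<in> Bn n" for u
    using biclosed_compl[OF biclosed_Inv[OF that]] by (simp add: Ninv_def)
  have "biclosed n ((Ninv n x \<union> Ninv n y)\<^sup>+)"
  proof (rule biclosed_trancl)
    show "Ninv n x \<union> Ninv n y \<subseteq> idx_pairs n" by (auto simp: Ninv_def)
    show "(a, b) \<in> Ninv n x \<union> Ninv n y \<or> (b, c) \<in> Ninv n x \<union> Ninv n y"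
      if "(a, c) \<in> Ninv n x \<union> Ninv n y" "b \<in> signed_idx n" "a < b" "b < c" for a b c
      using that biclosedD(3)[OF N[OF x]] biclosedD(3)[OF N[OF y]] by blast
    show "(- c, - a) \<in> Ninv n x \<union> Ninv n y" if "(a, c) \<in> Ninv n x \<union> Ninv n y" for a c
      using that biclosedD(4)[OF N[OF x]] biclosedD(4)[OF N[OF y]] by blast
  qed
  from biclosed_compl[OF this] obtain z where
    z: "z \<in> Bn n" "Inv n z = idx_pairs n - (Ninv n x \<union> Ninv n y)\<^sup>+"
    by (rule biclosed_realize)
  have Nz: "Ninv n z = (Ninv n x \<union> Ninv n y)\<^sup>+"
    using z(2) \<open>biclosed n ((Ninv n x \<union> Ninv n y)\<^sup>+)\<close> by (auto simp: Ninv_def biclosed_def)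
  have le: "wle n u v \<longleftrightarrow> Ninv n v \<subseteq> Ninv n u" if "u \<in> Bn n" "v \<in> Bn n" for u v
    using that Inv_subset_pairs[of n u] Inv_subset_pairs[of n v] by (auto simp: wle_iff Ninv_def)
  have lower: "wle n z x" "wle n z y" using z Nz x y by (auto simp: le)
  have greatest: "wle n u z" if "u \<in> Bn n" "wle n u x" "wle n u y" for u
    using that z Nz x y trancl_least[of "Ninv n x \<union> Ninv n y" "Ninv n u"] N[of u]
    by (simp add: le biclosed_def)
  have "wmeet n x y = z"
    unfolding wmeet_def
  proof (rule the_equality)
    fix u assume "u \<in> Bn n \<and> wle n u x \<and> wle n u y \<and>
       (\<forall>z\<in>Bn n. wle n z x \<and> wle n z y \<longrightarrow> wle n z u)"
    then show "u = z" using z(1) lower greatest[of u] by (blast intro: wle_antisym)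
  qed (use z lower greatest in blast)
  then show "wmeet n x y \<in> Bn n" "Ninv n (wmeet n x y) = (Ninv n x \<union> Ninv n y)\<^sup>+"
    using z Nz by auto
qed

lemma wle_Ninv: "u \<in> Bn n \<Longrightarrow> v \<in> Bn n \<Longrightarrow> wle n u v \<longleftrightarrow> Ninv n v \<subseteq> Ninv n u"
  using Inv_subset_pairs[of n u] Inv_subset_pairs[of n v] by (auto simp: wle_iff Ninv_def)

lemma wmeet_lower:
  assumes "x \<in> Bn n" "y \<in> Bn n"
  shows "wle n (wmeet n x y) x" "wle n (wmeet n x y) y"
  using wmeet_Ninv[OF assms] assms by (auto simp: wle_Ninv)

lemma wmeet_absorb:
  assumes "x \<in> Bn n" "y \<in> Bn n" "wle n x y"
  shows "wmeet n x y = x" "wmeet n y x = x"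
proof -
  have "Ninv n x \<union> Ninv n y = Ninv n x" using assms by (auto simp: wle_Ninv)
  moreover have "(Ninv n x)\<^sup>+ = Ninv n x"
    using biclosed_compl[OF biclosed_Inv[OF assms(1)]] by (simp add: Ninv_def biclosed_def)
  ultimately have "Ninv n (wmeet n x y) = Ninv n x" "Ninv n (wmeet n y x) = Ninv n x"
    using wmeet_Ninv[OF assms(1,2)] wmeet_Ninv[OF assms(2,1)] by (auto simp: Un_commute)
  then show "wmeet n x y = x" "wmeet n y x = x"
    using wmeet_Ninv(1)[OF assms(1,2)] wmeet_Ninv(1)[OF assms(2,1)] assms
    by (auto intro!: wle_antisym simp: wle_Ninv)
qed

lemma wjoin_absorb:
  assumes "x \<in> Bn n" "y \<in> Bn n" "wle n x y"
  shows "wjoin n x y = y" "wjoin n y x = y"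
proof -
  have "Inv n x \<union> Inv n y = Inv n y" using assms by (auto simp: wle_iff)
  moreover have "(Inv n y)\<^sup>+ = Inv n y"
    using biclosed_Inv[OF assms(2)] by (simp add: biclosed_def)
  ultimately have "Inv n (wjoin n x y) = Inv n y" "Inv n (wjoin n y x) = Inv n y"
    using wjoin_Inv[OF assms(1,2)] wjoin_Inv[OF assms(2,1)] by (auto simp: Un_commute)
  then show "wjoin n x y = y" "wjoin n y x = y"
    using wjoin_Inv(1)[OF assms(1,2)] wjoin_Inv(1)[OF assms(2,1)] assms
    by (auto intro!: wle_antisym simp: wle_iff)
qed

section \<open>Monotone paths and their edges\<close>

lemma poly_verts_iff: "i \<in> poly_verts n \<longleftrightarrow> i \<noteq> 0 \<and> \<bar>i\<bar> \<le> int n + 1"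
  by (auto simp: poly_verts_def)

lemma poly_verts_between:
  "u \<in> poly_verts n \<Longrightarrow> w \<in> poly_verts n \<Longrightarrow> q \<in> poly_verts n \<Longrightarrow> u < q \<Longrightarrow> q < w \<Longrightarrow> q \<in> signed_idx n"
  by (auto simp: poly_verts_iff signed_idx_iff)

lemma signed_idx_poly_verts: "i \<in> signed_idx n \<Longrightarrow> i \<in> poly_verts n"
  by (auto simp: poly_verts_iff signed_idx_iff)

lemma finite_poly_verts [simp]: "finite (poly_verts n)"
proof -
  have "poly_verts n = signed_idx (Suc n)" by (auto simp: poly_verts_iff signed_idx_iff)
  then show ?thesis by simp
qed

text \<open>An order on the labels given by \<open>pos\<close> turns the lower boundary of the polygon into the
  upper one by deleting down vertices and inserting up vertices in this order. A segment \<open>uw\<close> lies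
  on one of the intermediate paths iff all labels in \<open>bef up u w\<close> precede all other labels
  from \<open>u\<close> to \<open>w\<close>.\<close>

definition bef :: "(int \<Rightarrow> bool) \<Rightarrow> int \<Rightarrow> int \<Rightarrow> int \<Rightarrow> bool" where
  "bef up u w i \<longleftrightarrow> (up i \<longleftrightarrow> i = u \<or> i = w)"

definition path_edges :: "nat \<Rightarrow> (int \<Rightarrow> bool) \<Rightarrow> (int \<Rightarrow> int) \<Rightarrow> (int \<times> int) set" where
  "path_edges n up pos = {(u, w). u \<in> poly_verts n \<and> w \<in> poly_verts n \<and> u < w \<and>
     (\<forall>i\<in>signed_idx n \<inter> {u..w}. \<forall>j\<in>signed_idx n \<inter> {u..w}.
        bef up u w i \<longrightarrow> \<not> bef up u w j \<longrightarrow> pos i < pos j)}"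

lemma path_edgesD:
  assumes "(u, w) \<in> path_edges n up pos"
  shows "u \<in> poly_verts n" "w \<in> poly_verts n" "u < w"
    and "i \<in> signed_idx n \<Longrightarrow> j \<in> signed_idx n \<Longrightarrow> u \<le> i \<Longrightarrow> i \<le> w \<Longrightarrow> u \<le> j \<Longrightarrow> j \<le> w \<Longrightarrow>
      bef up u w i \<Longrightarrow> \<not> bef up u w j \<Longrightarrow> pos i < pos j"
  using assms by (auto simp: path_edges_def)

lemma path_edgesI:
  assumes "u \<in> poly_verts n" "w \<in> poly_verts n" "u < w"
    and "\<And>i j. i \<in> signed_idx n \<Longrightarrow> j \<in> signed_idx n \<Longrightarrow> u \<le> i \<Longrightarrow> i \<le> w \<Longrightarrow> u \<le> j \<Longrightarrow> j \<le> w \<Longrightarrow>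
      bef up u w i \<Longrightarrow> \<not> bef up u w j \<Longrightarrow> pos i < pos j"
  shows "(u, w) \<in> path_edges n up pos"
  using assms by (simp add: path_edges_def)

text \<open>The path at time \<open>t\<close>: the up vertices already inserted and the down
  vertices not yet deleted. The vertices \<open>n + 1\<close> and \<open>- n - 1\<close> carry no
  position and belong to every path.\<close>

definition on_path :: "nat \<Rightarrow> (int \<Rightarrow> bool) \<Rightarrow> (int \<Rightarrow> int) \<Rightarrow> int \<Rightarrow> int set" where
  "on_path n up pos t = {i \<in> poly_verts n. i \<in> signed_idx n \<longrightarrow> (up i \<longleftrightarrow> pos i \<le> t)}"

definition consecutive :: "int set \<Rightarrow> int \<Rightarrow> int \<Rightarrow> bool" where
  "consecutive S u w \<longleftrightarrow> u \<in> S \<and> w \<in> S \<and> u < w \<and> S \<inter> {u<..<w} = {}"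

lemma finite_on_path [simp]: "finite (on_path n up pos t)"
  by (simp add: on_path_def)

lemma on_path_ends: "- int n - 1 \<in> on_path n up pos t" "int n + 1 \<in> on_path n up pos t"
  by (auto simp: on_path_def poly_verts_iff signed_idx_iff)

text \<open>Endpoints of an edge are on the path and inner labels are not; \<open>bef\<close> is
  chosen so that in both cases it says that the label has been processed by time
  \<open>t\<close>.\<close>

lemma consecutive_bef:
  assumes "consecutive (on_path n up pos t) u w" "i \<in> signed_idx n" "u \<le> i" "i \<le> w"
  shows "bef up u w i \<longleftrightarrow> pos i \<le> t"
proof (cases "i = u \<or> i = w")
  case True
  then show ?thesis using assms by (auto simp: bef_def consecutive_def on_path_def)
next
  case False
  then have "i \<notin> on_path n up pos t" using assms by (auto simp: consecutive_def)
  then show ?thesis using False assms signed_idx_poly_verts[of i n]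
    by (auto simp: bef_def on_path_def)
qed

lemma consecutive_path_edge:
  assumes "consecutive (on_path n up pos t) u w"
  shows "(u, w) \<in> path_edges n up pos"
proof -
  have "u \<in> poly_verts n" "w \<in> poly_verts n" "u < w"
    using assms by (auto simp: consecutive_def on_path_def)
  then show ?thesis
    using consecutive_bef[OF assms] by (fastforce simp: path_edges_def)
qed

lemma consecutive_around:
  assumes "finite S" "l \<in> S" "r \<in> S" "l \<le> p" "p < q" "q \<le> r" "S \<inter> {p<..<q} = {}"
  shows "\<exists>u w. consecutive S u w \<and> l \<le> u \<and> u \<le> p \<and> q \<le> w \<and> w \<le> r"
proof -
  define u where "u = Max {s \<in> S. s \<le> p}"
  define w where "w = Min {s \<in> S. q \<le> s}"
  have fin: "finite {s \<in> S. s \<le> p}" "finite {s \<in> S. q \<le> s}" using assms by auto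
  have ne: "l \<in> {s \<in> S. s \<le> p}" "r \<in> {s \<in> S. q \<le> s}" using assms by auto
  have u: "u \<in> S" "u \<le> p" "l \<le> u" and w: "w \<in> S" "q \<le> w" "w \<le> r"
    using Max_in[OF fin(1)] Min_in[OF fin(2)] Max_ge[OF fin(1) ne(1)] Min_le[OF fin(2) ne(2)] ne
    by (auto simp: u_def w_def)
  have "s \<notin> S" if "u < s" "s < w" for s
  proof
    assume "s \<in> S"
    then have "\<not> s \<le> p" "\<not> q \<le> s"
      using that Max_ge[OF fin(1), of s] Min_le[OF fin(2), of s] by (auto simp: u_def w_def)
    then show False using \<open>s \<in> S\<close> assms(7) by auto
  qed
  then have "consecutive S u w" using u w assms(5) by (auto simp: consecutive_def)
  then show ?thesis using u w by blast
qed

lemma consecutive_transition: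
  assumes "finite S" "l \<in> S" "r \<in> S" "l < r" "P l" "\<not> P r"
  shows "\<exists>u w. consecutive S u w \<and> l \<le> u \<and> w \<le> r \<and> P u \<and> \<not> P w"
proof -
  define p where "p = Max {s \<in> S. s < r \<and> l \<le> s \<and> P s}"
  have fin: "finite {s \<in> S. s < r \<and> l \<le> s \<and> P s}" using assms by auto
  have "p \<in> {s \<in> S. s < r \<and> l \<le> s \<and> P s}"
    unfolding p_def using assms by (intro Max_in[OF fin]) auto
  then have p: "p \<in> S" "p < r" "l \<le> p" "P p" by auto
  have "S \<inter> {p<..<p + 1} = {}" by auto
  from consecutive_around[OF assms(1) p(1) assms(3) order_refl _ _ this] p(2)
  obtain u w where uw: "consecutive S u w" "p \<le> u" "u \<le> p" "p + 1 \<le> w" "w \<le> r" by auto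
  have "\<not> P w"
  proof
    assume "P w"
    then have "w \<in> {s \<in> S. s < r \<and> l \<le> s \<and> P s}"
      using uw p assms by (auto simp: consecutive_def order_le_less)
    then have "w \<le> p" unfolding p_def by (rule Max_ge[OF fin])
    then show False using uw by simp
  qed
  moreover have "u = p" using uw by simp
  ultimately show ?thesis using uw p by blast
qed

text \<open>The cases are the nested and the interleaved orders of the four endpoints. Only the
  sides of the two inner endpoints enter, and these are never the vertices on the axis.\<close>

definition xing :: "(int \<Rightarrow> bool) \<Rightarrow> int \<Rightarrow> int \<Rightarrow> int \<Rightarrow> int \<Rightarrow> bool" where
  "xing up u w u' w' \<longleftrightarrow>
     u < u' \<and> u' < w' \<and> w' < w \<and> up u' \<noteq> up w' \<or>
     u' < u \<and> u < w \<and> w < w' \<and> up u \<noteq> up w \<or>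
     u < u' \<and> u' < w \<and> w < w' \<and> up u' = up w \<or>
     u' < u \<and> u < w' \<and> w' < w \<and> up u = up w'"

lemma xing_sym: "xing up u w u' w' \<longleftrightarrow> xing up u' w' u w"
  unfolding xing_def by blast

text \<open>From each case of \<open>xing\<close>, the half in which the second chord is the steeper
  one; see \<open>xing_up_slope\<close>.\<close>

definition xing_up :: "(int \<Rightarrow> bool) \<Rightarrow> int \<Rightarrow> int \<Rightarrow> int \<Rightarrow> int \<Rightarrow> bool" where
  "xing_up up u w u' w' \<longleftrightarrow>
     u < u' \<and> u' < w' \<and> w' < w \<and> \<not> up u' \<and> up w' \<or>
     u' < u \<and> u < w \<and> w < w' \<and> up u \<and> \<not> up w \<or>
     u < u' \<and> u' < w \<and> w < w' \<and> \<not> up u' \<and> \<not> up w \<or>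
     u' < u \<and> u < w' \<and> w' < w \<and> up u \<and> up w'"

lemma xing_up_cases: "xing up u w u' w' \<Longrightarrow> xing_up up u w u' w' \<or> xing_up up u' w' u w"
  unfolding xing_def xing_up_def by argo

lemma xing_up_xing: "xing_up up u w u' w' \<Longrightarrow> xing up u w u' w'"
  unfolding xing_def xing_up_def by argo

text \<open>The witnesses are the two inner endpoints. The less steep chord demands them in
  increasing order and the steeper one demands them inverted; this ties slopes to the weak
  order.\<close>

lemma xing_up_bef:
  assumes "xing_up up u w u' w'" "u \<in> poly_verts n" "w \<in> poly_verts n" "u' \<in> poly_verts n" "w' \<in> poly_verts n"
  obtains q r where "q \<in> signed_idx n" "r \<in> signed_idx n" "q < r"
    "u \<le> q" "r \<le> w" "u' \<le> q" "r \<le> w'"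
    "bef up u w q" "\<not> bef up u w r" "\<not> bef up u' w' q" "bef up u' w' r"
proof -
  have "\<exists>q r. q \<in> signed_idx n \<and> r \<in> signed_idx n \<and> q < r \<and>
    u \<le> q \<and> r \<le> w \<and> u' \<le> q \<and> r \<le> w' \<and>
    bef up u w q \<and> \<not> bef up u w r \<and> \<not> bef up u' w' q \<and> bef up u' w' r"
    using assms(1) unfolding xing_up_def
  proof (elim disjE conjE)
    assume "u < u'" "u' < w'" "w' < w" "\<not> up u'" "up w'"
    moreover from this have "u' \<in> signed_idx n" "w' \<in> signed_idx n"
      using assms(2-5) unfolding signed_idx_iff poly_verts_iff by linarith+
    ultimately show ?thesis by (intro exI[of _ u'] exI[of _ w']) (simp add: bef_def)
  next
    assume "u' < u" "u < w" "w < w'" "up u" "\<not> up w"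
    moreover from this have "u \<in> signed_idx n" "w \<in> signed_idx n"
      using assms(2-5) unfolding signed_idx_iff poly_verts_iff by linarith+
    ultimately show ?thesis by (intro exI[of _ u] exI[of _ w]) (simp add: bef_def)
  next
    assume "u < u'" "u' < w" "w < w'" "\<not> up u'" "\<not> up w"
    moreover from this have "u' \<in> signed_idx n" "w \<in> signed_idx n"
      using assms(2-5) unfolding signed_idx_iff poly_verts_iff by linarith+
    ultimately show ?thesis by (intro exI[of _ u'] exI[of _ w]) (simp add: bef_def)
  next
    assume "u' < u" "u < w'" "w' < w" "up u" "up w'"
    moreover from this have "u \<in> signed_idx n" "w' \<in> signed_idx n"
      using assms(2-5) unfolding signed_idx_iff poly_verts_iff by linarith+
    ultimately show ?thesis by (intro exI[of _ u] exI[of _ w']) (simp add: bef_def)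
  qed
  then show ?thesis using that by blast
qed

lemma xing_bef:
  assumes "xing up u w u' w'" "u \<in> poly_verts n" "w \<in> poly_verts n" "u' \<in> poly_verts n" "w' \<in> poly_verts n"
  obtains q r where "q \<in> signed_idx n" "r \<in> signed_idx n" "q < r"
    "u \<le> q" "r \<le> w" "u' \<le> q" "r \<le> w'"
    "bef up u w q = bef up u' w' r" "bef up u w r = bef up u' w' q" "bef up u w q \<noteq> bef up u w r"
  using xing_up_cases[OF assms(1)]
proof
  assume "xing_up up u w u' w'"
  from xing_up_bef[OF this assms(2-5)] show ?thesis using that by metis
next
  assume "xing_up up u' w' u w"
  from xing_up_bef[OF this assms(4,5,2,3)] show ?thesis using that by metis
qed

text \<open>A label demanded early by one chord and late by the other is an endpoint of exactly one
  of them and strictly inside the other.\<close>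

lemma bef_xing:
  assumes "q < r" "u \<le> q" "r \<le> w" "u' \<le> q" "r \<le> w'"
    "\<not> bef up u w q" "bef up u w r" "bef up u' w' q" "\<not> bef up u' w' r"
  shows "xing up u w u' w'"
proof -
  have "q \<noteq> w" "q \<noteq> w'" "r \<noteq> u" "r \<noteq> u'" using assms(1-5) by auto
  then have "up q \<longleftrightarrow> q \<noteq> u" "up q \<longleftrightarrow> q = u'" "up r \<longleftrightarrow> r = w" "up r \<longleftrightarrow> r \<noteq> w'"
    using assms(6-9) by (auto simp: bef_def)
  then have q: "up q \<and> u < q \<and> u' = q \<or> \<not> up q \<and> u = q \<and> u' < q"
    and r: "up r \<and> w = r \<and> r < w' \<or> \<not> up r \<and> r < w \<and> w' = r"
    using assms(1-5) by fastforce+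
  show ?thesis using q r assms(1) unfolding xing_def by blast
qed

lemma path_edges_noncrossing:
  assumes "(u, w) \<in> path_edges n up pos" "(u', w') \<in> path_edges n up pos"
  shows "\<not> xing up u w u' w'"
proof
  assume "xing up u w u' w'"
  then obtain q r where qr: "q \<in> signed_idx n" "r \<in> signed_idx n" "q < r"
    "u \<le> q" "r \<le> w" "u' \<le> q" "r \<le> w'"
    "bef up u w q = bef up u' w' r" "bef up u w r = bef up u' w' q" "bef up u w q \<noteq> bef up u w r"
    using xing_bef path_edgesD(1,2)[OF assms(1)] path_edgesD(1,2)[OF assms(2)] by metis
  show False
  proof (cases "bef up u w q")
    case True
    then have "pos q < pos r" using qr by (intro path_edgesD(4)[OF assms(1)]) auto
    moreover have "pos r < pos q" using True qr by (intro path_edgesD(4)[OF assms(2)]) auto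
    ultimately show False by simp
  next
    case False
    then have "pos r < pos q" using qr by (intro path_edgesD(4)[OF assms(1)]) auto
    moreover have "pos q < pos r" using False qr by (intro path_edgesD(4)[OF assms(2)]) auto
    ultimately show False by simp
  qed
qed

text \<open>Here \<open>S\<close> is a path at a time when \<open>j\<close> has been processed and
  \<open>i\<close> has not, although the chord \<open>uw\<close> demands the contrary. If all
  vertices of \<open>S\<close> strictly between \<open>u\<close> and \<open>w\<close> are up, then
  \<open>i\<close> must be an up endpoint of the chord missing from \<open>S\<close>, and the edge
  of \<open>S\<close> passing \<open>i\<close> crosses the chord.\<close>

lemma consecutive_crossing:
  assumes fin: "finite S" and ends: "l \<in> S" "r \<in> S" "l \<le> u" "w \<le> r" "u < w"
    and ibound: "l < i" "i < r"
    and iS: "i \<in> S \<longleftrightarrow> \<not> up i" and jS: "j \<in> S \<longleftrightarrow> up j"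
    and i: "if up i then i = u \<or> i = w else u < i \<and> i < w"
    and j: "if up j then u < j \<and> j < w else j = u \<or> j = w"
    and up: "\<forall>s\<in>S \<inter> {u<..<w}. up s"
  shows "\<exists>y z. consecutive S y z \<and> xing up u w y z"
proof -
  define S' where "S' = S \<inter> {u<..<w}"
  note up = up[folded S'_def]
  have upi: "up i"
  proof (rule ccontr)
    assume "\<not> up i"
    then have "i \<in> S'" using iS i by (simp add: S'_def)
    then show False using up \<open>\<not> up i\<close> by blast
  qed
  then have inS: "i \<notin> S" and iuw: "i = u \<or> i = w" using iS i by auto
  have jcase: "j \<in> S' \<or> (j = u \<or> j = w) \<and> j \<notin> S \<and> \<not> up j"
    using jS j by (auto simp: S'_def split: if_splits)
  obtain y z where yz: "consecutive S y z" "y < i" "i < z"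
    "(\<forall>s\<in>S'. y < s \<longrightarrow> z \<le> s) \<and> (\<forall>s\<in>S'. s < z \<longrightarrow> s \<le> y)"
  proof -
    have "S \<inter> {i - 1<..<i + 1} = {}"
    proof -
      have "{i - 1<..<i + 1} = {i}" by auto
      then show ?thesis using inS by simp
    qed
    from consecutive_around[OF fin ends(1,2) _ _ _ this] ibound
    obtain y z where "consecutive S y z" "y \<le> i - 1" "i + 1 \<le> z" by auto
    then show ?thesis using that[of y z] by (fastforce simp: consecutive_def S'_def)
  qed
  have yzS: "y \<in> S" "z \<in> S" using yz(1) by (auto simp: consecutive_def)
  show ?thesis
  proof (cases "S' = {}")
    \<comment> \<open>With no vertex of \<open>S\<close> in between, the edge spans the whole chord,
      whose other endpoint is then \<open>j\<close>, a down label.\<close>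
    case True
    then have jj: "j = u \<or> j = w" "j \<notin> S" "\<not> up j" using jcase by auto
    have "y \<notin> {u<..<w}" "z \<notin> {u<..<w}" "y \<noteq> j" "z \<noteq> j" using True yzS jj(2) by (auto simp: S'_def)
    then have "y < u" "w < z" using iuw yz jj upi ends(5) by auto
    moreover have "up u \<noteq> up w" using iuw jj upi by auto
    ultimately show ?thesis using yz(1) ends(5) unfolding xing_def by blast
  next
    case False
    then obtain s where s: "s \<in> S'" by blast
    then have sb: "u < s" "s < w" by (auto simp: S'_def)
    show ?thesis
    proof (cases "i = u")
      case True
      then have "z \<le> s" using yz s sb by auto
      then have "z \<in> S'" using yz yzS sb True by (auto simp: S'_def)
      then have "up z" using up by blast
      then show ?thesis using yz True \<open>z \<le> s\<close> sb upi unfolding xing_def by (intro exI[of _ y] exI[of _ z]) auto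
    next
      case False
      then have iw: "i = w" using iuw by blast
      then have "s \<le> y" using yz s sb by auto
      then have "y \<in> S'" using yz yzS sb iw by (auto simp: S'_def)
      then have "up y" using up by blast
      then show ?thesis using yz iw \<open>s \<le> y\<close> sb upi unfolding xing_def by (intro exI[of _ y] exI[of _ z]) auto
    qed
  qed
qed

text \<open>The crossing edge is found on the path at time \<open>pos j\<close>, where
  \<open>i\<close> and \<open>j\<close> violate a demand of the chord. The case of down vertices
  reduces to that of up vertices by exchanging the two sides and the roles of \<open>i\<close> and
  \<open>j\<close>.\<close>

lemma path_edges_maximal:
  assumes inj: "inj_on pos (signed_idx n)"
    and uw: "u \<in> poly_verts n" "w \<in> poly_verts n" "u < w" "(u, w) \<notin> path_edges n up pos"
  obtains u' w' where "(u', w') \<in> path_edges n up pos" "xing up u w u' w'"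
proof -
  obtain i j where ij: "i \<in> signed_idx n" "j \<in> signed_idx n" "u \<le> i" "i \<le> w" "u \<le> j" "j \<le> w"
    "bef up u w i" "\<not> bef up u w j" "\<not> pos i < pos j"
    using uw by (auto simp: path_edges_def)
  have "pos i \<noteq> pos j" using inj ij by (metis inj_onD)
  then have less: "pos j < pos i" using ij by simp
  define S where "S = on_path n up pos (pos j)"
  have fin: "finite S" and ends: "- int n - 1 \<in> S" "int n + 1 \<in> S"
    by (auto simp: S_def on_path_ends)
  have iS: "i \<in> S \<longleftrightarrow> \<not> up i" and jS: "j \<in> S \<longleftrightarrow> up j"
    using ij less signed_idx_poly_verts by (auto simp: S_def on_path_def)
  have i: "if up i then i = u \<or> i = w else u < i \<and> i < w"
    and j: "if up j then u < j \<and> j < w else j = u \<or> j = w"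
    using ij by (auto simp: bef_def split: if_splits)
  have ibound: "- int n - 1 < i" "i < int n + 1" and jbound: "- int n - 1 < j" "j < int n + 1"
    using ij(1,2) by (auto simp: signed_idx_iff)
  have bounds: "- int n - 1 \<le> u" "w \<le> int n + 1" using uw by (auto simp: poly_verts_iff)
  have "\<exists>y z. consecutive S y z \<and> xing up u w y z"
  proof -
    define S' where "S' = S \<inter> {u<..<w}"
    consider (both) s s' where "s \<in> S'" "s' \<in> S'" "up s" "\<not> up s'"
      | (up) "\<forall>s\<in>S'. up s" | (down) "\<forall>s\<in>S'. \<not> up s" by blast
    then show ?thesis
    proof cases
      \<comment> \<open>The path passes from one side of the chord to the other between two
        consecutive vertices.\<close>
      case both
      have "\<exists>y z. consecutive S y z \<and> u < y \<and> z < w \<and> up y \<noteq> up z"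
      proof (cases "s < s'")
        case True
        then obtain y z where "consecutive S y z" "s \<le> y" "z \<le> s'" "up y" "\<not> up z"
          using consecutive_transition[of S s s' up] both fin by (auto simp: S'_def)
        then show ?thesis using both by (intro exI[of _ y] exI[of _ z]) (auto simp: S'_def)
      next
        case False
        with both have "s' < s" by (metis linorder_less_linear)
        then obtain y z where "consecutive S y z" "s' \<le> y" "z \<le> s" "\<not> up y" "up z"
          using consecutive_transition[of S s' s "\<lambda>i. \<not> up i"] both fin by (auto simp: S'_def)
        then show ?thesis using both by (intro exI[of _ y] exI[of _ z]) (auto simp: S'_def)
      qed
      then show ?thesis unfolding xing_def consecutive_def by blast
    next
      case up
      then show ?thesis
        using consecutive_crossing[OF fin ends bounds uw(3) ibound iS jS i j] by (simp add: S'_def)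
    next
      case down
      have dual: "xing (\<lambda>s. \<not> up s) u w y z = xing up u w y z" for y z by (simp add: xing_def)
      show ?thesis
      proof (rule consecutive_crossing[OF fin ends bounds uw(3) jbound, of "\<lambda>s. \<not> up s" i, unfolded dual])
        show "j \<in> S \<longleftrightarrow> \<not> \<not> up j" "i \<in> S \<longleftrightarrow> \<not> up i" using iS jS by auto
        show "if \<not> up j then j = u \<or> j = w else u < j \<and> j < w" using j by (cases "up j") simp_all
        show "if \<not> up i then u < i \<and> i < w else i = u \<or> i = w" using i by (cases "up i") simp_all
        show "\<forall>s\<in>S \<inter> {u<..<w}. \<not> up s" using down by (simp add: S'_def)
      qed
    qed
  qed
  then show ?thesis using that consecutive_path_edge unfolding S_def by blast
qed

section \<open>The path edges determine a lattice congruence\<close>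

text \<open>\<open>(a, c)\<close> is forced iff all inversions of the join-irreducible element associated with
  \<open>a < c\<close> are present: the minimal element in which \<open>c\<close> stands immediately before \<open>a\<close>, the
  down labels between them stand to the left and the up labels between them to the right.\<close>

definition forced :: "nat \<Rightarrow> (int \<Rightarrow> bool) \<Rightarrow> (int \<Rightarrow> int) \<Rightarrow> (int \<times> int) set" where
  "forced n up pos = {(a, c) \<in> idx_pairs n. \<forall>p\<in>signed_idx n. \<forall>q\<in>signed_idx n.
     a \<le> p \<longrightarrow> p < q \<longrightarrow> q \<le> c \<longrightarrow> p = a \<or> up p \<longrightarrow> q = c \<or> \<not> up q \<longrightarrow> pos q < pos p}"

lemma forcedD:
  assumes "(a, c) \<in> forced n up pos" "p \<in> signed_idx n" "q \<in> signed_idx n"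
    "a \<le> p" "p < q" "q \<le> c" "p = a \<or> up p" "q = c \<or> \<not> up q"
  shows "pos q < pos p"
  using assms unfolding forced_def by blast

text \<open>Labels strictly inside the chord are demanded early if down and late if up, which is
  their arrangement in the join-irreducible element of \<open>(q, r)\<close>.\<close>

lemma path_edge_forced:
  assumes e: "(u, w) \<in> path_edges n up pos" and qr: "q \<in> signed_idx n" "r \<in> signed_idx n" "q < r"
    "u \<le> q" "r \<le> w" "\<not> bef up u w q" "bef up u w r"
  shows "(q, r) \<in> forced n up pos"
proof -
  have "pos s < pos p" if "p \<in> signed_idx n" "s \<in> signed_idx n" "q \<le> p" "p < s" "s \<le> r"
    "p = q \<or> up p" "s = r \<or> \<not> up s" for p s
  proof (rule path_edgesD(4)[OF e])
    show "\<not> bef up u w p" "bef up u w s" using that qr by (auto simp: bef_def)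
  qed (use that qr in auto)
  then show ?thesis using qr by (simp add: forced_def idx_pairs_iff)
qed

text \<open>The path at time \<open>pos p0\<close> separates a pair standing in the wrong order. For
  a separated pair as close in value as possible, no vertex of that path lies in between, since it
  could replace \<open>p\<close> or \<open>q\<close>; hence a single edge spans both.\<close>

lemma not_forced_edge:
  assumes inj: "inj_on pos (signed_idx n)"
    and ac: "(a, c) \<in> idx_pairs n" "(a, c) \<notin> forced n up pos"
  obtains u w p q where "(u, w) \<in> path_edges n up pos"
    "p \<in> signed_idx n" "q \<in> signed_idx n" "a \<le> p" "p < q" "q \<le> c" "p = a \<or> up p" "q = c \<or> \<not> up q"
    "u \<le> p" "q \<le> w" "bef up u w p" "\<not> bef up u w q"
proof -
  obtain p0 q0 where pq0: "p0 \<in> signed_idx n" "q0 \<in> signed_idx n" "a \<le> p0" "p0 < q0" "q0 \<le> c"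
    "p0 = a \<or> up p0" "q0 = c \<or> \<not> up q0" "\<not> pos q0 < pos p0"
    using ac unfolding forced_def by blast
  have "pos p0 \<noteq> pos q0" using inj pq0 by (metis inj_onD order_less_irrefl)
  then have less: "pos p0 < pos q0" using pq0 by simp
  define t where "t = pos p0"
  define S where "S = on_path n up pos t"
  define A where "A p \<longleftrightarrow> p \<in> signed_idx n \<and> a \<le> p \<and> (p = a \<or> up p) \<and> pos p \<le> t" for p
  define B where "B q \<longleftrightarrow> q \<in> signed_idx n \<and> q \<le> c \<and> (q = c \<or> \<not> up q) \<and> t < pos q" for q
  have "A p0 \<and> B q0 \<and> p0 < q0" using pq0 less by (simp add: A_def B_def t_def)
  then obtain x where x: "A (fst x) \<and> B (snd x) \<and> fst x < snd x"
    and x_least: "\<And>y. A (fst y) \<and> B (snd y) \<and> fst y < snd y \<Longrightarrow>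
      nat (snd x - fst x) \<le> nat (snd y - fst y)"
    using ex_has_least_nat[of "\<lambda>x. A (fst x) \<and> B (snd x) \<and> fst x < snd x" "(p0, q0)"
      "\<lambda>x. nat (snd x - fst x)"] by auto
  obtain p q where "x = (p, q)" by fastforce
  then have pq: "A p" "B q" "p < q"
    and least: "\<And>p' q'. A p' \<Longrightarrow> B q' \<Longrightarrow> p' < q' \<Longrightarrow> nat (q - p) \<le> nat (q' - p')"
    using x x_least by fastforce+
  have "S \<inter> {p<..<q} = {}"
  proof (rule ccontr)
    assume "S \<inter> {p<..<q} \<noteq> {}"
    then obtain s where s: "s \<in> S" "p < s" "s < q" by auto
    have "s \<in> poly_verts n" using s by (simp add: S_def on_path_def)
    then have sI: "s \<in> signed_idx n"
      using poly_verts_between[of p n q s] pq s signed_idx_poly_verts by (auto simp: A_def B_def)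
    show False
    proof (cases "up s")
      case True
      then have "A s" using s pq sI by (auto simp: A_def S_def on_path_def)
      then show False using least[of s q] pq s by simp
    next
      case False
      then have "B s" using s pq sI by (auto simp: B_def S_def on_path_def)
      then show False using least[of p s] pq s by simp
    qed
  qed
  moreover have "- int n - 1 \<le> p" "q \<le> int n + 1"
    using pq by (auto simp: A_def B_def signed_idx_iff)
  ultimately obtain u w where uw: "consecutive S u w" "u \<le> p" "q \<le> w"
    using consecutive_around[of S "- int n - 1" "int n + 1" p q] pq(3)
    by (auto simp: S_def on_path_ends)
  have "bef up u w p" "\<not> bef up u w q"
    using consecutive_bef[OF uw(1)[unfolded S_def], of p] consecutive_bef[OF uw(1)[unfolded S_def], of q]
      pq uw by (auto simp: A_def B_def)
  then show ?thesis
    using that[of u w p q] consecutive_path_edge[OF uw(1)[unfolded S_def]] uw pq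
    by (auto simp: A_def B_def)
qed

lemma forced_antimono_edges:
  assumes "inj_on pos (signed_idx n)" and sub: "path_edges n up pos \<subseteq> path_edges n up pos'"
  shows "forced n up pos' \<subseteq> forced n up pos"
proof (rule subrelI, rule ccontr)
  fix a c assume f: "(a, c) \<in> forced n up pos'" "(a, c) \<notin> forced n up pos"
  then have "(a, c) \<in> idx_pairs n" by (simp add: forced_def)
  from not_forced_edge[OF assms(1) this f(2)]
  obtain u w p q where e: "(u, w) \<in> path_edges n up pos"
    "p \<in> signed_idx n" "q \<in> signed_idx n" "a \<le> p" "p < q" "q \<le> c" "p = a \<or> up p" "q = c \<or> \<not> up q"
    "u \<le> p" "q \<le> w" "bef up u w p" "\<not> bef up u w q" by metis
  then have "pos' p < pos' q" using sub path_edgesD(4)[of u w n up pos' p q] by auto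
  moreover have "pos' q < pos' p" using forcedD[OF f(1)] e by blast
  ultimately show False by simp
qed

text \<open>An edge of one order missing from the other is crossed by an edge of the latter. The
  contested pair is forced in the order whose edge demands the inversion, while the other edge
  demands the opposite; so the forced sets differ.\<close>

lemma path_edges_eq_iff_forced:
  assumes inj: "inj_on pos (signed_idx n)" "inj_on pos' (signed_idx n)"
  shows "path_edges n up pos = path_edges n up pos' \<longleftrightarrow> forced n up pos = forced n up pos'"
proof
  assume "path_edges n up pos = path_edges n up pos'"
  then show "forced n up pos = forced n up pos'"
    using forced_antimono_edges[of pos n up pos'] forced_antimono_edges[of pos' n up pos] inj by blast
next
  have sub: "path_edges n up pos1 \<subseteq> path_edges n up pos2"
    if eq: "forced n up pos1 = forced n up pos2" and inj2: "inj_on pos2 (signed_idx n)" for pos1 pos2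
  proof (rule subrelI, rule ccontr)
    fix u w assume e: "(u, w) \<in> path_edges n up pos1" "(u, w) \<notin> path_edges n up pos2"
    obtain u' w' where e': "(u', w') \<in> path_edges n up pos2" "xing up u w u' w'"
      using path_edges_maximal[OF inj2 path_edgesD(1-3)[OF e(1)] e(2)] by blast
    then obtain q r where qr: "q \<in> signed_idx n" "r \<in> signed_idx n" "q < r"
      "u \<le> q" "r \<le> w" "u' \<le> q" "r \<le> w'"
      "bef up u w q = bef up u' w' r" "bef up u w r = bef up u' w' q" "bef up u w q \<noteq> bef up u w r"
      using xing_bef path_edgesD(1,2)[OF e(1)] path_edgesD(1,2)[OF e'(1)] by metis
    show False
    proof (cases "bef up u w q")
      case True
      then have "(q, r) \<in> forced n up pos2"
        using qr by (intro path_edge_forced[OF e'(1)]) auto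
      then have "pos1 r < pos1 q" unfolding eq[symmetric] using forcedD[of q r n up pos1 q r] qr by blast
      moreover have "pos1 q < pos1 r"
        using True qr by (intro path_edgesD(4)[OF e(1)]) auto
      ultimately show False by simp
    next
      case False
      then have "(q, r) \<in> forced n up pos1"
        using qr by (intro path_edge_forced[OF e(1)]) auto
      then have "pos2 r < pos2 q" unfolding eq using forcedD[of q r n up pos2 q r] qr by blast
      moreover have "pos2 q < pos2 r"
        using False qr by (intro path_edgesD(4)[OF e'(1)]) auto
      ultimately show False by simp
    qed
  qed
  assume "forced n up pos = forced n up pos'"
  then show "path_edges n up pos = path_edges n up pos'"
    using sub[of pos pos'] sub[of pos' pos] inj by blast
qed

text \<open>Reversing the order and exchanging up and down does not change the paths, but turns
  joins into meets.\<close>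

lemma path_edges_dual: "path_edges n (\<lambda>i. \<not> up i) (\<lambda>i. - pos i) = path_edges n up pos"
proof -
  have "bef (\<lambda>i. \<not> up i) u w i \<longleftrightarrow> \<not> bef up u w i" for u w i by (auto simp: bef_def)
  then show ?thesis unfolding path_edges_def by auto
qed

text \<open>Locates the link at which a chain leaves \<open>P\<close>; this is how demands are
  checked on transitive closures.\<close>

lemma trancl_step_out:
  assumes "(p, q) \<in> R\<^sup>+" "P p" "\<not> P q" and mono: "\<And>x y. (x, y) \<in> R \<Longrightarrow> x < (y :: int)"
  shows "\<exists>p' q'. (p', q') \<in> R \<and> P p' \<and> \<not> P q' \<and> p \<le> p' \<and> q' \<le> q"
  using assms(1,3)
proof (induction rule: trancl_induct)
  case (base y)
  then show ?case using assms(2) by blast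
next
  case (step y z)
  have "p < y" using step(1) by (induction rule: trancl_induct) (auto dest: mono)
  show ?case
  proof (cases "P y")
    case True
    then show ?thesis using step \<open>p < y\<close> by (meson order_less_imp_le order_refl)
  next
    case False
    then show ?thesis using step mono[OF step(2)] by (meson order_trans order_less_imp_le)
  qed
qed

lemma forced_trancl:
  assumes R: "\<And>x y. (x, y) \<in> R \<Longrightarrow> (x, y) \<in> idx_pairs n"
    and ac: "(a, c) \<in> idx_pairs n" and pq: "a \<le> p" "p < q" "q \<le> c" "p = a \<or> up p" "q = c \<or> \<not> up q"
    and tr: "(p, q) \<in> R\<^sup>+"
  obtains p' q' where "(p', q') \<in> R" "p' \<in> signed_idx n" "q' \<in> signed_idx n" "a \<le> p'" "p' < q'" "q' \<le> c"
    "p' = a \<or> up p'" "q' = c \<or> \<not> up q'"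
proof -
  \<comment> \<open>\<open>p\<close> satisfies \<open>P\<close> and \<open>q\<close> does not, and
    the link leaving \<open>P\<close> again joins two labels that \<open>forced\<close>
    compares.\<close>
  define P where "P z \<longleftrightarrow> z \<noteq> c \<and> (z = p \<or> up z)" for z
  have "P p" "\<not> P q" using pq by (auto simp: P_def)
  from trancl_step_out[of p q R P, OF tr this] R
  obtain p' q' where pq': "(p', q') \<in> R" "P p'" "\<not> P q'" "p \<le> p'" "q' \<le> q"
    by (auto simp: idx_pairs_iff)
  have "p' \<in> signed_idx n" "q' \<in> signed_idx n" "p' < q'" using R[OF pq'(1)] by (auto simp: idx_pairs_iff)
  then show ?thesis using that[of p' q'] pq pq' by (auto simp: P_def)
qed

lemma inj_inv: "w \<in> Bn n \<Longrightarrow> inj_on (inv w) A"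
  by (simp add: inj_on_def)

text \<open>Stated for arbitrary positions to serve both operations: meets with the non-inversions
  as relations, joins with the inversions and negated positions.\<close>

lemma forced_Int:
  assumes iff: "\<And>p q. p \<in> signed_idx n \<Longrightarrow> q \<in> signed_idx n \<Longrightarrow> p < q \<Longrightarrow> pos q < pos p \<longleftrightarrow> (p, q) \<notin> R"
      "\<And>p q. p \<in> signed_idx n \<Longrightarrow> q \<in> signed_idx n \<Longrightarrow> p < q \<Longrightarrow> pos' q < pos' p \<longleftrightarrow> (p, q) \<notin> R'"
      "\<And>p q. p \<in> signed_idx n \<Longrightarrow> q \<in> signed_idx n \<Longrightarrow> p < q \<Longrightarrow> pos'' q < pos'' p \<longleftrightarrow> (p, q) \<notin> (R \<union> R')\<^sup>+"
    and R: "R \<union> R' \<subseteq> idx_pairs n"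
  shows "forced n up pos'' = forced n up pos \<inter> forced n up pos'"
proof (intro set_eqI iffI)
  fix e assume "e \<in> forced n up pos''"
  then show "e \<in> forced n up pos \<inter> forced n up pos'"
    using iff r_into_trancl[of _ _ "R \<union> R'"] unfolding forced_def by (cases e) blast
next
  fix e assume e: "e \<in> forced n up pos \<inter> forced n up pos'"
  obtain a c where ac: "e = (a, c)" by fastforce
  have pair: "(a, c) \<in> idx_pairs n" using e by (simp add: ac forced_def)
  have "pos'' q < pos'' p" if pq: "p \<in> signed_idx n" "q \<in> signed_idx n" "a \<le> p" "p < q" "q \<le> c"
    "p = a \<or> up p" "q = c \<or> \<not> up q" for p q
  proof (rule ccontr)
    assume "\<not> pos'' q < pos'' p"
    then have tr: "(p, q) \<in> (R \<union> R')\<^sup>+" using iff(3) pq by blast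
    obtain p' q' where
      "(p', q') \<in> R \<union> R'" "p' \<in> signed_idx n" "q' \<in> signed_idx n" "a \<le> p'" "p' < q'" "q' \<le> c"
      "p' = a \<or> up p'" "q' = c \<or> \<not> up q'" by (rule forced_trancl[OF subsetD[OF R] pair pq(3-7) tr])
    moreover from this have "pos q' < pos p'" "pos' q' < pos' p'"
      using e forcedD[of a c n up pos p' q'] forcedD[of a c n up pos' p' q'] unfolding ac by blast+
    ultimately show False using iff(1,2) by blast
  qed
  then show "e \<in> forced n up pos''" using pair unfolding ac forced_def by blast
qed

lemma forced_wmeet:
  assumes x: "x \<in> Bn n" and y: "y \<in> Bn n"
  shows "forced n up (inv (wmeet n x y)) = forced n up (inv x) \<inter> forced n up (inv y)"
proof -
  have iff: "inv w q < inv w p \<longleftrightarrow> (p, q) \<notin> Ninv n w"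
    if "p \<in> signed_idx n" "q \<in> signed_idx n" "p < q" "w \<in> Bn n" for p q w
    using that inv_eq_iff[OF that(4), of p q] by (auto simp: Ninv_iff simp del: inv_eq_iff)
  note m = wmeet_Ninv[OF x y]
  show ?thesis
  proof (rule forced_Int)
    show "Ninv n x \<union> Ninv n y \<subseteq> idx_pairs n" by (auto simp: Ninv_def)
  qed (use iff x y m(1) in \<open>simp_all flip: m(2)\<close>)
qed

lemma forced_wjoin:
  assumes x: "x \<in> Bn n" and y: "y \<in> Bn n"
  shows "forced n up (\<lambda>i. - inv (wjoin n x y) i) = forced n up (\<lambda>i. - inv x i) \<inter> forced n up (\<lambda>i. - inv y i)"
proof -
  have iff: "- inv w q < - inv w p \<longleftrightarrow> (p, q) \<notin> Inv n w"
    if "p \<in> signed_idx n" "q \<in> signed_idx n" "p < q" "w \<in> Bn n" for p q w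
    using that inv_eq_iff[OF that(4), of p q] by (auto simp: Inv_iff simp del: inv_eq_iff)
  note m = wjoin_Inv[OF x y]
  show ?thesis
  proof (rule forced_Int)
    show "Inv n x \<union> Inv n y \<subseteq> idx_pairs n" using Inv_subset_pairs by blast
  qed (use iff x y m(1) in \<open>simp_all only: flip: m(2)\<close>)
qed

definition bn_edges :: "nat \<Rightarrow> (int \<Rightarrow> bool) \<Rightarrow> (int \<Rightarrow> int) \<Rightarrow> (int \<times> int) set" where
  "bn_edges n up w = path_edges n up (inv w)"

definition edge_cong :: "nat \<Rightarrow> (int \<Rightarrow> bool) \<Rightarrow> ((int \<Rightarrow> int) \<times> (int \<Rightarrow> int)) set" where
  "edge_cong n up = {(x, y). x \<in> Bn n \<and> y \<in> Bn n \<and> bn_edges n up x = bn_edges n up y}"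

text \<open>Two descriptions of one equivalence: the first is preserved by meets, the second,
  obtained through \<open>path_edges_dual\<close>, by joins.\<close>

lemma bn_edges_eq_iff:
  assumes "x \<in> Bn n" "y \<in> Bn n"
  shows "bn_edges n up x = bn_edges n up y \<longleftrightarrow> forced n up (inv x) = forced n up (inv y)"
    and "bn_edges n up x = bn_edges n up y \<longleftrightarrow>
      forced n (\<lambda>i. \<not> up i) (\<lambda>i. - inv x i) = forced n (\<lambda>i. \<not> up i) (\<lambda>i. - inv y i)"
proof -
  show "bn_edges n up x = bn_edges n up y \<longleftrightarrow> forced n up (inv x) = forced n up (inv y)"
    using path_edges_eq_iff_forced inj_inv assms by (simp add: bn_edges_def)
  have "inj_on (\<lambda>i. - inv x i) (signed_idx n)" "inj_on (\<lambda>i. - inv y i) (signed_idx n)"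
    using assms by (auto simp: inj_on_def)
  from path_edges_eq_iff_forced[OF this, of "\<lambda>i. \<not> up i"]
  show "bn_edges n up x = bn_edges n up y \<longleftrightarrow>
      forced n (\<lambda>i. \<not> up i) (\<lambda>i. - inv x i) = forced n (\<lambda>i. \<not> up i) (\<lambda>i. - inv y i)"
    unfolding path_edges_dual bn_edges_def .
qed

lemma lattice_cong_edge_cong: "lattice_cong n (edge_cong n up)"
  unfolding lattice_cong_def
proof (intro conjI allI impI)
  show "equiv (Bn n) (edge_cong n up)"
    by (rule equivI) (auto simp: edge_cong_def refl_on_def sym_def trans_def)
  fix x y z assume xy: "(x, y) \<in> edge_cong n up" and z: "z \<in> Bn n"
  then have x: "x \<in> Bn n" and y: "y \<in> Bn n" and eq: "bn_edges n up x = bn_edges n up y"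
    by (auto simp: edge_cong_def)
  note in_Bn = wjoin_Inv(1)[OF x z] wjoin_Inv(1)[OF y z] wmeet_Ninv(1)[OF x z] wmeet_Ninv(1)[OF y z]
  show "(wjoin n x z, wjoin n y z) \<in> edge_cong n up"
    using eq in_Bn by (simp add: edge_cong_def bn_edges_eq_iff(2) forced_wjoin x y z)
  show "(wmeet n x z, wmeet n y z) \<in> edge_cong n up"
    using eq in_Bn by (simp add: edge_cong_def bn_edges_eq_iff(1) forced_wmeet x y z)
qed

section \<open>Persistence of edges in intervals and meets\<close>

lemma bn_edgesD:
  assumes "(u, w) \<in> bn_edges n up x" "i \<in> signed_idx n" "j \<in> signed_idx n"
    "u \<le> i" "i \<le> w" "u \<le> j" "j \<le> w" "bef up u w i" "\<not> bef up u w j"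
  shows "inv x i < inv x j"
  using path_edgesD(4)[of u w n up "inv x"] assms unfolding bn_edges_def by blast

text \<open>Each demand of an edge is either an inversion, inherited upwards from \<open>x\<close>,
  or a non-inversion, inherited downwards from \<open>z\<close>.\<close>

lemma bn_edges_convex:
  assumes B: "x \<in> Bn n" "y \<in> Bn n" "z \<in> Bn n" and le: "wle n x y" "wle n y z"
    and e: "(u, w) \<in> bn_edges n up x" "(u, w) \<in> bn_edges n up z"
  shows "(u, w) \<in> bn_edges n up y"
proof -
  have "inv y i < inv y j" if ij: "i \<in> signed_idx n" "j \<in> signed_idx n"
    "u \<le> i" "i \<le> w" "u \<le> j" "j \<le> w" "bef up u w i" "\<not> bef up u w j" for i j
  proof (cases "i < j")
    case True
    then have "(i, j) \<in> Ninv n z" using bn_edgesD[OF e(2) ij] ij B by (simp add: Ninv_iff)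
    then have "(i, j) \<in> Ninv n y" using le B by (auto simp: wle_Ninv)
    then show ?thesis using B by (simp add: Ninv_iff)
  next
    case False
    then have "j < i" using ij by (metis linorder_less_linear)
    then have "(j, i) \<in> Inv n x" using bn_edgesD[OF e(1) ij] ij by (simp add: Inv_iff)
    then have "(j, i) \<in> Inv n y" using le B by (auto simp: wle_iff)
    then show ?thesis by (simp add: Inv_iff)
  qed
  then show ?thesis using path_edgesD(1-3)[of u w n up "inv x"] e(1)
    unfolding bn_edges_def by (blast intro: path_edgesI)
qed

text \<open>A demanded non-inversion passes to the meet directly. If a demanded inversion were lost,
  a chain of non-inversions of \<open>x\<close> and \<open>y\<close> would lead from a late label to
  an early one, and one of its links would violate a demand already in \<open>x\<close> or in
  \<open>y\<close>.\<close>

lemma bn_edges_wmeet: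
  assumes B: "x \<in> Bn n" "y \<in> Bn n"
    and e: "(u, w) \<in> bn_edges n up x" "(u, w) \<in> bn_edges n up y"
  shows "(u, w) \<in> bn_edges n up (wmeet n x y)"
proof -
  let ?m = "wmeet n x y"
  have m: "?m \<in> Bn n" and N: "Ninv n ?m = (Ninv n x \<union> Ninv n y)\<^sup>+"
    using wmeet_Ninv[OF B] by auto
  have "inv ?m i < inv ?m j" if ij: "i \<in> signed_idx n" "j \<in> signed_idx n"
    "u \<le> i" "i \<le> w" "u \<le> j" "j \<le> w" "bef up u w i" "\<not> bef up u w j" for i j
  proof (cases "i < j")
    case True
    then have "(i, j) \<in> Ninv n x" using bn_edgesD[OF e(1) ij] ij B by (simp add: Ninv_iff)
    then have "(i, j) \<in> Ninv n ?m" using N by auto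
    then show ?thesis using m by (simp add: Ninv_iff)
  next
    case False
    then have "j < i" using ij by (metis linorder_less_linear)
    have "(j, i) \<notin> Ninv n ?m"
    proof
      assume "(j, i) \<in> Ninv n ?m"
      then have tr: "(j, i) \<in> (Ninv n x \<union> Ninv n y)\<^sup>+" using N by simp
      have "\<exists>p q. (p, q) \<in> Ninv n x \<union> Ninv n y \<and> \<not> bef up u w p \<and> \<not> \<not> bef up u w q \<and> j \<le> p \<and> q \<le> i"
        using ij by (intro trancl_step_out[OF tr]) (auto simp: Ninv_def idx_pairs_iff)
      then obtain p q where pq: "(p, q) \<in> Ninv n x \<union> Ninv n y" "\<not> bef up u w p" "bef up u w q" "j \<le> p" "q \<le> i"
        by blast
      have "p \<in> signed_idx n" "q \<in> signed_idx n" "p < q" using pq(1) by (auto simp: Ninv_def idx_pairs_iff)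
      then have "inv x q < inv x p" "inv y q < inv y p"
        using pq ij by (auto intro!: bn_edgesD[OF e(1)] bn_edgesD[OF e(2)])
      then show False using pq(1) B by (auto simp: Ninv_iff)
    qed
    then show ?thesis using \<open>j < i\<close> ij m inv_eq_iff[OF m, of i j]
      by (auto simp: Ninv_iff simp del: inv_eq_iff)
  qed
  then show ?thesis using path_edgesD(1-3)[of u w n up "inv x"] e(1)
    unfolding bn_edges_def by (blast intro: path_edgesI)
qed

section \<open>Adjacent transpositions and flips\<close>

lemma ex_least_pair:
  assumes "P a b"
  obtains a b where "P a b" "\<And>a' b'. P a' b' \<Longrightarrow> (f a b :: nat) \<le> f a' b'"
proof -
  obtain x where "P (fst x) (snd x)" "\<And>y. P (fst y) (snd y) \<Longrightarrow> f (fst x) (snd x) \<le> f (fst y) (snd y)"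
    using ex_has_least_nat[of "\<lambda>x. P (fst x) (snd x)" "(a, b)" "\<lambda>x. f (fst x) (snd x)"] assms by auto
  then show ?thesis using that[of "fst x" "snd x"] by fastforce
qed

lemma inj_on_swap_values:
  assumes "inj_on f A" "a \<in> A" "c \<in> A"
  shows "inj_on (f(a := f c, c := f a)) A"
proof (rule inj_onI)
  fix i j assume ij: "i \<in> A" "j \<in> A" "(f(a := f c, c := f a)) i = (f(a := f c, c := f a)) j"
  have "f x = f y \<longleftrightarrow> x = y" if "x \<in> A" "y \<in> A" for x y
    using that assms(1) by (auto dest: inj_onD)
  then show "i = j" using ij assms(2,3) by (metis fun_upd_apply)
qed

text \<open>By \<open>path_edges_maximal\<close> the smaller set is a maximal noncrossing one, hence
  not properly contained in another noncrossing set.\<close>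

lemma path_edges_subset_eq:
  assumes "inj_on pos (signed_idx n)" "path_edges n up pos \<subseteq> path_edges n up pos'"
  shows "path_edges n up pos = path_edges n up pos'"
proof (rule antisym[OF assms(2)], rule subrelI, rule ccontr)
  fix u w assume e: "(u, w) \<in> path_edges n up pos'" "(u, w) \<notin> path_edges n up pos"
  obtain u' w' where e': "(u', w') \<in> path_edges n up pos" "xing up u w u' w'"
    using path_edges_maximal[OF assms(1) path_edgesD(1-3)[OF e(1)] e(2)] by blast
  then show False using path_edges_noncrossing e(1) assms(2) by blast
qed

lemma crossing_edges_xing_up:
  assumes "(u, w) \<in> path_edges n up pos" "(u', w') \<in> path_edges n up pos'" "xing up u w u' w'"
    and mono: "\<And>i j. i \<in> signed_idx n \<Longrightarrow> j \<in> signed_idx n \<Longrightarrow> i < j \<Longrightarrow> pos j < pos i \<Longrightarrow> pos' j < pos' i"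
  shows "xing_up up u w u' w'"
proof (rule ccontr)
  assume "\<not> xing_up up u w u' w'"
  then have "xing_up up u' w' u w" using xing_up_cases assms(3) by blast
  then obtain q r where qr: "q \<in> signed_idx n" "r \<in> signed_idx n" "q < r"
    "u \<le> q" "r \<le> w" "u' \<le> q" "r \<le> w'"
    "\<not> bef up u w q" "bef up u w r" "bef up u' w' q" "\<not> bef up u' w' r"
    using xing_up_bef path_edgesD(1,2)[OF assms(1)] path_edgesD(1,2)[OF assms(2)] by metis
  have "pos r < pos q" using qr by (intro path_edgesD(4)[OF assms(1)]) auto
  moreover have "pos' q < pos' r" using qr by (intro path_edgesD(4)[OF assms(2)]) auto
  ultimately show False using mono[of q r] qr by fastforce
qed

text \<open>The swap can break only the demand that \<open>a\<close> precede \<open>c\<close>. As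
  these are neighbors, an edge with this demand has its early labels up to \<open>a\<close> and its
  late labels from \<open>c\<close> on, so it lies on the path at time \<open>pos a\<close>.\<close>

lemma swap_edges_diff:
  assumes ac: "a \<in> signed_idx n" "c \<in> signed_idx n" "pos a < pos c"
    and adj: "\<And>i. i \<in> signed_idx n \<Longrightarrow> pos a < pos i \<Longrightarrow> pos i < pos c \<Longrightarrow> False"
    and inj: "inj_on pos (signed_idx n)"
  shows "path_edges n up pos - path_edges n up (pos(a := pos c, c := pos a)) =
    {(u, w). consecutive (on_path n up pos (pos a)) u w \<and> u \<le> a \<and> a \<le> w \<and> u \<le> c \<and> c \<le> w}"
    (is "path_edges n up pos - path_edges n up ?pos' = ?C")
proof (intro set_eqI iffI)
  fix e assume e: "e \<in> path_edges n up pos - path_edges n up ?pos'"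
  obtain u w where uw: "e = (u, w)" by fastforce
  have E: "(u, w) \<in> path_edges n up pos" "(u, w) \<notin> path_edges n up ?pos'" using e uw by auto
  have "\<exists>i j. i \<in> signed_idx n \<and> j \<in> signed_idx n \<and> u \<le> i \<and> i \<le> w \<and> u \<le> j \<and> j \<le> w \<and>
    bef up u w i \<and> \<not> bef up u w j \<and> \<not> ?pos' i < ?pos' j"
    using E(2) path_edgesD(1-3)[OF E(1)] by (fastforce simp: path_edges_def simp del: fun_upd_apply)
  then obtain i j where ij: "i \<in> signed_idx n" "j \<in> signed_idx n" "u \<le> i" "i \<le> w" "u \<le> j" "j \<le> w"
    "bef up u w i" "\<not> bef up u w j" "\<not> ?pos' i < ?pos' j" by blast
  have less: "pos i < pos j" using path_edgesD(4)[OF E(1)] ij by blast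
  have injD: "pos i = pos j \<longleftrightarrow> i = j" if "i \<in> signed_idx n" "j \<in> signed_idx n" for i j
    using inj that by (auto dest: inj_onD)
  have "i = a \<and> j = c"
  proof (rule ccontr)
    assume neq: "\<not> (i = a \<and> j = c)"
    have na: "pos i < pos c" if "i \<noteq> a" "i \<noteq> c" "pos i < pos a" using that ac by simp
    show False
      using neq ij(9) less ac adj[OF ij(1)] adj[OF ij(2)] injD[OF ij(1) ac(1)] injD[OF ij(1) ac(2)]
        injD[OF ij(2) ac(1)] injD[OF ij(2) ac(2)]
      by (cases "i = a"; cases "i = c"; cases "j = a"; cases "j = c"; simp; linarith)
  qed
  then have iac: "u \<le> a" "a \<le> w" "u \<le> c" "c \<le> w" "bef up u w a" "\<not> bef up u w c" using ij by auto
  have time: "bef up u w i \<longleftrightarrow> pos i \<le> pos a" if i: "i \<in> signed_idx n" "u \<le> i" "i \<le> w" for i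
  proof
    assume "bef up u w i"
    then have "pos i < pos c" using path_edgesD(4)[OF E(1)] i ac iac by blast
    then show "pos i \<le> pos a" using adj[OF i(1)] by force
  next
    assume "pos i \<le> pos a"
    then show "bef up u w i" using path_edgesD(4)[OF E(1) ac(1) i(1)] i iac by fastforce
  qed
  have "consecutive (on_path n up pos (pos a)) u w"
    unfolding consecutive_def
  proof (intro conjI)
    note V = path_edgesD(1-3)[OF E(1)]
    show "u < w" by fact
    show "u \<in> on_path n up pos (pos a)" "w \<in> on_path n up pos (pos a)"
      using V time[of u] time[of w] by (auto simp: on_path_def bef_def)
    show "on_path n up pos (pos a) \<inter> {u<..<w} = {}"
    proof (rule ccontr)
      assume "on_path n up pos (pos a) \<inter> {u<..<w} \<noteq> {}"
      then obtain i where i: "i \<in> on_path n up pos (pos a)" "u < i" "i < w" by auto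
      then have "i \<in> signed_idx n" using poly_verts_between[of u n w i] V by (auto simp: on_path_def)
      then show False using i time[of i] by (auto simp: on_path_def bef_def)
    qed
  qed
  then show "e \<in> ?C" using uw iac by auto
next
  fix e assume "e \<in> ?C"
  then obtain u w where uw: "e = (u, w)" and C: "consecutive (on_path n up pos (pos a)) u w"
    and iac: "u \<le> a" "a \<le> w" "u \<le> c" "c \<le> w" by auto
  have b: "bef up u w a" "\<not> bef up u w c"
    using consecutive_bef[OF C] ac iac by auto
  have "(u, w) \<notin> path_edges n up ?pos'"
  proof
    assume "(u, w) \<in> path_edges n up ?pos'"
    from path_edgesD(4)[OF this ac(1,2) iac b] ac show False by (auto split: if_splits)
  qed
  then show "e \<in> path_edges n up pos - path_edges n up ?pos'"
    using consecutive_path_edge[OF C] uw by blast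
qed

lemma consecutive_unique:
  assumes "consecutive S u w" "consecutive S u' w'" "a \<noteq> c"
    "u \<le> a" "a \<le> w" "u \<le> c" "c \<le> w" "u' \<le> a" "a \<le> w'" "u' \<le> c" "c \<le> w'"
  shows "u = u' \<and> w = w'"
proof -
  have "u' < w" "u < w'" using assms by linarith+
  then have "\<not> u < u'" "\<not> u' < u" "\<not> w < w'" "\<not> w' < w" using assms(1,2) by (auto simp: consecutive_def)
  then show ?thesis by linarith
qed

text \<open>A path has at most one edge spanning both labels, so one edge is lost and one gained.
  They cross, because by maximality some edge of the new set crosses the lost one, and it cannot be
  an old edge.\<close>

lemma swap_edges_flip:
  assumes ac: "a \<in> signed_idx n" "c \<in> signed_idx n" "a < c" "pos a < pos c"
    and adj: "\<And>i. i \<in> signed_idx n \<Longrightarrow> pos a < pos i \<Longrightarrow> pos i < pos c \<Longrightarrow> False"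
    and inj: "inj_on pos (signed_idx n)"
    and pos': "pos' = pos(a := pos c, c := pos a)"
    and neq: "path_edges n up pos \<noteq> path_edges n up pos'"
  obtains u w u' w' where "path_edges n up pos - path_edges n up pos' = {(u, w)}"
    "path_edges n up pos' - path_edges n up pos = {(u', w')}" "xing_up up u w u' w'"
proof -
  have injD: "pos i = pos j \<longleftrightarrow> i = j" if "i \<in> signed_idx n" "j \<in> signed_idx n" for i j
    using inj that by (auto dest: inj_onD)
  have val: "pos' a = pos c" "pos' c = pos a"
    and val': "i \<noteq> a \<Longrightarrow> i \<noteq> c \<Longrightarrow> pos' i = pos i" for i
    using ac by (auto simp: pos')
  have inj': "inj_on pos' (signed_idx n)"
    unfolding pos' by (rule inj_on_swap_values[OF inj ac(1,2)])
  have gap: "pos i < pos a \<or> i = a \<or> i = c \<or> pos c < pos i" if "i \<in> signed_idx n" for i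
    using adj[OF that] injD[OF that ac(1)] injD[OF that ac(2)] by (metis linorder_less_linear)
  have undo: "pos = pos'(c := pos' a, a := pos' c)" using ac(3) unfolding pos' by (intro ext) simp
  have adj': False if "i \<in> signed_idx n" "pos' c < pos' i" "pos' i < pos' a" for i
    using adj[OF that(1)] that val val'[of i] by (cases "i = a"; cases "i = c"; simp)
  have less': "pos' c < pos' a" using val ac by simp
  let ?E = "path_edges n up pos" and ?E' = "path_edges n up pos'"
  let ?C = "{(u, w). consecutive (on_path n up pos (pos a)) u w \<and> u \<le> a \<and> a \<le> w \<and> u \<le> c \<and> c \<le> w}"
  let ?C' = "{(u, w). consecutive (on_path n up pos' (pos' c)) u w \<and> u \<le> c \<and> c \<le> w \<and> u \<le> a \<and> a \<le> w}"
  have D: "?E - ?E' = ?C"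
    using swap_edges_diff[of a n c pos up] ac(1,2,4) adj inj pos' by blast
  have D': "?E' - ?E = ?C'"
    using swap_edges_diff[of c n a pos' up, folded undo] ac(1,2) less' adj' inj' by blast
  have "?E - ?E' \<noteq> {}" "?E' - ?E \<noteq> {}"
    using path_edges_subset_eq[OF inj, of up pos'] path_edges_subset_eq[OF inj', of up pos] neq by auto
  then obtain u w u' w' where e: "(u, w) \<in> ?E - ?E'" "(u', w') \<in> ?E' - ?E" by fastforce
  have uniq: "?E - ?E' = {(u, w)}"
    using e(1) consecutive_unique[of _ u w _ _ a c] ac(3) unfolding D by fastforce
  have uniq': "?E' - ?E = {(u', w')}"
    using e(2) consecutive_unique[of _ u' w' _ _ a c] ac(3) unfolding D' by fastforce
  have "(u, w) \<in> ?E" "(u, w) \<notin> ?E'" using e by auto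
  from path_edges_maximal[OF inj' path_edgesD(1-3)[OF this(1)] this(2)]
  obtain y z where yz: "(y, z) \<in> ?E'" "xing up u w y z" by blast
  then have "(y, z) \<notin> ?E" using path_edges_noncrossing e(1) by blast
  then have "(y, z) = (u', w')" using yz(1) uniq' by blast
  then have x: "xing up u w u' w'" using yz by simp
  have "xing_up up u w u' w'"
  proof (rule crossing_edges_xing_up[of u w n up pos u' w' pos'])
    fix i j assume ij: "i \<in> signed_idx n" "j \<in> signed_idx n" "i < j" "pos j < pos i"
    show "pos' j < pos' i"
      using ij(3,4) ac(3,4) gap[OF ij(1)] gap[OF ij(2)] val val'[of i] val'[of j] by (smt (verit))
  qed (use e x in auto)
  then show ?thesis using that uniq uniq' by blast
qed

section \<open>Orders symmetric under negation of labels\<close>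

locale signed_orientation =
  fixes n :: nat and up :: "int \<Rightarrow> bool"
  assumes up_minus: "i \<in> signed_idx n \<Longrightarrow> up (- i) \<longleftrightarrow> \<not> up i"
begin

abbreviation edges :: "(int \<Rightarrow> int) \<Rightarrow> (int \<times> int) set" where
  "edges x \<equiv> bn_edges n up x"

lemma bef_minus: "i \<in> signed_idx n \<Longrightarrow> bef up (- w) (- u) (- i) \<longleftrightarrow> \<not> bef up u w i"
  using up_minus by (auto simp: bef_def)

lemma edges_minus:
  assumes x: "x \<in> Bn n" and e: "(u, w) \<in> edges x"
  shows "(- w, - u) \<in> edges x"
  unfolding bn_edges_def
proof (rule path_edgesI)
  show "- w \<in> poly_verts n" "- u \<in> poly_verts n" "- w < - u"
    using path_edgesD(1-3)[OF e[unfolded bn_edges_def]] by (auto simp: poly_verts_iff)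
  fix i j assume ij: "i \<in> signed_idx n" "j \<in> signed_idx n" "- w \<le> i" "i \<le> - u" "- w \<le> j" "j \<le> - u"
    "bef up (- w) (- u) i" "\<not> bef up (- w) (- u) j"
  then have "inv x (- j) < inv x (- i)"
    using bef_minus[of "- i" w u] bef_minus[of "- j" w u] by (intro bn_edgesD[OF e]) auto
  then show "inv x i < inv x j" using x by (simp add: inv_odd)
qed

text \<open>Negation reverses both the sides and the order. The mirror time is
  \<open>- t - 1\<close> because \<open>inv x (- i) \<le> - t - 1\<close> is the negation of
  \<open>inv x i \<le> t\<close>.\<close>

lemma on_path_minus:
  assumes "x \<in> Bn n"
  shows "- i \<in> on_path n up (inv x) (- t - 1) \<longleftrightarrow> i \<in> on_path n up (inv x) t"
proof -
  have "up (- i) = (inv x (- i) \<le> - t - 1) \<longleftrightarrow> up i = (inv x i \<le> t)" if "i \<in> signed_idx n"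
    using up_minus[OF that] assms by (auto simp: inv_odd)
  then show ?thesis by (auto simp: on_path_def poly_verts_iff)
qed

lemma consecutive_minus:
  assumes "x \<in> Bn n" "consecutive (on_path n up (inv x) t) u w"
  shows "consecutive (on_path n up (inv x) (- t - 1)) (- w) (- u)"
proof -
  have "i \<notin> on_path n up (inv x) (- t - 1)" if "- w < i" "i < - u" for i
  proof
    assume "i \<in> on_path n up (inv x) (- t - 1)"
    then have "- i \<in> on_path n up (inv x) t" using on_path_minus[OF assms(1), of "- i" t] by simp
    then show False using assms(2) that by (auto simp: consecutive_def)
  qed
  then show ?thesis using assms(2) on_path_minus[OF assms(1)] by (auto simp: consecutive_def)
qed

lemma on_path_cong:
  "(\<And>i. i \<in> signed_idx n \<Longrightarrow> pos i \<le> t \<longleftrightarrow> pos' i \<le> t) \<Longrightarrow> on_path n up pos t = on_path n up pos' t"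
  by (auto simp: on_path_def)

lemma no_position_between:
  assumes "x \<in> Bn n" "i \<in> signed_idx n" "lo k < inv x i" "inv x i < hi k"
  shows False
proof -
  have "inv x i \<in> signed_idx n" using assms by simp
  then show False using assms(3,4) by (auto simp: lo_def hi_def signed_idx_iff split: if_splits)
qed

text \<open>A transposition of the signed permutation at positive positions is carried out one half at a
  time; the intermediate order is no longer symmetric.\<close>

lemma half_swap:
  assumes x: "x \<in> Bn n" and k: "0 < k" "k < n" and asc: "x (lo k) < x (hi k)"
    and neq: "edges x \<noteq> edges (x \<circ> gen k)"
  obtains u w u' w' pos where "inj_on pos (signed_idx n)"
    "edges x - path_edges n up pos = {(u, w)}" "path_edges n up pos - edges x = {(u', w')}"
    "path_edges n up pos - edges (x \<circ> gen k) = {(- w, - u)}"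
    "edges (x \<circ> gen k) - path_edges n up pos = {(- w', - u')}"
    "xing_up up u w u' w'" "xing_up up (- w) (- u) (- w') (- u')" "u \<noteq> - w"
    "consecutive (on_path n up (inv x) (lo k)) u w" "u \<le> x (lo k)" "x (hi k) \<le> w"
proof -
  define a c where "a = x (lo k)" and "c = x (hi k)"
  define y where "y = x \<circ> gen k"
  have y: "y \<in> Bn n" using x k by (simp add: y_def)
  have ac: "a \<in> signed_idx n" "c \<in> signed_idx n" "a < c" using x k asc by (auto simp: a_def c_def)
  have lohi: "lo k = int k" "hi k = int k + 1" using k by (auto simp: lo_def hi_def)
  have pa: "inv x a = int k" "inv x c = int k + 1" "inv x (- a) = - int k" "inv x (- c) = - int k - 1"
    using x lohi by (auto simp: a_def c_def inv_odd)
  have neg: "a \<noteq> - c" "a \<noteq> - a" "c \<noteq> - c" using pa k by auto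
  define pos where "pos = (inv x)(a := inv x c, c := inv x a)"
  have pos: "pos a = int k + 1" "pos c = int k" "pos (- a) = - int k" "pos (- c) = - int k - 1"
    using pa neg ac by (auto simp: pos_def)
  have pos_other: "i \<noteq> a \<Longrightarrow> i \<noteq> c \<Longrightarrow> pos i = inv x i" for i by (simp add: pos_def)
  have inj_x: "inj_on (inv x) (signed_idx n)" and inj_y: "inj_on (inv y) (signed_idx n)"
    using x y by (simp_all add: inj_inv)
  have inj_pos: "inj_on pos (signed_idx n)"
    unfolding pos_def by (rule inj_on_swap_values[OF inj_x ac(1,2)])
  have y_pos: "inv y = pos(- c := pos (- a), - a := pos (- c))"
  proof
    fix i
    have yi: "inv y i = gen k (inv x i)" using x by (simp add: y_def inv_comp_gen)
    have neg': "c \<noteq> - a" "- c \<noteq> a" "- a \<noteq> c" "- c \<noteq> - a" using neg ac(3) by auto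
    consider "i = a" | "i = c" | "i = - a" | "i = - c" | "i \<notin> {a, c, - a, - c}" by blast
    then show "inv y i = (pos(- c := pos (- a), - a := pos (- c))) i"
    proof cases
      case 5
      then have "inv x i \<noteq> int k" "inv x i \<noteq> int k + 1" "inv x i \<noteq> - int k" "inv x i \<noteq> - int k - 1"
        using pa inv_eq_iff[OF x, of i a] inv_eq_iff[OF x, of i c]
          inv_eq_iff[OF x, of i "- a"] inv_eq_iff[OF x, of i "- c"] by simp_all
      then have "inv y i = inv x i" unfolding yi gen_eq lohi by simp
      then show ?thesis using 5 pos_other[of i] by simp
    qed (unfold yi gen_eq lohi, use neg neg' pa pos k in simp_all)
  qed
  have y_pa: "inv y (- c) = - int k" "inv y (- a) = - int k - 1" and y_other: "i \<noteq> - a \<Longrightarrow> i \<noteq> - c \<Longrightarrow> inv y i = pos i" for i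
    using ac pos unfolding y_pos by auto
  have adj1: False if "i \<in> signed_idx n" "inv x a < inv x i" "inv x i < inv x c" for i
    using that pa by simp
  have adj2: False if "i \<in> signed_idx n" "pos (- c) < pos i" "pos i < pos (- a)" for i
    using that pos by simp
  have adj2': False if "i \<in> signed_idx n" "inv y (- a) < inv y i" "inv y i < inv y (- c)" for i
    using that y_pa by simp
  have adj1': False if "i \<in> signed_idx n" "pos c < pos i" "pos i < pos a" for i
    using that pos by simp
  let ?P = "path_edges n up pos"
  have D1: "edges x - ?P = {(u, w). consecutive (on_path n up (inv x) (int k)) u w \<and> u \<le> a \<and> a \<le> w \<and> u \<le> c \<and> c \<le> w}"
    unfolding bn_edges_def using swap_edges_diff[of a n c "inv x" up, folded pos_def] ac adj1 inj_x pa by auto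
  have "inv x = pos(c := pos a, a := pos c)" using ac by (auto simp: pos_def)
  then have D1': "?P - edges x = {(u, w). consecutive (on_path n up pos (int k)) u w \<and> u \<le> c \<and> c \<le> w \<and> u \<le> a \<and> a \<le> w}"
    unfolding bn_edges_def using swap_edges_diff[of c n a pos up] ac adj1' inj_pos pos by auto
  have D2: "?P - edges y = {(u, w). consecutive (on_path n up pos (- int k - 1)) u w \<and> u \<le> - c \<and> - c \<le> w \<and> u \<le> - a \<and> - a \<le> w}"
    unfolding bn_edges_def using swap_edges_diff[of "- c" n "- a" pos up, folded y_pos] ac adj2 inj_pos pos by auto
  have "pos = (inv y)(- a := inv y (- c), - c := inv y (- a))" using ac unfolding y_pos by auto
  then have D2': "edges y - ?P = {(u, w). consecutive (on_path n up (inv y) (- int k - 1)) u w \<and> u \<le> - a \<and> - a \<le> w \<and> u \<le> - c \<and> - c \<le> w}"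
    unfolding bn_edges_def using swap_edges_diff[of "- a" n "- c" "inv y" up] ac adj2' inj_y y_pa by auto
  \<comment> \<open>The path relevant to one half of the swap is not affected by the other half, so
    the mirror symmetry of \<open>x\<close> and of \<open>y\<close> can be used for
    \<open>pos\<close>.\<close>
  have same: "on_path n up pos (- int k - 1) = on_path n up (inv x) (- int k - 1)"
  proof (rule on_path_cong)
    fix i show "pos i \<le> - int k - 1 \<longleftrightarrow> inv x i \<le> - int k - 1"
      using pos pa pos_other[of i] k by (cases "i = a"; cases "i = c"; simp)
  qed
  have same': "on_path n up pos (int k) = on_path n up (inv y) (int k)"
  proof (rule on_path_cong)
    fix i show "pos i \<le> int k \<longleftrightarrow> inv y i \<le> int k"
      using pos y_pa y_other[of i] k by (cases "i = - a"; cases "i = - c"; simp)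
  qed
  have mirror: "(- w, - u) \<in> ?P - edges y" if "(u, w) \<in> edges x - ?P" for u w
    using that consecutive_minus[OF x, of "int k" u w] unfolding D1 D2 same by auto
  have mirror': "(- w, - u) \<in> edges x - ?P" if "(u, w) \<in> ?P - edges y" for u w
    using that consecutive_minus[OF x, of "- int k - 1" u w] unfolding D1 D2 same by auto
  have mirror2: "(- w, - u) \<in> edges y - ?P" if "(u, w) \<in> ?P - edges x" for u w
    using that consecutive_minus[OF y, of "int k" u w] unfolding D1' D2' same' by auto
  have neq1: "edges x \<noteq> ?P"
  proof
    assume eq: "edges x = ?P"
    then have "?P - edges y = {}" using mirror' by fastforce
    then have "?P \<subseteq> edges y" by blast
    then have "?P = edges y" using path_edges_subset_eq[OF inj_pos] unfolding bn_edges_def by blast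
    then show False using neq eq y_def by simp
  qed
  have less1: "inv x a < inv x c" and less2: "pos (- c) < pos (- a)" and ca: "- c < - a"
    using pa pos ac by auto
  have mem: "- c \<in> signed_idx n" "- a \<in> signed_idx n" using ac by auto
  obtain u w u' w' where f1: "edges x - ?P = {(u, w)}" "?P - edges x = {(u', w')}" "xing_up up u w u' w'"
    unfolding bn_edges_def
    by (rule swap_edges_flip[OF ac less1 adj1 inj_x pos_def neq1[unfolded bn_edges_def]])
  have uw: "(- w, - u) \<in> ?P - edges y" and uw': "(- w', - u') \<in> edges y - ?P"
    using mirror[of u w] mirror2[of u' w'] f1 by auto
  then have neq2: "?P \<noteq> edges y" by blast
  obtain u2 w2 u2' w2' where f2: "?P - edges y = {(u2, w2)}" "edges y - ?P = {(u2', w2')}" "xing_up up u2 w2 u2' w2'"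
    unfolding bn_edges_def
    by (rule swap_edges_flip[OF mem ca less2 adj2 inj_pos y_pos neq2[unfolded bn_edges_def]])
  have eq2: "u2 = - w" "w2 = - u" "u2' = - w'" "w2' = - u'" using f2 uw uw' by auto
  have uwC: "(u, w) \<in> edges x - ?P" using f1 by auto
  have C: "consecutive (on_path n up (inv x) (int k)) u w" "u \<le> a" "c \<le> w"
    using uwC unfolding D1 by auto
  \<comment> \<open>A diameter would be an edge at time \<open>k\<close> and at time
    \<open>- k - 1\<close>, but it spans \<open>- a\<close>, whose position \<open>- k\<close> makes
    it processed at only one of these times.\<close>
  have "u \<noteq> - w"
  proof
    assume eq: "u = - w"
    then have "consecutive (on_path n up (inv x) (- int k - 1)) u w" "u \<le> - a" "- a \<le> w"
      using uw unfolding D2 same by auto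
    then show False using consecutive_bef[OF C(1), of "- a"] consecutive_bef[of n up "inv x" "- int k - 1" u w "- a"] pa ac by auto
  qed
  then show ?thesis
    using that[OF inj_pos, of u w u' w'] f1 f2 C unfolding eq2 a_def c_def y_def lohi by blast
qed

text \<open>The swap at \<open>k = 0\<close> is symmetric by itself, so the only lost edge and the
  only gained edge are their own mirror images, that is, diameters.\<close>

lemma central_swap:
  assumes x: "x \<in> Bn n" and n: "0 < n" and asc: "x (lo 0) < x (hi 0)"
    and neq: "edges x \<noteq> edges (x \<circ> gen 0)"
  obtains w w' where
    "edges x - edges (x \<circ> gen 0) = {(- w, w)}" "edges (x \<circ> gen 0) - edges x = {(- w', w')}"
    "xing_up up (- w) w (- w') w'"
    "consecutive (on_path n up (inv x) (lo 0)) (- w) w" "- w \<le> x (lo 0)" "x (hi 0) \<le> w"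
proof -
  define a c where "a = x (lo 0)" and "c = x (hi 0)"
  define y where "y = x \<circ> gen 0"
  have y: "y \<in> Bn n" using x n by (simp add: y_def)
  have ac: "a \<in> signed_idx n" "c \<in> signed_idx n" "a < c" using x n asc by (auto simp: a_def c_def)
  have pa: "inv x a = lo 0" "inv x c = hi 0" using x by (auto simp: a_def c_def)
  have y_pos: "inv y = (inv x)(a := inv x c, c := inv x a)"
  proof
    fix i
    have "inv y i = gen 0 (inv x i)" using x by (simp add: y_def inv_comp_gen)
    moreover have "inv x i = lo 0 \<longleftrightarrow> i = a" "inv x i = hi 0 \<longleftrightarrow> i = c"
      using pa inv_eq_iff[OF x] by metis+
    ultimately show "inv y i = ((inv x)(a := inv x c, c := inv x a)) i"
      using pa ac by (auto simp: gen_eq lo_def hi_def)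
  qed
  have adj: False if "i \<in> signed_idx n" "inv x a < inv x i" "inv x i < inv x c" for i
    using no_position_between[OF x that(1), of 0] that pa by simp
  have less: "inv x a < inv x c" using pa by simp
  obtain u w u' w' where f: "edges x - edges y = {(u, w)}" "edges y - edges x = {(u', w')}" "xing_up up u w u' w'"
    using swap_edges_flip[of a n c "inv x" "inv y" up] ac adj inj_inv[OF x] less y_pos neq
    unfolding bn_edges_def y_def by blast
  have "(- w, - u) \<in> edges x - edges y"
    using f(1) edges_minus[OF x, of u w] edges_minus[OF y, of "- w" "- u"] by auto
  then have u: "u = - w" using f(1) by auto
  have "(- w', - u') \<in> edges y - edges x"
    using f(2) edges_minus[OF y, of u' w'] edges_minus[OF x, of "- w'" "- u'"] by auto
  then have u': "u' = - w'" using f(2) by auto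
  have "(u, w) \<in> edges x - edges y" using f by auto
  then have "consecutive (on_path n up (inv x) (lo 0)) u w \<and> u \<le> a \<and> c \<le> w"
    using swap_edges_diff[of a n c "inv x" up, folded y_pos] ac adj inj_inv[OF x] less pa
    unfolding bn_edges_def by auto
  then show ?thesis using that[of w w'] f unfolding u u' a_def c_def y_def by blast
qed

text \<open>The witness \<open>b\<close> is a parameter because the forcing argument keeps
  \<open>b\<close> while the pair around it changes.\<close>

definition contracted :: "(int \<Rightarrow> int) \<Rightarrow> nat \<Rightarrow> int \<Rightarrow> bool" where
  "contracted x k b \<longleftrightarrow> b \<in> signed_idx n \<and> x (lo k) < b \<and> b < x (hi k) \<and>
     (if up b then inv x b < lo k else hi k < inv x b)"

text \<open>A lost edge would span both swapped values on the path at time \<open>lo k\<close>, but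
  \<open>b\<close> is a vertex of this path lying between them.\<close>

lemma contracted_edges:
  assumes x: "x \<in> Bn n" and k: "k < n" and asc: "x (lo k) < x (hi k)" and b: "contracted x k b"
  shows "edges x = edges (x \<circ> gen k)"
proof (rule ccontr)
  assume neq: "edges x \<noteq> edges (x \<circ> gen k)"
  have "\<exists>u w. consecutive (on_path n up (inv x) (lo k)) u w \<and> u \<le> x (lo k) \<and> x (hi k) \<le> w"
  proof (cases "k = 0")
    case True
    then show ?thesis using central_swap[OF x] k asc neq by (metis (no_types))
  next
    case False
    then show ?thesis using half_swap[OF x _ k asc neq] by (metis (no_types) gr0I)
  qed
  then obtain u w where uw: "consecutive (on_path n up (inv x) (lo k)) u w" "u \<le> x (lo k)" "x (hi k) \<le> w"
    by blast
  have "up b \<longleftrightarrow> inv x b \<le> lo k"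
    using b lo_less_hi[of k] unfolding contracted_def by (smt (verit))
  then have "b \<in> on_path n up (inv x) (lo k)"
    using b signed_idx_poly_verts[of b n] by (simp add: contracted_def on_path_def)
  then show False using uw b by (auto simp: contracted_def consecutive_def)
qed

text \<open>Without a witness, all labels between the two values stand where the join-irreducible
  element of \<open>(a, c)\<close> wants them, so the swap makes this pair forced.\<close>

lemma not_contracted_edges:
  assumes x: "x \<in> Bn n" and k: "k < n" and asc: "x (lo k) < x (hi k)" and b: "\<And>b. \<not> contracted x k b"
  shows "edges x \<noteq> edges (x \<circ> gen k)"
proof
  define a c where "a = x (lo k)" and "c = x (hi k)"
  define y where "y = x \<circ> gen k"
  have y: "y \<in> Bn n" using x k by (simp add: y_def)
  have ac: "a \<in> signed_idx n" "c \<in> signed_idx n" "a < c" using x k asc by (auto simp: a_def c_def)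
  have pa: "inv x a = lo k" "inv x c = hi k" using x by (auto simp: a_def c_def)
  have y_pos: "inv y i = gen k (inv x i)" for i using x by (simp add: y_def inv_comp_gen)
  have big: "hi k \<le> inv y p" if p: "p \<in> signed_idx n" "a \<le> p" "p < c" "p = a \<or> up p" for p
  proof (cases "p = a")
    case True
    then show ?thesis by (simp add: y_pos pa)
  next
    case False
    then have "\<not> inv x p < lo k" using p b[of p] by (auto simp: contracted_def a_def c_def)
    moreover have "inv x p \<noteq> lo k" "inv x p \<noteq> hi k" using False p pa inv_eq_iff[OF x] by (metis, metis order_less_irrefl)
    ultimately have "hi k < inv x p" using no_position_between[OF x p(1), of k] by (smt (verit))
    then show ?thesis by (auto simp: y_pos gen_eq lo_def hi_def split: if_splits)
  qed
  have small: "inv y q \<le> lo k" if q: "q \<in> signed_idx n" "a < q" "q \<le> c" "q = c \<or> \<not> up q" for q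
  proof (cases "q = c")
    case True
    then show ?thesis by (simp add: y_pos pa)
  next
    case False
    then have "\<not> hi k < inv x q" using q b[of q] by (auto simp: contracted_def a_def c_def)
    moreover have "inv x q \<noteq> lo k" "inv x q \<noteq> hi k" using False q pa inv_eq_iff[OF x] by (metis order_less_irrefl, metis)
    ultimately have "inv x q < lo k" using no_position_between[OF x q(1), of k] by (smt (verit))
    then show ?thesis by (auto simp: y_pos gen_eq lo_def hi_def split: if_splits)
  qed
  have "(a, c) \<in> forced n up (inv y)"
    unfolding forced_def
  proof (clarify, intro conjI ballI impI)
    show "(a, c) \<in> idx_pairs n" using ac by (simp add: idx_pairs_iff)
    fix p q assume "p \<in> signed_idx n" "q \<in> signed_idx n" "a \<le> p" "p < q" "q \<le> c" "p = a \<or> up p" "q = c \<or> \<not> up q"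
    then have "hi k \<le> inv y p" "inv y q \<le> lo k" using big small by auto
    then show "inv y q < inv y p" using lo_less_hi[of k] by linarith
  qed
  moreover have "(a, c) \<notin> forced n up (inv x)"
    using forcedD[of a c n up "inv x" a c] ac pa lo_less_hi[of k] by force
  moreover assume "edges x = edges (x \<circ> gen k)"
  ultimately show False using bn_edges_eq_iff(1)[OF x y, of up] unfolding y_def by blast
qed

text \<open>Among the elements without the inversions forbidden by \<open>T\<close>, take a maximal one. If it lacked an
  inversion required by some edge of \<open>T\<close>, then a suitable ascent could not be removed because of
  another edge of \<open>T\<close>, and the two edges would cross.\<close>

lemma noncrossing_realized:
  assumes T: "\<And>u w. (u, w) \<in> T \<Longrightarrow> u \<in> poly_verts n \<and> w \<in> poly_verts n \<and> u < w"
    and noncross: "\<And>u w u' w'. (u, w) \<in> T \<Longrightarrow> (u', w') \<in> T \<Longrightarrow> \<not> xing up u w u' w'"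
    and sym: "\<And>u w. (u, w) \<in> T \<Longrightarrow> (- w, - u) \<in> T"
  obtains x where "x \<in> Bn n" "T \<subseteq> edges x"
proof -
  \<comment> \<open>Demands with \<open>i < j\<close> forbid inversions and demands with
    \<open>j < i\<close> require them; \<open>F\<close> imposes only the former.\<close>
  define F where "F = {x \<in> Bn n. \<forall>(u, w)\<in>T. \<forall>i\<in>signed_idx n \<inter> {u..w}. \<forall>j\<in>signed_idx n \<inter> {u..w}.
     bef up u w i \<longrightarrow> \<not> bef up u w j \<longrightarrow> i < j \<longrightarrow> inv x i < inv x j}"
  have FD: "inv x i < inv x j" if "x \<in> F" "(u, w) \<in> T" "i \<in> signed_idx n" "j \<in> signed_idx n"
    "u \<le> i" "j \<le> w" "bef up u w i" "\<not> bef up u w j" "i < j" for x u w i j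
    using that unfolding F_def by fastforce
  have fin: "finite F" unfolding F_def using finite_Bn by (rule rev_finite_subset) blast
  have "id \<in> F" using id_Bn by (auto simp: F_def)
  then obtain x where x: "x \<in> F" and xmax: "\<And>y. y \<in> F \<Longrightarrow> card (Inv n y) \<le> card (Inv n x)"
    using obtains_MAX[of F "\<lambda>x. card (Inv n x)"] fin
    by (metis Max_ge empty_iff finite_imageI imageI)
  have xB: "x \<in> Bn n" using x by (simp add: F_def)
  have "T \<subseteq> edges x"
  proof (rule subrelI, rule ccontr)
    fix u w assume d: "(u, w) \<in> T" "(u, w) \<notin> edges x"
    define V where "V r q \<longleftrightarrow> r \<in> signed_idx n \<and> q \<in> signed_idx n \<and> u \<le> r \<and> q \<le> w \<and> r < q \<and>
      \<not> bef up u w r \<and> bef up u w q \<and> inv x r < inv x q" for r q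
    have "\<exists>i j. i \<in> signed_idx n \<and> j \<in> signed_idx n \<and> u \<le> i \<and> i \<le> w \<and> u \<le> j \<and> j \<le> w \<and>
      bef up u w i \<and> \<not> bef up u w j \<and> \<not> inv x i < inv x j"
      using d T[OF d(1)] unfolding bn_edges_def path_edges_def by fastforce
    then obtain i j where ij: "i \<in> signed_idx n" "j \<in> signed_idx n" "u \<le> i" "i \<le> w" "u \<le> j" "j \<le> w"
      "bef up u w i" "\<not> bef up u w j" "\<not> inv x i < inv x j" by blast
    have "i \<noteq> j" using ij by auto
    then have "inv x j < inv x i" using ij inv_eq_iff[OF xB, of i j] by linarith
    moreover have "j < i" using FD[OF x d(1), of i j] ij \<open>i \<noteq> j\<close> by linarith
    ultimately have "V j i" using ij by (simp add: V_def)
    then obtain r q where V: "V r q"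
      and V_least: "\<And>r' q'. V r' q' \<Longrightarrow> nat (inv x q - inv x r) \<le> nat (inv x q' - inv x r')"
      by (rule ex_least_pair[where f = "\<lambda>r q. nat (inv x q - inv x r)"]) blast
    have rq: "r \<in> signed_idx n" "q \<in> signed_idx n" "u \<le> r" "q \<le> w" "r < q"
      "\<not> bef up u w r" "bef up u w q" "inv x r < inv x q" using V by (auto simp: V_def)
    \<comment> \<open>The violated pair \<open>(r, q)\<close> is closest in position; an entry
      between them in position and in value would give a closer one.\<close>
    have gap: "z \<le> r \<or> q \<le> z" if z: "z \<in> signed_idx n" "inv x r \<le> inv x z" "inv x z \<le> inv x q" for z
    proof (rule ccontr)
      assume "\<not> (z \<le> r \<or> q \<le> z)"
      then have zrq: "r < z" "z < q" by auto
      then have "inv x z \<noteq> inv x r" "inv x z \<noteq> inv x q" using inv_eq_iff[OF xB] by auto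
      then have "inv x r < inv x z" "inv x z < inv x q" using z by auto
      then show False
        using V_least[of r z] V_least[of z q] zrq z rq by (cases "bef up u w z") (auto simp: V_def)
    qed
    \<comment> \<open>By \<open>gap\<close>, some neighboring entries between the positions of
      \<open>r\<close> and \<open>q\<close> jump over the values from \<open>r\<close> to
      \<open>q\<close>; swapping them is the candidate for a larger element of
      \<open>F\<close>.\<close>
    define W where "W z z' \<longleftrightarrow> z \<in> signed_idx n \<and> z' \<in> signed_idx n \<and> z \<le> r \<and> q \<le> z' \<and>
      inv x r \<le> inv x z \<and> inv x z < inv x z' \<and> inv x z' \<le> inv x q" for z z'
    have "W r q" using rq by (simp add: W_def)
    then obtain z z' where W: "W z z'"
      and W_least: "\<And>y y'. W y y' \<Longrightarrow> nat (inv x z' - inv x z) \<le> nat (inv x y' - inv x y)"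
      by (rule ex_least_pair[where f = "\<lambda>r q. nat (inv x q - inv x r)"]) blast
    have zz: "z \<in> signed_idx n" "z' \<in> signed_idx n" "z \<le> r" "q \<le> z'"
      "inv x r \<le> inv x z" "inv x z < inv x z'" "inv x z' \<le> inv x q" using W by (auto simp: W_def)
    have adj: False if m: "m \<in> signed_idx n" "inv x z < m" "m < inv x z'" for m
    proof -
      have "x m \<in> signed_idx n" "inv x (x m) = m" using m xB by auto
      then show False
        using gap[of "x m"] W_least[of "x m" z'] W_least[of z "x m"] m zz by (auto simp: W_def)
    qed
    have "inv x z \<in> signed_idx n" "inv x z' \<in> signed_idx n" using zz xB by auto
    from adjacent_positions[OF this zz(6)] adj obtain k where k: "k < n"
      "inv x z = lo k \<and> inv x z' = hi k \<or> inv x z = - hi k \<and> inv x z' = - lo k" by blast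
    have lohi: "(z = x (lo k) \<and> z' = x (hi k)) \<or> (z = - x (hi k) \<and> z' = - x (lo k))"
      using k(2) Bn_f_inv[OF xB, of z] Bn_f_inv[OF xB, of z'] by (auto simp: Bn_odd[OF xB])
    have asc: "x (lo k) < x (hi k)" using lohi zz rq by auto
    define y where "y = x \<circ> gen k"
    have y: "y \<in> Bn n" using xB k by (simp add: y_def)
    have step: "Inv n y = Inv n x \<union> {(x (lo k), x (hi k)), (- x (hi k), - x (lo k))}"
      "(x (lo k), x (hi k)) \<notin> Inv n x" "(- x (hi k), - x (lo k)) \<notin> Inv n x"
      using Inv_step[OF xB k(1) asc] unfolding y_def by auto
    have "Inv n x \<subset> Inv n y" using step by auto
    then have "card (Inv n x) < card (Inv n y)" by (intro psubset_card_mono) auto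
    then have "y \<notin> F" using xmax[of y] by auto
    then obtain u' w' i j where d': "(u', w') \<in> T" and ij: "i \<in> signed_idx n" "j \<in> signed_idx n"
      "u' \<le> i" "j \<le> w'" "bef up u' w' i" "\<not> bef up u' w' j" "i < j" "\<not> inv y i < inv y j"
      using y unfolding F_def by fastforce
    have "inv y i \<noteq> inv y j" using ij inv_eq_iff[OF y, of i j] by auto
    then have "(i, j) \<in> Inv n y" using ij by (auto simp: Inv_iff)
    moreover have "(i, j) \<notin> Inv n x" using FD[OF x d' ij(1,2,3,4,5,6,7)] by (auto simp: Inv_iff)
    ultimately have "(i, j) = (z, z') \<or> (i, j) = (- z', - z)" using step(1) lohi by auto
    then obtain u2 w2 where e: "(u2, w2) \<in> T" "u2 \<le> z" "z' \<le> w2" "bef up u2 w2 z" "\<not> bef up u2 w2 z'"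
    proof
      assume "(i, j) = (z, z')"
      then show ?thesis using that[of u' w'] d' ij by auto
    next
      assume "(i, j) = (- z', - z)"
      then show ?thesis using that[of "- w'" "- u'"] sym[OF d'] ij zz
        bef_minus[of "- z" w' u'] bef_minus[of "- z'" w' u'] by auto
    qed
    \<comment> \<open>The edge \<open>u2 w2\<close> forbids the inversion of \<open>z\<close> and
      \<open>z'\<close>. Since \<open>x\<close> lies in \<open>F\<close>, this edge must want
      \<open>r\<close> early and \<open>q\<close> late, contrary to the edge
      \<open>u w\<close>.\<close>
    have "bef up u2 w2 r"
    proof (rule ccontr)
      assume nb: "\<not> bef up u2 w2 r"
      then have "z < r" using zz e by (cases "z = r") auto
      then have "inv x z < inv x r" using FD[OF x e(1) zz(1) rq(1)] e zz rq nb by auto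
      then show False using zz by simp
    qed
    moreover have "\<not> bef up u2 w2 q"
    proof
      assume nb: "bef up u2 w2 q"
      then have "q < z'" using zz e by (cases "z' = q") auto
      then have "inv x q < inv x z'" using FD[OF x e(1) rq(2) zz(2)] e zz rq nb by auto
      then show False using zz by simp
    qed
    ultimately have "xing up u w u2 w2"
      using rq e zz by (intro bef_xing[of r q]) auto
    then show False using noncross d(1) e(1) by blast
  qed
  then show ?thesis using that xB by blast
qed

end

section \<open>The polygon\<close>

lemma cross_affine:
  "cross a b ((1 - t) *\<^sub>R c + t *\<^sub>R d) = (1 - t) * cross a b c + t * cross a b d"
  by (simp add: cross_def algebra_simps)

lemma cross_rotate: "cross b c a = cross a b c" "cross c a b = cross a b c"
  and cross_flip: "cross b a c = - cross a b c" "cross a c b = - cross a b c" "cross c b a = - cross a b c"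
  by (simp_all add: cross_def algebra_simps)

lemma closed_segment_same_side:
  assumes "cross a b c * cross a b d > 0"
  shows "closed_segment a b \<inter> closed_segment c d = {}"
proof (rule ccontr)
  assume "closed_segment a b \<inter> closed_segment c d \<noteq> {}"
  then obtain z s t where z: "z = (1 - s) *\<^sub>R a + s *\<^sub>R b" "z = (1 - t) *\<^sub>R c + t *\<^sub>R d" "0 \<le> t" "t \<le> 1"
    by (auto simp: in_segment)
  have "cross a b z = 0" unfolding z(1) cross_affine by (simp add: cross_def)
  then have eq: "(1 - t) * cross a b c + t * cross a b d = 0" unfolding z(2) cross_affine .
  consider "cross a b c > 0" "cross a b d > 0" | "cross a b c < 0" "cross a b d < 0"
    using assms by (auto simp: zero_less_mult_iff)
  then show False
  proof cases
    case 1
    then have "(1 - t) * cross a b c \<ge> 0" "t * cross a b d \<ge> 0" using z by auto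
    then have "(1 - t) * cross a b c = 0" "t * cross a b d = 0" using eq by linarith+
    then show False using 1 by auto
  next
    case 2
    then have "(1 - t) * cross a b c \<le> 0" "t * cross a b d \<le> 0"
      using z by (auto simp: mult_nonneg_nonpos)
    then have "(1 - t) * cross a b c = 0" "t * cross a b d = 0" using eq by linarith+
    then show False using 2 by auto
  qed
qed

text \<open>The common point divides each segment in the ratio of the distances of its endpoints
  from the other line, which the cross products measure.\<close>

lemma closed_segment_opposite_sides:
  assumes 1: "cross a b c * cross a b d < 0" and 2: "cross c d a * cross c d b < 0"
  shows "closed_segment a b \<inter> closed_segment c d \<noteq> {}"
proof -
  define t where "t = cross a b c / (cross a b c - cross a b d)"
  define s where "s = cross c d a / (cross c d a - cross c d b)"
  have frac: "0 \<le> x / (x - y) \<and> x / (x - y) \<le> 1" if "x * y < 0" for x y :: real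
    using that by (auto simp: mult_less_0_iff divide_simps)
  have "0 \<le> t" "t \<le> 1" "0 \<le> s" "s \<le> 1" using frac 1 2 by (auto simp: t_def s_def)
  moreover have "(1 - s) *\<^sub>R a + s *\<^sub>R b = (1 - t) *\<^sub>R c + t *\<^sub>R d"
  proof -
    \<comment> \<open>Both denominators are, up to sign, the determinant of the two directions;
      multiplying by \<open>K\<close> turns each coordinate into a polynomial identity.\<close>
    define K where "K = cross a b c - cross a b d"
    have ne: "K \<noteq> 0" using 1 by (auto simp: mult_less_0_iff K_def)
    have opp: "cross c d a - cross c d b = - K"
      by (simp add: K_def cross_def algebra_simps)
    have s: "s * K = - cross c d a" and t: "t * K = cross a b c"
      using ne by (simp_all add: s_def opp t_def flip: K_def)
    have "(fst ((1 - s) *\<^sub>R a + s *\<^sub>R b) - fst ((1 - t) *\<^sub>R c + t *\<^sub>R d)) * K =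
       (fst a - fst c) * K + (fst b - fst a) * (s * K)
        - (fst d - fst c) * (t * K)"
      by (simp add: algebra_simps)
    also have "\<dots> = 0" unfolding s t by (simp add: K_def cross_def algebra_simps)
    finally have x: "fst ((1 - s) *\<^sub>R a + s *\<^sub>R b) = fst ((1 - t) *\<^sub>R c + t *\<^sub>R d)" using ne by simp
    have "(snd ((1 - s) *\<^sub>R a + s *\<^sub>R b) - snd ((1 - t) *\<^sub>R c + t *\<^sub>R d)) * K =
       (snd a - snd c) * K + (snd b - snd a) * (s * K)
        - (snd d - snd c) * (t * K)"
      by (simp add: algebra_simps)
    also have "\<dots> = 0" unfolding s t by (simp add: K_def cross_def algebra_simps)
    finally have y: "snd ((1 - s) *\<^sub>R a + s *\<^sub>R b) = snd ((1 - t) *\<^sub>R c + t *\<^sub>R d)" using ne by simp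
    show ?thesis by (rule prod_eqI[OF x y])
  qed
  ultimately show ?thesis by (force simp: in_segment)
qed

section \<open>Chords, crossings and slopes in the polygon\<close>

locale signed_polygon = signed_orientation n up for n :: nat and up :: "int \<Rightarrow> bool" +
  fixes v :: "int \<Rightarrow> real \<times> real"
  assumes Q: "Qpoly n up v"
begin

lemma v_minus: "i \<in> poly_verts n \<Longrightarrow> v (- i) = - v i"
  using Q by (auto simp: Qpoly_def)

lemma fst_v_less: "i \<in> poly_verts n \<Longrightarrow> j \<in> poly_verts n \<Longrightarrow> i < j \<Longrightarrow> fst (v i) < fst (v j)"
  using Q by (auto simp: Qpoly_def)

text \<open>An upper vertex on or below a chord would be a convex combination of a point of the chord and
  a point of the horizontal diameter.\<close>

lemma cross_up:
  assumes V: "p \<in> poly_verts n" "q \<in> poly_verts n" "s \<in> poly_verts n" and less: "p < q" "q < s" and "up q"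
  shows "cross (v p) (v q) (v s) < 0"
proof (rule ccontr)
  assume neg: "\<not> cross (v p) (v q) (v s) < 0"
  define l r where "l = - int n - 1" and "r = int n + 1"
  have lr: "l \<in> poly_verts n" "r \<in> poly_verts n" "l < q" "q < r"
    using V less by (auto simp: l_def r_def poly_verts_iff)
  have "\<bar>q\<bar> \<le> int n" using lr by (auto simp: l_def r_def)
  then have pos: "snd (v q) > 0" using Q V \<open>up q\<close> by (auto simp: Qpoly_def)
  have ends: "snd (v l) = 0" "snd (v r) = 0" using Q by (auto simp: Qpoly_def l_def r_def)
  let ?S = "v ` (poly_verts n - {q})"
  have inS: "v p \<in> convex hull ?S" "v s \<in> convex hull ?S" "v l \<in> convex hull ?S" "v r \<in> convex hull ?S"
    using V less lr by (auto intro!: hull_inc)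
  note x = fst_v_less[OF V(1,2) less(1)] fst_v_less[OF V(2,3) less(2)]
    fst_v_less[OF lr(1) V(2) lr(3)] fst_v_less[OF V(2) lr(2,4)]
  define t where "t = (fst (v q) - fst (v p)) / (fst (v s) - fst (v p))"
  define t' where "t' = (fst (v q) - fst (v l)) / (fst (v r) - fst (v l))"
  have t: "0 \<le> t" "t \<le> 1" "0 \<le> t'" "t' \<le> 1" using x by (auto simp: t_def t'_def)
  \<comment> \<open>\<open>H\<close> and \<open>O'\<close> are the points of the chord and of the
    diameter on the vertical line through \<open>v q\<close>, which lies between them.\<close>
  define H where "H = (1 - t) *\<^sub>R v p + t *\<^sub>R v s"
  define O' where "O' = (1 - t') *\<^sub>R v l + t' *\<^sub>R v r"
  have "H \<in> convex hull ?S" "O' \<in> convex hull ?S"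
    unfolding H_def O'_def using t inS by (auto intro!: convexD_alt)
  have "t * (fst (v s) - fst (v p)) = fst (v q) - fst (v p)"
    "t' * (fst (v r) - fst (v l)) = fst (v q) - fst (v l)"
    using x by (auto simp: t_def t'_def)
  then have fstHO: "fst H = fst (v q)" "fst O' = fst (v q)" by (auto simp: H_def O'_def algebra_simps)
  have sndO: "snd O' = 0" using ends by (simp add: O'_def)
  have "(fst (v q) - fst (v p)) * (snd (v s) - snd (v p)) \<ge> (snd (v q) - snd (v p)) * (fst (v s) - fst (v p))"
    using neg by (simp add: cross_def)
  then have "t * (snd (v s) - snd (v p)) \<ge> snd (v q) - snd (v p)"
    using x by (simp add: t_def pos_le_divide_eq)
  then have h: "snd (v q) \<le> snd H" by (simp add: H_def algebra_simps)
  define m where "m = snd (v q) / snd H"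
  have m: "0 \<le> m" "m \<le> 1" "m * snd H = snd (v q)" using pos h by (auto simp: m_def)
  have "v q = (1 - m) *\<^sub>R O' + m *\<^sub>R H"
    by (rule prod_eqI) (simp_all add: fstHO sndO m algebra_simps)
  also have "\<dots> \<in> convex hull ?S"
    using \<open>H \<in> convex hull ?S\<close> \<open>O' \<in> convex hull ?S\<close> m by (auto intro!: convexD_alt)
  finally show False using Q V by (auto simp: Qpoly_def)
qed

lemma cross_down:
  assumes V: "p \<in> poly_verts n" "q \<in> poly_verts n" "s \<in> poly_verts n" and less: "p < q" "q < s" and "\<not> up q"
  shows "cross (v p) (v q) (v s) > 0"
proof -
  have "q \<in> signed_idx n" using poly_verts_between V less by blast
  then have "up (- q)" using up_minus assms by blast
  moreover have "- p \<in> poly_verts n" "- q \<in> poly_verts n" "- s \<in> poly_verts n"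
    using V by (auto simp: poly_verts_iff)
  ultimately have "cross (v (- s)) (v (- q)) (v (- p)) < 0"
    using cross_up[of "- s" "- q" "- p"] less by auto
  then show ?thesis using V by (simp add: v_minus cross_def algebra_simps)
qed

lemma cross_pos_iff:
  assumes "p \<in> poly_verts n" "q \<in> poly_verts n" "s \<in> poly_verts n" "p < q" "q < s"
  shows "0 < cross (v p) (v q) (v s) \<longleftrightarrow> \<not> up q" "cross (v p) (v q) (v s) < 0 \<longleftrightarrow> up q"
  using cross_up[OF assms] cross_down[OF assms] by (cases "up q"; simp)+

lemma seg_eq: "seg v {i, j} = closed_segment (v i) (v j)"
  unfolding seg_def by (auto simp: doubleton_eq_iff closed_segment_commute)

lemma crossing_sym: "crossing v d e \<longleftrightarrow> crossing v e d"
  by (auto simp: crossing_def)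

lemma xing_crosses:
  assumes V: "u \<in> poly_verts n" "w \<in> poly_verts n" "u' \<in> poly_verts n" "w' \<in> poly_verts n"
    and x: "xing up u w u' w'"
  shows "cross (v u) (v w) (v u') * cross (v u) (v w) (v w') < 0"
  using x unfolding xing_def
proof (elim disjE conjE)
  assume "u < u'" "u' < w'" "w' < w" "up u' \<noteq> up w'"
  then show ?thesis
    using cross_pos_iff[of u u' w] cross_pos_iff[of u w' w] V
    by (auto simp: cross_flip(2)[of "v u" "v w"] mult_less_0_iff)
next
  assume "u' < u" "u < w" "w < w'" "up u \<noteq> up w"
  then show ?thesis
    using cross_pos_iff[of u' u w] cross_pos_iff[of u w w'] V
    by (auto simp: cross_rotate(1)[of "v u" "v w"] mult_less_0_iff)
next
  assume "u < u'" "u' < w" "w < w'" "up u' = up w"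
  then show ?thesis
    using cross_pos_iff[of u u' w] cross_pos_iff[of u w w'] V
    by (cases "up w") (auto simp: cross_flip(2)[of "v u" "v w" "v u'"] mult_less_0_iff intro: mult_neg_neg mult_pos_pos)
next
  assume "u' < u" "u < w'" "w' < w" "up u = up w'"
  then show ?thesis
    using cross_pos_iff[of u' u w] cross_pos_iff[of u w' w] V
    by (cases "up w'") (auto simp: cross_rotate(1)[of "v u" "v w" "v u'"] cross_flip(2)[of "v u" "v w" "v w'"]
        intro: mult_neg_neg mult_pos_pos)
qed

lemma not_xing_same_side:
  assumes V: "u \<in> poly_verts n" "w \<in> poly_verts n" "u' \<in> poly_verts n" "w' \<in> poly_verts n"
    and less: "u < w" "u' < w'" "u < u'" and dist: "{u, w} \<inter> {u', w'} = {}"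
    and x: "\<not> xing up u w u' w'"
  shows "cross (v u) (v w) (v u') * cross (v u) (v w) (v w') > 0"
proof -
  consider "w < u'" | "u' < w" "w' < w" | "u' < w" "w < w'" using dist by fastforce
  then show ?thesis
  proof cases
    case 1
    then show ?thesis
      using cross_pos_iff[of u w u'] cross_pos_iff[of u w w'] V less by (auto simp: zero_less_mult_iff)
  next
    case 2
    then have "up u' = up w'" using x less unfolding xing_def by blast
    then show ?thesis
      using cross_pos_iff[of u u' w] cross_pos_iff[of u w' w] V less 2
      by (auto simp: cross_flip(2)[of "v u" "v w"] zero_less_mult_iff)
  next
    case 3
    then have "up u' \<noteq> up w" using x less unfolding xing_def by blast
    then show ?thesis
      using cross_pos_iff[of u u' w] cross_pos_iff[of u w w'] V less 3
      by (cases "up w") (auto simp: cross_flip(2)[of "v u" "v w" "v u'"] intro: mult_neg_pos mult_pos_neg)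
  qed
qed

text \<open>Crossing chords separate each other's endpoints. Otherwise, the chord with the leftmost
  endpoint has the other one strictly on one side.\<close>

lemma crossing_iff_xing:
  assumes V: "u \<in> poly_verts n" "w \<in> poly_verts n" "u' \<in> poly_verts n" "w' \<in> poly_verts n"
    and less: "u < w" "u' < w'"
  shows "crossing v {u, w} {u', w'} \<longleftrightarrow> xing up u w u' w'"
proof
  assume c: "crossing v {u, w} {u', w'}"
  then have dist: "{u, w} \<inter> {u', w'} = {}" and meet: "seg v {u, w} \<inter> seg v {u', w'} \<noteq> {}"
    by (auto simp: crossing_def)
  show "xing up u w u' w'"
  proof (rule ccontr)
    assume n: "\<not> xing up u w u' w'"
    consider "u < u'" | "u' < u" using dist by fastforce
    then show False
    proof cases
      case 1
      then show False
        using closed_segment_same_side[OF not_xing_same_side[OF V less 1 dist n]] meet by (simp add: seg_eq)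
    next
      case 2
      have "{u', w'} \<inter> {u, w} = {}" "\<not> xing up u' w' u w" using dist n xing_sym by auto
      then show False
        using closed_segment_same_side[OF not_xing_same_side[OF V(3,4,1,2) less(2,1) 2]] meet
        by (simp add: seg_eq Int_commute)
    qed
  qed
next
  assume x: "xing up u w u' w'"
  have "{u, w} \<inter> {u', w'} = {}" using x by (auto simp: xing_def)
  moreover have "xing up u' w' u w" using x xing_sym by blast
  then have "closed_segment (v u) (v w) \<inter> closed_segment (v u') (v w') \<noteq> {}"
    using xing_crosses V x by (intro closed_segment_opposite_sides) auto
  ultimately show "crossing v {u, w} {u', w'}" by (simp add: crossing_def seg_eq)
qed

lemma is_diagonalE:
  assumes "is_diagonal n v d"
  obtains u w where "d = {u, w}" "u < w" "u \<in> poly_verts n" "w \<in> poly_verts n"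
proof -
  obtain i j where "d = {i, j}" "i \<noteq> j" "i \<in> poly_verts n" "j \<in> poly_verts n"
    using assms by (auto simp: is_diagonal_def)
  then show ?thesis using that[of i j] that[of j i] by (cases "i < j") (auto simp: insert_commute)
qed

text \<open>A chord that is crossed has vertices strictly on both sides and so is not a boundary
  edge.\<close>

lemma xing_is_diagonal:
  assumes V: "u \<in> poly_verts n" "w \<in> poly_verts n" "u' \<in> poly_verts n" "w' \<in> poly_verts n"
    and x: "xing up u w u' w'"
  shows "is_diagonal n v {u, w}"
proof -
  have dist: "u' \<notin> {u, w}" "w' \<notin> {u, w}" "u \<noteq> w" using x by (auto simp: xing_def)
  have "\<not> adjacent n v u w"
    using xing_crosses[OF V x] dist V unfolding adjacent_def
    by (meson Diff_iff mult_pos_pos mult_neg_neg order_less_asym)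
  then show ?thesis unfolding is_diagonal_def using V dist by blast
qed

lemma slope_eq:
  assumes "i < j"
  shows "slope v {i, j} = (snd (v j) - snd (v i)) / (fst (v j) - fst (v i))"
  unfolding slope_def
proof (rule the_equality)
  show "\<exists>i' j'. {i, j} = {i', j'} \<and> i' < j' \<and> (snd (v j) - snd (v i)) / (fst (v j) - fst (v i)) =
      (snd (v j') - snd (v i')) / (fst (v j') - fst (v i'))"
    using assms by blast
  show "s = (snd (v j) - snd (v i)) / (fst (v j) - fst (v i))"
    if "\<exists>i' j'. {i, j} = {i', j'} \<and> i' < j' \<and> s = (snd (v j') - snd (v i')) / (fst (v j') - fst (v i'))" for s
    using that assms by (auto simp: doubleton_eq_iff)
qed

lemma slope_chain:
  assumes V: "p \<in> poly_verts n" "q \<in> poly_verts n" "s \<in> poly_verts n" and less: "p < q" "q < s"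
  shows "up q \<Longrightarrow> slope v {q, s} < slope v {p, s} \<and> slope v {p, s} < slope v {p, q}"
    and "\<not> up q \<Longrightarrow> slope v {p, q} < slope v {p, s} \<and> slope v {p, s} < slope v {q, s}"
proof -
  have ps: "p < s" using less by simp
  note x = fst_v_less[OF V(1,2) less(1)] fst_v_less[OF V(2,3) less(2)] fst_v_less[OF V(1,3) ps]
  note sl = slope_eq[OF less(1)] slope_eq[OF less(2)] slope_eq[OF ps]
  show "up q \<Longrightarrow> slope v {q, s} < slope v {p, s} \<and> slope v {p, s} < slope v {p, q}"
    using cross_up[OF V less] x by (simp add: sl cross_def divide_simps algebra_simps)
  show "\<not> up q \<Longrightarrow> slope v {p, q} < slope v {p, s} \<and> slope v {p, s} < slope v {q, s}"
    using cross_down[OF V less] x by (simp add: sl cross_def divide_simps algebra_simps)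
qed

text \<open>A third chord, joining an endpoint of one chord to an endpoint of the other, has a slope
  strictly between the two; \<open>slope_chain\<close> is applied to the two triangles at this
  chord.\<close>

lemma xing_up_slope:
  assumes V: "u \<in> poly_verts n" "w \<in> poly_verts n" "u' \<in> poly_verts n" "w' \<in> poly_verts n"
    and x: "xing_up up u w u' w'"
  shows "slope v {u, w} < slope v {u', w'}"
  using x unfolding xing_up_def
proof (elim disjE conjE)
  assume "u < u'" "u' < w'" "w' < w" "\<not> up u'" "up w'"
  then show ?thesis using slope_chain(2)[of u u' w'] slope_chain(1)[of u w' w] V by force
next
  assume "u' < u" "u < w" "w < w'" "up u" "\<not> up w"
  then show ?thesis using slope_chain(1)[of u' u w] slope_chain(2)[of u' w w'] V by force
next
  assume "u < u'" "u' < w" "w < w'" "\<not> up u'" "\<not> up w"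
  then show ?thesis using slope_chain(2)[of u u' w] slope_chain(2)[of u' w w'] V by force
next
  assume "u' < u" "u < w'" "w' < w" "up u" "up w'"
  then show ?thesis using slope_chain(1)[of u' u w'] slope_chain(1)[of u w' w] V by force
qed

lemma neg_diag_pair: "neg_diag {u, w} = {- u, - w}"
  by (simp add: neg_diag_def)

lemma neg_diag_neg_diag [simp]: "neg_diag (neg_diag d) = d"
  by (auto simp: neg_diag_def image_image)

lemma slope_neg_diag:
  assumes "is_diagonal n v d"
  shows "slope v (neg_diag d) = slope v d"
proof -
  obtain u w where d: "d = {u, w}" "u < w" "u \<in> poly_verts n" "w \<in> poly_verts n"
    using is_diagonalE[OF assms] by blast
  have "neg_diag d = {- w, - u}" by (auto simp: d neg_diag_pair)
  then show ?thesis using slope_eq[of "- w" "- u"] slope_eq[of u w] d by (simp add: v_minus)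
qed

subsection \<open>Triangulations from orders\<close>

text \<open>Path edges include the boundary edges of the polygon. These lie on paths of every
  injective order (\<open>not_diagonal_path_edge\<close>), so dropping them loses no
  information.\<close>

definition tri :: "(int \<Rightarrow> int) \<Rightarrow> int set set" where
  "tri pos = {{u, w} | u w. (u, w) \<in> path_edges n up pos \<and> is_diagonal n v {u, w}}"

lemma tri_iff:
  assumes "u < w"
  shows "{u, w} \<in> tri pos \<longleftrightarrow> (u, w) \<in> path_edges n up pos \<and> is_diagonal n v {u, w}"
proof
  assume "{u, w} \<in> tri pos"
  then obtain u' w' where e: "{u, w} = {u', w'}" "(u', w') \<in> path_edges n up pos" "is_diagonal n v {u', w'}"
    by (auto simp: tri_def)
  then have "u' < w'" using path_edgesD(3) by blast
  then have "u' = u" "w' = w" using e(1) assms by (auto simp: doubleton_eq_iff)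
  then show "(u, w) \<in> path_edges n up pos \<and> is_diagonal n v {u, w}" using e by simp
qed (auto simp: tri_def)

lemma not_diagonal_path_edge:
  assumes "inj_on pos (signed_idx n)" "u \<in> poly_verts n" "w \<in> poly_verts n" "u < w" "\<not> is_diagonal n v {u, w}"
  shows "(u, w) \<in> path_edges n up pos"
  using path_edges_maximal[OF assms(1-4)] xing_is_diagonal assms path_edgesD(1,2) by (metis (no_types))

lemma tri_eq_iff:
  assumes "inj_on pos (signed_idx n)" "inj_on pos' (signed_idx n)"
  shows "tri pos = tri pos' \<longleftrightarrow> path_edges n up pos = path_edges n up pos'"
proof
  have sub: "path_edges n up p \<subseteq> path_edges n up p'" if "tri p \<subseteq> tri p'" "inj_on p' (signed_idx n)" for p p'
  proof (rule subrelI)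
    fix u w assume e: "(u, w) \<in> path_edges n up p"
    then show "(u, w) \<in> path_edges n up p'"
      using tri_iff[of u w p] tri_iff[of u w p'] not_diagonal_path_edge[OF that(2)] that(1) path_edgesD(1-3)[OF e]
      by (cases "is_diagonal n v {u, w}") auto
  qed
  assume "tri pos = tri pos'"
  then show "path_edges n up pos = path_edges n up pos'" using sub assms by (metis order_antisym order_refl)
qed (auto simp: tri_def)

lemma triangulation_tri:
  assumes inj: "inj_on pos (signed_idx n)"
  shows "triangulation n v (tri pos)"
  unfolding triangulation_def
proof (intro conjI ballI allI impI)
  fix d assume "d \<in> tri pos"
  then show "is_diagonal n v d" by (auto simp: tri_def)
next
  fix d e assume "d \<in> tri pos" "e \<in> tri pos"
  then show "\<not> crossing v d e"
    using path_edges_noncrossing by (auto simp: tri_def crossing_iff_xing path_edgesD(1-3))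
next
  fix d assume d: "is_diagonal n v d \<and> d \<notin> tri pos"
  then obtain u w where uw: "d = {u, w}" "u < w" "u \<in> poly_verts n" "w \<in> poly_verts n"
    using is_diagonalE by blast
  then have "(u, w) \<notin> path_edges n up pos" using d tri_iff by auto
  from path_edges_maximal[OF inj uw(3,4,2) this]
  obtain u' w' where e: "(u', w') \<in> path_edges n up pos" "xing up u w u' w'" by blast
  note V = path_edgesD(1-3)[OF e(1)]
  have "is_diagonal n v {u', w'}"
    using xing_is_diagonal[OF V(1,2) uw(3,4)] e(2) xing_sym by blast
  then have "{u', w'} \<in> tri pos" using tri_iff[OF V(3)] e(1) by blast
  moreover have "crossing v d {u', w'}" using crossing_iff_xing[OF uw(3,4) V(1,2) uw(2) V(3)] e(2) uw(1) by blast
  ultimately show "\<exists>e\<in>tri pos. crossing v d e" by blast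
qed

lemma triangulationD:
  assumes "triangulation n v T"
  shows "d \<in> T \<Longrightarrow> is_diagonal n v d"
    and "d \<in> T \<Longrightarrow> e \<in> T \<Longrightarrow> \<not> crossing v d e"
    and "is_diagonal n v d \<Longrightarrow> d \<notin> T \<Longrightarrow> \<exists>e\<in>T. crossing v d e"
  using assms unfolding triangulation_def by blast+

lemma triangulation_subset_eq:
  assumes "triangulation n v T" "triangulation n v T'" "T \<subseteq> T'"
  shows "T = T'"
  using assms unfolding triangulation_def by (meson subsetD subsetI subset_antisym)

subsection \<open>Flips\<close>

text \<open>Position of a vertex in counterclockwise order along the boundary, starting from the
  leftmost vertex.\<close>

definition circ :: "int \<Rightarrow> int" where
  "circ i = (if i \<in> signed_idx n \<and> up i then 2 * (int n + 2) - i else i)"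

text \<open>Crossing of chords in terms of the \<open>circ\<close> numbers of their endpoints. No
  side is distinguished here, so arguments about quadrilaterals need no case distinction by up and
  down.\<close>

definition ilv :: "int \<Rightarrow> int \<Rightarrow> int \<Rightarrow> int \<Rightarrow> bool" where
  "ilv a c b d \<longleftrightarrow> a \<noteq> b \<and> a \<noteq> d \<and> c \<noteq> b \<and> c \<noteq> d \<and>
     (min a c < b \<and> b < max a c) \<noteq> (min a c < d \<and> d < max a c)"

lemma ilv_comm: "ilv x y z t \<longleftrightarrow> ilv y x z t" "ilv x y z t \<longleftrightarrow> ilv x y t z"
  by (simp_all only: ilv_def min.commute[of x y] max.commute[of x y]) blast+

lemma circ_inj: "i \<in> poly_verts n \<Longrightarrow> j \<in> poly_verts n \<Longrightarrow> circ i = circ j \<longleftrightarrow> i = j"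
  by (auto simp: circ_def poly_verts_iff signed_idx_iff split: if_splits)

lemma xing_iff_ilv:
  assumes V: "u \<in> poly_verts n" "w \<in> poly_verts n" "u' \<in> poly_verts n" "w' \<in> poly_verts n"
    and less: "u < w" "u' < w'"
  shows "xing up u w u' w' \<longleftrightarrow> ilv (circ u) (circ w) (circ u') (circ w')"
proof -
  \<comment> \<open>The up labels are numbered backwards after all others:
    \<open>2 * (n + 2) - i\<close> exceeds \<open>n + 1\<close> for
    \<open>i \<le> n\<close>.\<close>
  have c: "up i \<and> - int n \<le> i \<and> i \<le> int n \<and> circ i = 2 * (int n + 2) - i \<or>
      (\<not> up i \<or> i = - int n - 1 \<or> i = int n + 1) \<and> circ i = i" if "i \<in> poly_verts n" for i
    using that by (auto simp: circ_def poly_verts_iff signed_idx_iff)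
  have b: "- int n - 1 \<le> i \<and> i \<le> int n + 1" if "i \<in> poly_verts n" for i
    using that by (auto simp: poly_verts_iff)
  show ?thesis
    using c[OF V(1)] c[OF V(2)] c[OF V(3)] c[OF V(4)] b[OF V(1)] b[OF V(2)] b[OF V(3)] b[OF V(4)] less
    unfolding xing_def ilv_def by (smt (verit))
qed

lemma crossing_iff_ilv:
  assumes V: "a \<in> poly_verts n" "c \<in> poly_verts n" "b \<in> poly_verts n" "d \<in> poly_verts n"
    and "a \<noteq> c" "b \<noteq> d"
  shows "crossing v {a, c} {b, d} \<longleftrightarrow> ilv (circ a) (circ c) (circ b) (circ d)"
proof -
  have main: "crossing v {a, c} {b, d} \<longleftrightarrow> ilv (circ a) (circ c) (circ b) (circ d)"
    if "a \<in> poly_verts n" "c \<in> poly_verts n" "b \<in> poly_verts n" "d \<in> poly_verts n" "a < c" "b < d" for a b c d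
    using crossing_iff_xing[OF that] xing_iff_ilv[OF that] by simp
  consider "a < c" "b < d" | "a < c" "d < b" | "c < a" "b < d" | "c < a" "d < b" using assms(5,6) by linarith
  then show ?thesis
    using main[of a c b d] main[of a c d b] main[of c a b d] main[of c a d b] V ilv_comm
    by cases (metis insert_commute)+
qed

lemma ilv_side:
  assumes "ilv a c b d" "ilv e f a c" "\<not> (e = b \<and> f = d)" "\<not> (e = d \<and> f = b)"
  shows "ilv e f a b \<or> ilv e f c b \<or> ilv e f c d \<or> ilv e f a d"
  using assms unfolding ilv_def by (smt (verit))

lemma ilv_through:
  assumes "ilv a c b d" "ilv e f a b"
  shows "ilv e f a c \<or> ilv e f b d"
  using assms unfolding ilv_def by (smt (verit))

text \<open>By maximality of \<open>T\<close> the new diagonal crosses an element of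
  \<open>T\<close>, and all elements except \<open>d\<close> stay together with \<open>d'\<close> in
  \<open>T'\<close>.\<close>

lemma flip_crossing:
  assumes "flip n v T d d' T'"
  shows "crossing v d d'"
proof -
  have d': "is_diagonal n v d'" "d' \<notin> T" using assms by (auto simp: flip_def triangulation_def)
  then obtain f where f: "f \<in> T" "crossing v d' f"
    using assms by (auto simp: flip_def triangulation_def)
  have "f = d"
  proof (rule ccontr)
    assume "f \<noteq> d"
    then have "f \<in> T'" "d' \<in> T'" "triangulation n v T'" using f assms by (auto simp: flip_def)
    then show False using f by (auto simp: triangulation_def)
  qed
  then show ?thesis using f crossing_sym by blast
qed

text \<open>The sides of the quadrilateral of a flip other than boundary edges belong to the
  triangulation, because a diagonal crossing a side would cross one of its diagonals. Any further
  diagonal crossing \<open>d\<close> leaves the quadrilateral through one of the sides.\<close>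

lemma flip_unique:
  assumes fl: "flip n v T d d' T'" and e: "is_diagonal n v e" "crossing v e d" "e \<noteq> d'"
  obtains g where "g \<in> T" "g \<noteq> d" "g \<inter> d \<noteq> {}" "crossing v e g"
proof -
  have tri: "triangulation n v T" "triangulation n v T'" "d \<in> T" "d' \<in> T'" "T - {d} \<subseteq> T'"
    using fl by (auto simp: flip_def)
  have "is_diagonal n v d" "is_diagonal n v d'" using tri by (auto simp: triangulation_def)
  then obtain a c b h where ac: "d = {a, c}" "a < c" "a \<in> poly_verts n" "c \<in> poly_verts n"
    and bh: "d' = {b, h}" "b < h" "b \<in> poly_verts n" "h \<in> poly_verts n"
    using is_diagonalE by metis
  obtain p q where pq: "e = {p, q}" "p < q" "p \<in> poly_verts n" "q \<in> poly_verts n"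
    using is_diagonalE[OF e(1)] by metis
  have x: "ilv (circ a) (circ c) (circ b) (circ h)"
    using flip_crossing[OF fl] crossing_iff_ilv[of a c b h] ac bh by auto
  have y: "ilv (circ p) (circ q) (circ a) (circ c)"
    using e(2) crossing_iff_ilv[of p q a c] ac pq by auto
  have "\<not> (circ p = circ b \<and> circ q = circ h)" "\<not> (circ p = circ h \<and> circ q = circ b)"
    using e(3) circ_inj pq bh by auto
  from ilv_side[OF x y this] obtain s t where st: "s \<in> {a, c}" "t \<in> {b, h}" "ilv (circ p) (circ q) (circ s) (circ t)"
    by blast
  have dist: "a \<noteq> b" "a \<noteq> h" "c \<noteq> b" "c \<noteq> h" using x by (auto simp: ilv_def)
  have stV: "s \<in> poly_verts n" "t \<in> poly_verts n" "s \<noteq> t" using st ac bh dist by auto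
  have cross: "crossing v e {s, t}" using crossing_iff_ilv[of p q s t] pq stV st(3) by auto
  have diag: "is_diagonal n v {s, t}"
  proof -
    have sym: "crossing v {s, t} {p, q}" using cross pq crossing_sym by blast
    show ?thesis
    proof (cases "s < t")
      case True
      then show ?thesis using xing_is_diagonal[of s t p q] crossing_iff_xing[of s t p q] sym pq stV by blast
    next
      case False
      then have "t < s" using stV by simp
      then show ?thesis
        using xing_is_diagonal[of t s p q] crossing_iff_xing[of t s p q] sym pq stV by (metis insert_commute)
    qed
  qed
  have "{s, t} \<in> T"
  proof (rule ccontr)
    assume "{s, t} \<notin> T"
    then obtain f where f: "f \<in> T" "crossing v {s, t} f" using diag triangulationD(3)[OF tri(1)] by blast
    have "is_diagonal n v f" using triangulationD(1)[OF tri(1)] f(1) by blast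
    then obtain k l where kl: "f = {k, l}" "k < l" "k \<in> poly_verts n" "l \<in> poly_verts n"
      using is_diagonalE by metis
    have fst: "ilv (circ k) (circ l) (circ s) (circ t)"
      using f(2) crossing_sym crossing_iff_ilv[of k l s t] kl stV by auto
    obtain s' t' where st': "{s, s'} = {a, c}" "{t, t'} = {b, h}" using st by blast
    have "ilv (circ s) (circ s') (circ t) (circ t')"
      using x st' ilv_comm unfolding doubleton_eq_iff by metis
    note through = ilv_through[OF this fst]
    have "s' \<in> {a, c}" "t' \<in> {b, h}" using st' by blast+
    then have V': "s' \<in> poly_verts n" "t' \<in> poly_verts n" using ac bh by auto
    have "card {s, s'} = 2" "card {t, t'} = 2" unfolding st' using ac(2) bh(2) by simp_all
    then have ne': "s \<noteq> s'" "t \<noteq> t'" by auto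
    have "crossing v f {s, s'} \<or> crossing v f {t, t'}"
      using through crossing_iff_ilv[of k l s s'] crossing_iff_ilv[of k l t t'] kl stV V' ne' by auto
    then have "crossing v f d \<or> crossing v f d'" using st' ac(1) bh(1) by simp
    moreover have "\<not> crossing v f d" using triangulationD(2)[OF tri(1)] f(1) tri(3) by blast
    moreover have "f \<noteq> d" using f(2) st(1) ac by (auto simp: crossing_def)
    then have "f \<in> T'" using f(1) tri(5) by blast
    then have "\<not> crossing v f d'" using triangulationD(2)[OF tri(2)] tri(4) by blast
    ultimately show False by blast
  qed
  moreover have "t \<notin> d" using st(2) dist ac(1) by auto
  then have "{s, t} \<noteq> d" by blast
  moreover have "{s, t} \<inter> d \<noteq> {}" using st ac by auto
  ultimately show ?thesis using that cross by blast
qed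

end

section \<open>Forcing among the contractions\<close>

lemma lo_pos: "0 < k \<Longrightarrow> lo k = int k"
  by (simp add: lo_def)

lemma InvI: "w \<in> Bn n \<Longrightarrow> i \<in> signed_idx n \<Longrightarrow> j \<in> signed_idx n \<Longrightarrow> j < i \<Longrightarrow> w i < w j \<Longrightarrow> (w i, w j) \<in> Inv n w"
  by (simp add: Inv_iff)

lemma NinvI: "w \<in> Bn n \<Longrightarrow> i \<in> signed_idx n \<Longrightarrow> j \<in> signed_idx n \<Longrightarrow> i < j \<Longrightarrow> w i < w j \<Longrightarrow> (w i, w j) \<in> Ninv n w"
  by (simp add: Ninv_iff)

lemma wle_ascent:
  assumes "w \<in> Bn n" "k < n" "w (lo k) < w (hi k)"
  shows "wle n w (w \<circ> gen k)"
  using Inv_step(1)[OF assms] assms by (auto simp: wle_iff)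

lemma wle_descent:
  assumes "w \<in> Bn n" "k < n" "w (hi k) < w (lo k)"
  shows "wle n (w \<circ> gen k) w"
  using wle_ascent[of "w \<circ> gen k" n k] assms by simp

lemma wle_step_mono:
  assumes x: "x \<in> Bn n" "k < n" "x (lo k) < x (hi k)"
    and x': "x' \<in> Bn n" "k' < n" "x' (lo k') = x (lo k)" "x' (hi k') = x (hi k)"
    and le: "wle n x x'"
  shows "wle n (x \<circ> gen k) (x' \<circ> gen k')"
proof -
  have "Inv n (x' \<circ> gen k') = Inv n x' \<union> {(x (lo k), x (hi k)), (- x (hi k), - x (lo k))}"
    using Inv_step(1)[OF x'(1,2)] x(3) unfolding x'(3,4) by blast
  then show ?thesis using Inv_step(1)[OF x] le x x' by (auto simp: wle_iff)
qed

section \<open>Deductions valid in every lattice congruence\<close>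

locale weak_order_cong = signed_orientation n up for n :: nat and up :: "int \<Rightarrow> bool" +
  fixes Th :: "((int \<Rightarrow> int) \<times> (int \<Rightarrow> int)) set"
  assumes cong: "lattice_cong n Th"
begin

lemma Th_equiv: "equiv (Bn n) Th"
  using cong by (simp add: lattice_cong_def)

lemma Th_refl: "x \<in> Bn n \<Longrightarrow> (x, x) \<in> Th"
  using Th_equiv by (simp add: equiv_def refl_on_def)

lemma Th_sym: "(x, y) \<in> Th \<Longrightarrow> (y, x) \<in> Th"
  using Th_equiv by (meson equiv_def symD)

lemma Th_trans: "(x, y) \<in> Th \<Longrightarrow> (y, z) \<in> Th \<Longrightarrow> (x, z) \<in> Th"
  using Th_equiv by (meson equiv_def transD)

lemma Th_join: "(x, y) \<in> Th \<Longrightarrow> z \<in> Bn n \<Longrightarrow> (wjoin n x z, wjoin n y z) \<in> Th"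
  and Th_meet: "(x, y) \<in> Th \<Longrightarrow> z \<in> Bn n \<Longrightarrow> (wmeet n x z, wmeet n y z) \<in> Th"
  using cong by (auto simp: lattice_cong_def)

lemma Th_between:
  assumes B: "x \<in> Bn n" "y \<in> Bn n" "z \<in> Bn n" and le: "wle n x y" "wle n y z" and xz: "(x, z) \<in> Th"
  shows "(x, y) \<in> Th"
  using Th_meet[OF xz B(2)] wmeet_absorb[OF B(1,2) le(1)] wmeet_absorb[OF B(2,3) le(2)] by simp

text \<open>Joining the collapse of \<open>x2\<close> and \<open>y2\<close> with \<open>x\<close>
  makes \<open>x\<close> congruent to \<open>wjoin n y2 x\<close>. The closure hypothesis puts the
  swapped pair among the inversions of this join, which therefore lies above
  \<open>x \<circ> gen k\<close>; classes being convex, the ascent collapses.\<close>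

lemma force_join:
  assumes x: "x \<in> Bn n" "k < n" "x (lo k) < x (hi k)"
    and B: "x2 \<in> Bn n" "y2 \<in> Bn n" and Th: "(x2, y2) \<in> Th" and le: "wle n x2 x"
    and tr: "(x (lo k), x (hi k)) \<in> (Inv n x \<union> Inv n y2)\<^sup>+"
  shows "(x, x \<circ> gen k) \<in> Th"
proof -
  let ?y = "x \<circ> gen k"
  define z where "z = wjoin n y2 x"
  have y: "?y \<in> Bn n" using x by simp
  have z: "z \<in> Bn n" "Inv n z = (Inv n y2 \<union> Inv n x)\<^sup>+" using wjoin_Inv[OF B(2) x(1)] by (simp_all add: z_def)
  have "(x (lo k), x (hi k)) \<in> Inv n z" using tr z(2) by (simp add: Un_commute)
  moreover from this have "(- x (hi k), - x (lo k)) \<in> Inv n z" using Inv_sym[OF z(1)] by blast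
  moreover have "Inv n x \<subseteq> Inv n z" using z by auto
  ultimately have "wle n ?y z" using Inv_step(1)[OF x] y z(1) by (simp add: wle_iff)
  moreover have "(x, z) \<in> Th"
    using Th_join[OF Th x(1)] wjoin_absorb(1)[OF B(1) x(1) le] by (simp add: z_def)
  ultimately show ?thesis using Th_between[OF x(1) y z(1) wle_ascent[OF x]] by blast
qed

text \<open>The dual of \<open>force_join\<close>: the meet of \<open>x2\<close> with
  \<open>x \<circ> gen k\<close> is congruent to the latter and lies below \<open>x\<close>.\<close>

lemma force_meet:
  assumes x: "x \<in> Bn n" "k < n" "x (lo k) < x (hi k)"
    and B: "x2 \<in> Bn n" "y2 \<in> Bn n" and Th: "(x2, y2) \<in> Th" and le: "wle n (x \<circ> gen k) y2"
    and tr: "(x (lo k), x (hi k)) \<in> (Ninv n (x \<circ> gen k) \<union> Ninv n x2)\<^sup>+"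
  shows "(x, x \<circ> gen k) \<in> Th"
proof -
  let ?y = "x \<circ> gen k"
  define z where "z = wmeet n x2 ?y"
  have y: "?y \<in> Bn n" using x by simp
  have z: "z \<in> Bn n" "Ninv n z = (Ninv n x2 \<union> Ninv n ?y)\<^sup>+" using wmeet_Ninv[OF B(1) y] by (simp_all add: z_def)
  have "(x (lo k), x (hi k)) \<in> Ninv n z" using tr z(2) by (simp add: Un_commute)
  then have "(x (lo k), x (hi k)) \<notin> Inv n z" by (simp add: Ninv_def)
  moreover from this have "(- x (hi k), - x (lo k)) \<notin> Inv n z" using Inv_sym[OF z(1)] by blast
  moreover have "Inv n z \<subseteq> Inv n ?y" using wmeet_lower(2)[OF B(1) y] z(1) y by (simp add: z_def wle_iff)
  ultimately have "Inv n z \<subseteq> Inv n x" using Inv_step(1)[OF x] by auto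
  then have zx: "wle n z x" using z x by (simp add: wle_iff)
  have "(z, ?y) \<in> Th"
    using Th_meet[OF Th y] wmeet_absorb(2)[OF y B(2) le] by (simp add: z_def)
  moreover from this have "(z, x) \<in> Th" using Th_between[OF z(1) x(1) y zx wle_ascent[OF x]] by blast
  ultimately show ?thesis using Th_sym Th_trans by blast
qed

text \<open>Between comparable elements only the exchanged values matter, not their positions: a
  meet carries the collapse down and a join carries it up.\<close>

lemma nested:
  assumes x: "x \<in> Bn n" "k < n" "x (lo k) < x (hi k)"
    and x': "x' \<in> Bn n" "k' < n" "x' (lo k') = x (lo k)" "x' (hi k') = x (hi k)"
    and le: "wle n x x' \<or> wle n x' x" and Th: "(x', x' \<circ> gen k') \<in> Th"
  shows "(x, x \<circ> gen k) \<in> Th"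
  using le
proof
  have asc: "x' (lo k') < x' (hi k')" using x x' by simp
  have y': "x' \<circ> gen k' \<in> Bn n" using x' by simp
  { assume "wle n x x'"
    then show ?thesis
      using force_meet[OF x x'(1) y' Th] wle_step_mono[OF x x'] NinvI[OF x'(1), of "lo k'" "hi k'"] x x' asc
      by (simp add: r_into_trancl) }
  { assume "wle n x' x"
    then show ?thesis
      using force_join[OF x x'(1) y' Th] Inv_step(1)[OF x'(1,2) asc] x' by (simp add: r_into_trancl) }
qed

lemma move_far:
  assumes x: "x \<in> Bn n" "k < n" "x (lo k) < x (hi k)" and j: "j < n" "k + 2 \<le> j \<or> j + 2 \<le> k"
    and Th: "(x \<circ> gen j, x \<circ> gen j \<circ> gen k) \<in> Th"
  shows "(x, x \<circ> gen k) \<in> Th"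
proof (rule nested[OF x _ x(2) _ _ _ Th])
  show "x \<circ> gen j \<in> Bn n" using x j by simp
  show "(x \<circ> gen j) (lo k) = x (lo k)" "(x \<circ> gen j) (hi k) = x (hi k)"
    using j(2) by (auto simp: gen_eq lo_def hi_def)
  show "wle n x (x \<circ> gen j) \<or> wle n (x \<circ> gen j) x"
    using wle_ascent[OF x(1) j(1)] wle_descent[OF x(1) j(1)] Bn_not_less[OF x(1)] by blast
qed

lemma contracted_transfer:
  assumes "contracted x k b" "x' (lo k') < b" "b < x' (hi k')"
    and "inv x b < lo k \<Longrightarrow> inv x' b < lo k'" "hi k < inv x b \<Longrightarrow> hi k' < inv x' b"
  shows "contracted x' k' b"
  using assms by (auto simp: contracted_def)

lemma inv_gen_app: "x \<in> Bn n \<Longrightarrow> inv (x \<circ> gen j) b = gen j (inv x b)"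
  by (simp add: inv_comp_gen)

lemma inv_eq_conv: "x \<in> Bn n \<Longrightarrow> inv x b = i \<longleftrightarrow> x i = b"
  by auto

lemma contractedD:
  assumes "contracted x k b"
  shows "x (lo k) < b" "b < x (hi k)" "b \<in> signed_idx n"
  using assms by (auto simp: contracted_def)

lemma gen_far:
  assumes "k + 2 \<le> j \<or> j + 2 \<le> k"
  shows "gen j (lo k) = lo k" "gen j (hi k) = hi k"
    "p < lo k \<Longrightarrow> gen j p < lo k" "hi k < p \<Longrightarrow> hi k < gen j p"
  using assms by (auto simp: gen_eq lo_def hi_def split: if_splits)

lemma contracted_far:
  assumes x: "x \<in> Bn n" and j: "k + 2 \<le> j \<or> j + 2 \<le> k" and c: "contracted x k b"
  shows "contracted (x \<circ> gen j) k b"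
  using contractedD[OF c] gen_far[OF j]
  by (intro contracted_transfer[OF c]) (simp_all add: inv_gen_app[OF x])

text \<open>The pair moves one place to the left past the entry \<open>x m\<close>. As this entry is
  not between the two values, passing it takes two ascents or two descents, so the old and the new
  element are comparable.\<close>

lemma shift_left:
  assumes x: "x \<in> Bn n" "Suc m < n" "x (lo (Suc m)) < x (hi (Suc m))" and m: "0 < m"
    and out: "x (int m) < x (lo (Suc m)) \<or> x (hi (Suc m)) < x (int m)"
    and Th: "(x \<circ> gen m \<circ> gen (Suc m), x \<circ> gen m \<circ> gen (Suc m) \<circ> gen m) \<in> Th"
  shows "(x, x \<circ> gen (Suc m)) \<in> Th"
proof (rule nested[OF x _ _ _ _ _ Th])
  let ?w = "x \<circ> gen m" and ?x' = "x \<circ> gen m \<circ> gen (Suc m)"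
  show B: "?x' \<in> Bn n" "m < n" using x by simp_all
  have w: "?w \<in> Bn n" using x by simp
  have "gen m (gen (Suc m) (lo m)) = lo (Suc m)" "gen m (gen (Suc m) (hi m)) = hi (Suc m)"
    using m by (simp_all add: gen_eq lo_def hi_def)
  then show "?x' (lo m) = x (lo (Suc m))" "?x' (hi m) = x (hi (Suc m))" by simp_all
  have "gen m (int m + 1) = int m" "gen m (int m + 2) = int m + 2"
    using m by (simp_all add: gen_eq lo_def hi_def)
  then have v: "lo m = int m" "hi m = int m + 1" "lo (Suc m) = int m + 1" "hi (Suc m) = int m + 2"
    "?w (int m + 1) = x (int m)" "?w (int m + 2) = x (int m + 2)"
    using m by (simp_all add: lo_def hi_def)
  from out show "wle n x ?x' \<or> wle n ?x' x"
  proof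
    assume less: "x (int m) < x (lo (Suc m))"
    have "wle n x ?w" using wle_ascent[OF x(1) B(2)] less unfolding v by simp
    moreover have "wle n ?w ?x'" using wle_ascent[OF w x(2)] less x(3) unfolding v by simp
    ultimately show ?thesis using wle_trans by blast
  next
    assume less: "x (hi (Suc m)) < x (int m)"
    have "wle n ?w x" using wle_descent[OF x(1) B(2)] less x(3) unfolding v by simp
    moreover have "wle n ?x' ?w" using wle_descent[OF w x(2)] less unfolding v by simp
    ultimately show ?thesis using wle_trans by blast
  qed
qed

lemma contracted_shift_left:
  assumes x: "x \<in> Bn n" and m: "0 < m" "m < n" and c: "contracted x (Suc m) b" and b: "x (int m) \<noteq> b"
  shows "contracted (x \<circ> gen m \<circ> gen (Suc m)) m b"
proof (rule contracted_transfer[OF c])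
  have w: "x \<circ> gen m \<in> Bn n" using x m by simp
  have p: "inv x b \<noteq> int m" using b by (simp add: inv_eq_conv[OF x])
  have i: "inv (x \<circ> gen m \<circ> gen (Suc m)) b = gen (Suc m) (gen m (inv x b))"
    by (simp add: inv_gen_app[OF w] inv_gen_app[OF x])
  show "(x \<circ> gen m \<circ> gen (Suc m)) (lo m) < b" "b < (x \<circ> gen m \<circ> gen (Suc m)) (hi m)"
    using contractedD[OF c] m by (simp_all add: gen_eq lo_def hi_def add.commute)
  show "inv x b < lo (Suc m) \<Longrightarrow> inv (x \<circ> gen m \<circ> gen (Suc m)) b < lo m"
    "hi (Suc m) < inv x b \<Longrightarrow> hi m < inv (x \<circ> gen m \<circ> gen (Suc m)) b"
    using p m unfolding i by (auto simp: gen_eq lo_def hi_def)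
qed

lemma shift_right:
  assumes x: "x \<in> Bn n" "Suc k < n" "x (lo k) < x (hi k)" and k: "0 < k"
    and out: "x (int k + 2) < x (lo k) \<or> x (hi k) < x (int k + 2)"
    and Th: "(x \<circ> gen (Suc k) \<circ> gen k, x \<circ> gen (Suc k) \<circ> gen k \<circ> gen (Suc k)) \<in> Th"
  shows "(x, x \<circ> gen k) \<in> Th"
proof (rule nested[OF x(1) _ x(3) _ x(2) _ _ _ Th])
  let ?w = "x \<circ> gen (Suc k)" and ?x' = "x \<circ> gen (Suc k) \<circ> gen k"
  show B: "?x' \<in> Bn n" "k < n" using x by simp_all
  have w: "?w \<in> Bn n" using x by simp
  have "gen (Suc k) (int k) = int k" "gen (Suc k) (int k + 1) = int k + 2"
    using k by (simp_all add: gen_eq lo_def hi_def)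
  then have v: "lo (Suc k) = int k + 1" "hi (Suc k) = int k + 2" "lo k = int k" "hi k = int k + 1"
    "?w (int k) = x (int k)" "?w (int k + 1) = x (int k + 2)"
    using k by (simp_all add: lo_def hi_def)
  have "gen (Suc k) (gen k (lo (Suc k))) = lo k" "gen (Suc k) (gen k (hi (Suc k))) = hi k"
    using k by (simp_all add: gen_eq lo_def hi_def)
  then show "?x' (lo (Suc k)) = x (lo k)" "?x' (hi (Suc k)) = x (hi k)" by simp_all
  from out show "wle n x ?x' \<or> wle n ?x' x"
  proof
    assume less: "x (int k + 2) < x (lo k)"
    have "wle n ?w x" using wle_descent[OF x(1,2)] less x(3) unfolding v by simp
    moreover have "wle n ?x' ?w" using wle_descent[OF w B(2)] less x(3) unfolding v by simp
    ultimately show ?thesis using wle_trans by blast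
  next
    assume less: "x (hi k) < x (int k + 2)"
    have "wle n x ?w" using wle_ascent[OF x(1,2)] less unfolding v by simp
    moreover have "wle n ?w ?x'" using wle_ascent[OF w B(2)] less x(3) unfolding v by simp
    ultimately show ?thesis using wle_trans by blast
  qed
qed

lemma contracted_shift_right:
  assumes x: "x \<in> Bn n" and k: "0 < k" "Suc k < n" and c: "contracted x k b" and b: "x (int k + 2) \<noteq> b"
  shows "contracted (x \<circ> gen (Suc k) \<circ> gen k) (Suc k) b"
proof (rule contracted_transfer[OF c])
  have w: "x \<circ> gen (Suc k) \<in> Bn n" using x k by simp
  have p: "inv x b \<noteq> int k + 2" using b by (simp add: inv_eq_conv[OF x])
  have i: "inv (x \<circ> gen (Suc k) \<circ> gen k) b = gen k (gen (Suc k) (inv x b))"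
    by (simp add: inv_gen_app[OF w] inv_gen_app[OF x])
  show "(x \<circ> gen (Suc k) \<circ> gen k) (lo (Suc k)) < b" "b < (x \<circ> gen (Suc k) \<circ> gen k) (hi (Suc k))"
    using contractedD[OF c] k by (simp_all add: gen_eq lo_def hi_def add.commute)
  show "inv x b < lo k \<Longrightarrow> inv (x \<circ> gen (Suc k) \<circ> gen k) b < lo (Suc k)"
    "hi k < inv x b \<Longrightarrow> hi (Suc k) < inv (x \<circ> gen (Suc k) \<circ> gen k) b"
    using p k unfolding i by (auto simp: gen_eq lo_def hi_def)
qed

text \<open>Induction hypothesis of the forcing argument, by the height of the ascent.\<close>

definition forces :: "int \<Rightarrow> bool" where
  "forces s \<longleftrightarrow> (\<forall>x k b. x \<in> Bn n \<longrightarrow> k < n \<longrightarrow> x (lo k) < x (hi k) \<longrightarrow> contracted x k b \<longrightarrow>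
     x (hi k) - x (lo k) < s \<longrightarrow> (x, x \<circ> gen k) \<in> Th)"

lemma forcesD: "forces s \<Longrightarrow> x \<in> Bn n \<Longrightarrow> k < n \<Longrightarrow> contracted x k b \<Longrightarrow>
     x (hi k) - x (lo k) < s \<Longrightarrow> (x, x \<circ> gen k) \<in> Th"
  unfolding forces_def using contractedD by (meson order_less_trans)

text \<open>Let the ascent consist of \<open>a < c\<close>, and let a neighboring value \<open>q\<close> lie between them. Whichever
  of \<open>(a, q)\<close> and \<open>(q, c)\<close> still straddles \<open>b\<close> gives a shorter contraction, from which a join or a
  meet produces the contraction of \<open>(a, c)\<close>.\<close>

lemma right_neighbor:
  assumes x: "x \<in> Bn n" "Suc k < n" "x (lo k) < x (hi k)" and k: "0 < k"
    and c: "contracted x k b" and IH: "forces (x (hi k) - x (lo k))"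
    and q: "x (lo k) < x (int k + 2)" "x (int k + 2) < x (hi k)" "x (int k + 2) \<noteq> b"
  shows "(x, x \<circ> gen k) \<in> Th"
proof -
  have kn: "k < n" using x by simp
  have pos: "int k \<in> signed_idx n" "int k + 1 \<in> signed_idx n" "int k + 2 \<in> signed_idx n"
    using x k by (auto simp: signed_idx_iff)
  have v: "lo (Suc k) = int k + 1" "hi (Suc k) = int k + 2" "lo k = int k" "hi k = int k + 1"
    using k by (simp_all add: lo_def hi_def)
  have g: "gen k (int k) = int k + 1" "gen k (int k + 1) = int k" "gen k (int k + 2) = int k + 2"
    "gen (Suc k) (int k) = int k" "gen (Suc k) (int k + 1) = int k + 2" "gen (Suc k) (int k + 2) = int k + 1"
    using k by (simp_all add: gen_eq lo_def hi_def)
  have p: "inv x b \<noteq> int k + 2" using q(3) by (simp add: inv_eq_conv[OF x(1)])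
  note less = x(3)[unfolded v] q(1,2)[unfolded v] contractedD(1,2)[OF c, unfolded v]
  consider "b < x (int k + 2)" | "x (int k + 2) < b" using q(3) by linarith
  then show ?thesis
  proof cases
    case 1
    \<comment> \<open>With entries \<open>a c q\<close> in \<open>x\<close>, these are
      \<open>x2 = a q c\<close> and \<open>x2 \<circ> gen k = q a c\<close>; the join combines the
      inversion \<open>(a, q)\<close> of the latter with \<open>(q, c)\<close> of
      \<open>x\<close>.\<close>
    define x2 where "x2 = x \<circ> gen (Suc k)"
    have x2: "x2 \<in> Bn n" using x by (simp add: x2_def)
    have "contracted x2 k b"
    proof (rule contracted_transfer[OF c])
      show "x2 (lo k) < b" "b < x2 (hi k)" using less 1 by (simp_all add: x2_def v g)
      show "inv x b < lo k \<Longrightarrow> inv x2 b < lo k" "hi k < inv x b \<Longrightarrow> hi k < inv x2 b"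
        using p k unfolding x2_def inv_gen_app[OF x(1)] by (auto simp: gen_eq lo_def hi_def)
    qed
    then have Th: "(x2, x2 \<circ> gen k) \<in> Th"
      by (rule forcesD[OF IH x2 kn]) (use less in \<open>simp add: x2_def v g\<close>)
    have y2: "x2 \<circ> gen k \<in> Bn n" using x2 kn by simp
    have le: "wle n x2 x" using wle_descent[OF x(1,2)] less unfolding x2_def v by simp
    have "(x (int k), x (int k + 2)) \<in> Inv n (x2 \<circ> gen k)"
      using InvI[OF y2 pos(2,1)] less by (simp add: x2_def g)
    moreover have "(x (int k + 2), x (int k + 1)) \<in> Inv n x" using InvI[OF x(1) pos(3,2)] less by simp
    ultimately have "(x (lo k), x (hi k)) \<in> (Inv n x \<union> Inv n (x2 \<circ> gen k))\<^sup>+"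
      unfolding v by (meson UnCI r_into_trancl trancl_trans)
    then show ?thesis using force_join[OF x(1) kn x(3) x2 y2 Th le] by blast
  next
    case 2
    \<comment> \<open>Here \<open>y = c a q\<close>, \<open>y2 = c q a\<close> and
      \<open>x2 = q c a\<close>; the meet combines the non-inversions \<open>(a, q)\<close> of
      \<open>y\<close> and \<open>(q, c)\<close> of \<open>x2\<close>.\<close>
    define y where "y = x \<circ> gen k"
    define y2 where "y2 = y \<circ> gen (Suc k)"
    define x2 where "x2 = y2 \<circ> gen k"
    have B: "y \<in> Bn n" "y2 \<in> Bn n" "x2 \<in> Bn n" using x by (simp_all add: y_def y2_def x2_def)
    have "contracted x2 k b"
    proof (rule contracted_transfer[OF c])
      show "x2 (lo k) < b" "b < x2 (hi k)" using less 2 by (simp_all add: x2_def y2_def y_def v g)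
      have "inv x2 b = gen k (gen (Suc k) (gen k (inv x b)))"
        unfolding x2_def y2_def y_def using B by (simp add: inv_gen_app x y_def y2_def)
      then show "inv x b < lo k \<Longrightarrow> inv x2 b < lo k" "hi k < inv x b \<Longrightarrow> hi k < inv x2 b"
        using p k by (auto simp: gen_eq lo_def hi_def)
    qed
    then have "(x2, x2 \<circ> gen k) \<in> Th"
      by (rule forcesD[OF IH B(3) kn]) (use less in \<open>simp add: x2_def y2_def y_def v g\<close>)
    then have Th: "(x2, y2) \<in> Th" by (simp add: x2_def)
    have le: "wle n (x \<circ> gen k) y2"
      using wle_ascent[OF B(1) x(2)] less unfolding y2_def v by (simp add: y_def g)
    have "(x (int k), x (int k + 2)) \<in> Ninv n y"
      using NinvI[OF B(1) pos(2,3)] less by (simp add: y_def g)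
    moreover have "(x (int k + 2), x (int k + 1)) \<in> Ninv n x2"
      using NinvI[OF B(3) pos(1,2)] less by (simp add: x2_def y2_def y_def g)
    ultimately have "(x (lo k), x (hi k)) \<in> (Ninv n (x \<circ> gen k) \<union> Ninv n x2)\<^sup>+"
      unfolding v y_def by (meson UnCI r_into_trancl trancl_trans)
    then show ?thesis using force_meet[OF x(1) kn x(3) B(3,2) Th le] by blast
  qed
qed

text \<open>Stated with \<open>lo m\<close> to include \<open>m = 0\<close>, where the left neighbor
  of the pair \<open>(a, c)\<close> is the value \<open>- a\<close>.\<close>

lemma left_neighbor_below:
  assumes x: "x \<in> Bn n" "Suc m < n" "x (lo (Suc m)) < x (hi (Suc m))"
    and c: "contracted x (Suc m) b" and IH: "forces (x (hi (Suc m)) - x (lo (Suc m)))"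
    and q: "x (lo (Suc m)) < x (lo m)" "x (lo m) < b"
  shows "(x, x \<circ> gen (Suc m)) \<in> Th"
proof -
  have mn: "m < n" using x by simp
  have pos: "lo m \<in> signed_idx n" "int m + 1 \<in> signed_idx n" "int m + 2 \<in> signed_idx n"
    using x by (auto simp: signed_idx_iff lo_def)
  have v: "lo (Suc m) = int m + 1" "hi (Suc m) = int m + 2" "hi m = int m + 1"
    by (simp_all add: lo_def hi_def)
  have g: "gen m (lo m) = int m + 1" "gen m (int m + 1) = lo m" "gen m (int m + 2) = int m + 2"
    "gen (Suc m) (int m + 1) = int m + 2" "gen (Suc m) (int m + 2) = int m + 1"
    by (simp_all add: gen_eq lo_def hi_def)
  have lom: "lo m < int m + 1" by (simp add: lo_def)
  have p: "inv x b \<noteq> lo m" using q(2) by (simp add: inv_eq_conv[OF x(1)])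
  note less = x(3)[unfolded v] q[unfolded v] contractedD(1,2)[OF c, unfolded v]
  define x2 where "x2 = x \<circ> gen m"
  have x2: "x2 \<in> Bn n" using x by (simp add: x2_def)
  have "contracted x2 (Suc m) b"
  proof (rule contracted_transfer[OF c])
    show "x2 (lo (Suc m)) < b" "b < x2 (hi (Suc m))" using less by (simp_all add: x2_def v g)
    show "inv x b < lo (Suc m) \<Longrightarrow> inv x2 b < lo (Suc m)" "hi (Suc m) < inv x b \<Longrightarrow> hi (Suc m) < inv x2 b"
      using p unfolding x2_def inv_gen_app[OF x(1)] by (auto simp: gen_eq lo_def hi_def split: if_splits)
  qed
  then have Th: "(x2, x2 \<circ> gen (Suc m)) \<in> Th"
    by (rule forcesD[OF IH x2 x(2)]) (use less in \<open>simp add: x2_def v g\<close>)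
  have y2: "x2 \<circ> gen (Suc m) \<in> Bn n" using x2 x by simp
  have le: "wle n x2 x" using wle_descent[OF x(1) mn] less unfolding x2_def v by simp
  have "(x (int m + 1), x (lo m)) \<in> Inv n x" using InvI[OF x(1) pos(2,1) lom] less by simp
  moreover have "(x (lo m), x (int m + 2)) \<in> Inv n (x2 \<circ> gen (Suc m))"
    using InvI[OF y2 pos(3,2)] less by (simp add: x2_def g)
  ultimately have "(x (lo (Suc m)), x (hi (Suc m))) \<in> (Inv n x \<union> Inv n (x2 \<circ> gen (Suc m)))\<^sup>+"
    unfolding v by (meson UnCI r_into_trancl trancl_trans)
  then show ?thesis using force_join[OF x x2 y2 Th le] by blast
qed

text \<open>The left neighbor is read off after the swap, since for \<open>m = 0\<close> the swap changes it too.\<close>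

lemma left_neighbor_above:
  assumes x: "x \<in> Bn n" "Suc m < n" "x (lo (Suc m)) < x (hi (Suc m))"
    and c: "contracted x (Suc m) b" and IH: "forces (x (hi (Suc m)) - x (lo (Suc m)))"
    and q: "q = (x \<circ> gen (Suc m)) (lo m)" "q < x (hi (Suc m))" "b < q"
  shows "(x, x \<circ> gen (Suc m)) \<in> Th"
proof -
  have mn: "m < n" using x by simp
  have pos: "lo m \<in> signed_idx n" "int m + 1 \<in> signed_idx n" "int m + 2 \<in> signed_idx n"
    using x by (auto simp: signed_idx_iff lo_def)
  have v: "lo (Suc m) = int m + 1" "hi (Suc m) = int m + 2" "hi m = int m + 1"
    by (simp_all add: lo_def hi_def)
  have g: "gen m (lo m) = int m + 1" "gen m (int m + 1) = lo m" "gen m (int m + 2) = int m + 2"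
    "gen (Suc m) (int m + 1) = int m + 2" "gen (Suc m) (int m + 2) = int m + 1"
    by (simp_all add: gen_eq lo_def hi_def)
  have lom: "lo m < int m + 1" by (simp add: lo_def)
  have p: "gen (Suc m) (inv x b) \<noteq> lo m"
  proof
    assume "gen (Suc m) (inv x b) = lo m"
    then have "inv x b = gen (Suc m) (lo m)" by (metis gen_gen)
    then show False using q by (simp add: inv_eq_conv[OF x(1)])
  qed
  note less = x(3)[unfolded v] q(2,3)[unfolded v] contractedD(1,2)[OF c, unfolded v]
  define y where "y = x \<circ> gen (Suc m)"
  define y2 where "y2 = y \<circ> gen m"
  define x2 where "x2 = y2 \<circ> gen (Suc m)"
  have B: "y \<in> Bn n" "y2 \<in> Bn n" "x2 \<in> Bn n" using x by (simp_all add: y_def y2_def x2_def)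
  have yv: "y (lo m) = q" "y (int m + 1) = x (int m + 2)" "y (int m + 2) = x (int m + 1)"
    by (simp_all add: y_def q g)
  have "contracted x2 (Suc m) b"
  proof (rule contracted_transfer[OF c])
    show "x2 (lo (Suc m)) < b" "b < x2 (hi (Suc m))" using less by (simp_all add: x2_def y2_def v g yv)
    have i: "inv x2 b = gen (Suc m) (gen m (gen (Suc m) (inv x b)))"
      unfolding x2_def y2_def y_def using B by (simp add: inv_gen_app x y_def y2_def)
    show "inv x b < lo (Suc m) \<Longrightarrow> inv x2 b < lo (Suc m)" "hi (Suc m) < inv x b \<Longrightarrow> hi (Suc m) < inv x2 b"
      using p unfolding i by (auto simp: gen_eq lo_def hi_def split: if_splits)
  qed
  then have "(x2, x2 \<circ> gen (Suc m)) \<in> Th"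
    by (rule forcesD[OF IH B(3) x(2)]) (use less in \<open>simp add: x2_def y2_def v g yv\<close>)
  then have Th: "(x2, y2) \<in> Th" by (simp add: x2_def)
  have le: "wle n (x \<circ> gen (Suc m)) y2"
    using wle_ascent[OF B(1) mn] less yv unfolding y2_def v y_def[symmetric] by simp
  have "(q, x (int m + 2)) \<in> Ninv n y"
    using NinvI[OF B(1) pos(1,2) lom] less by (simp add: yv)
  moreover have "(x (int m + 1), q) \<in> Ninv n x2"
    using NinvI[OF B(3) pos(2,3)] less by (simp add: x2_def y2_def g yv)
  ultimately have "(x (lo (Suc m)), x (hi (Suc m))) \<in> (Ninv n (x \<circ> gen (Suc m)) \<union> Ninv n x2)\<^sup>+"
    unfolding v y_def by (meson UnCI r_into_trancl trancl_trans)
  then show ?thesis using force_meet[OF x B(3,2) Th le] by blast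
qed

lemma left_neighbor:
  assumes x: "x \<in> Bn n" "Suc m < n" "x (lo (Suc m)) < x (hi (Suc m))" and m: "0 < m"
    and c: "contracted x (Suc m) b" and IH: "forces (x (hi (Suc m)) - x (lo (Suc m)))"
    and q: "x (lo (Suc m)) < x (int m)" "x (int m) < x (hi (Suc m))" "x (int m) \<noteq> b"
  shows "(x, x \<circ> gen (Suc m)) \<in> Th"
proof (cases "x (int m) < b")
  case True
  then show ?thesis using left_neighbor_below[OF x c IH] q m by (simp add: lo_pos)
next
  case False
  have "(x \<circ> gen (Suc m)) (lo m) = x (int m)" using m by (simp add: gen_eq lo_def hi_def)
  then show ?thesis using left_neighbor_above[OF x c IH] q False by simp
qed

lemma contracted_center_minus:
  assumes x: "x \<in> Bn n" and c: "contracted x 0 b"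
  shows "contracted x 0 (- b)"
proof -
  have "x (lo 0) = - x (hi 0)" using Bn_odd[OF x, of 1] by (simp add: lo_def hi_def)
  then show ?thesis using c up_minus[of b] x
    by (auto simp: contracted_def inv_odd lo_def hi_def)
qed

text \<open>The central pair is \<open>(- C, C)\<close>, and both \<open>b\<close> and
  \<open>- b\<close> are witnesses. If \<open>\<bar>b\<bar> < \<bar>q\<bar>\<close>, the shorter
  contraction is the central pair of \<open>q\<close> and \<open>- q\<close>; otherwise it is the
  pair of \<open>\<bar>q\<bar>\<close> and \<open>C\<close> or its mirror image. In both situations
  the sign of \<open>q\<close> decides between a join and a meet.\<close>

lemma center_neighbor:
  assumes x: "x \<in> Bn n" "1 < n" "x (lo 0) < x (hi 0)"
    and c: "contracted x 0 b" and IH: "forces (x (hi 0) - x (lo 0))"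
    and q: "\<bar>x 2\<bar> < x 1" "\<bar>x 2\<bar> \<noteq> \<bar>b\<bar>"
  shows "(x, x \<circ> gen 0) \<in> Th"
proof -
  let ?g = "gen (Suc 0)"
  have n0: "0 < n" "Suc 0 < n" using x by simp_all
  have v: "lo 0 = -1" "hi 0 = 1" "lo (Suc 0) = 1" "hi (Suc 0) = 2" by (simp_all add: lo_def hi_def)
  have g: "gen 0 1 = -1" "gen 0 (-1) = 1" "gen 0 2 = 2" "gen 0 (-2) = -2"
    "?g 1 = 2" "?g 2 = 1" "?g (-1) = -2" "?g (-2) = -1"
    by (simp_all add: gen_eq lo_def hi_def)
  have far: "gen 0 p = p" "?g p = p" if "p \<notin> {1, -1, 2, -2}" for p
    using that by (auto simp: gen_eq lo_def hi_def)
  define C q B where "C = x 1" and "q = x 2" and "B = \<bar>b\<bar>"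
  have xv: "x 1 = C" "x 2 = q" "x (-1) = - C" "x (-2) = - q"
    using Bn_odd[OF x(1), of 1] Bn_odd[OF x(1), of 2] by (simp_all add: C_def q_def)
  have pos: "-1 \<in> signed_idx n" "1 \<in> signed_idx n" "2 \<in> signed_idx n" "-2 \<in> signed_idx n"
    using x by (auto simp: signed_idx_iff)
  have "q \<noteq> 0" using x(1) pos(3) by (metis Bn_in q_def signed_idx_iff)
  have qC: "\<bar>q\<bar> < C" "\<bar>q\<bar> \<noteq> B" using q by (simp_all add: C_def q_def B_def)
  have cB: "contracted x 0 B" "contracted x 0 (- B)"
    using c contracted_center_minus[OF x(1) c] by (cases "b < 0"; simp add: B_def)+
  have BC: "B < C" "0 < B" using contractedD[OF cB(1)] by (auto simp: v xv B_def signed_idx_iff)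
  have farB: "inv x B \<notin> {1, -1, 2, -2}" "inv x (- B) \<notin> {1, -1, 2, -2}"
    using qC BC by (auto simp: inv_eq_conv[OF x(1)] xv)
  have cpos: "inv x b' < -1 \<Longrightarrow> inv x b' < -2" "1 < inv x b' \<Longrightarrow> 2 < inv x b'" if "b' \<in> {B, - B}" for b'
    using farB that by auto
  have IH': "forces (2 * C)" using IH by (simp add: v xv)
  define y where "y = x \<circ> gen 0"
  have y: "y \<in> Bn n" using x by (simp add: y_def)
  have yv: "y 1 = - C" "y 2 = q" "y (-1) = C" "y (-2) = - q" by (simp_all add: y_def g xv)
  have goal: ?thesis if "x2 \<in> Bn n" "y2 \<in> Bn n" "(x2, y2) \<in> Th" "wle n x2 x" "(- C, C) \<in> (Inv n x \<union> Inv n y2)\<^sup>+" for x2 y2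
    using force_join[OF x(1) n0(1) x(3) that(1-4)] that(5) by (simp add: v xv)
  have goal': ?thesis if "x2 \<in> Bn n" "y2 \<in> Bn n" "(x2, y2) \<in> Th" "wle n y y2" "(- C, C) \<in> (Ninv n y \<union> Ninv n x2)\<^sup>+" for x2 y2
    using force_meet[OF x(1) n0(1) x(3) that(1-3)] that(4,5) by (simp add: v xv y_def)
  consider "q < 0" "- q < B" | "q < 0" "B < - q" | "0 < q" "B < q" | "0 < q" "q < B"
    using \<open>q \<noteq> 0\<close> qC by linarith
  then show ?thesis
  proof cases
    case 1
    define w x2 where "w = x \<circ> ?g" and "x2 = w \<circ> gen 0"
    have BB: "w \<in> Bn n" "x2 \<in> Bn n" "x2 \<circ> ?g \<in> Bn n" using x n0 by (simp_all add: w_def x2_def)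
    have "wle n w x" using wle_descent[OF x(1) n0(2)] qC by (simp add: v xv w_def)
    moreover have "wle n x2 w"
      using wle_descent[OF BB(1) n0(1)] 1 by (simp add: v xv g w_def x2_def)
    ultimately have le: "wle n x2 x" using wle_trans by blast
    have "contracted x2 (Suc 0) B"
    proof (rule contracted_transfer[OF cB(1)])
      show "x2 (lo (Suc 0)) < B" "B < x2 (hi (Suc 0))" using 1 BC by (simp_all add: v x2_def w_def g xv)
      show "inv x B < lo 0 \<Longrightarrow> inv x2 B < lo (Suc 0)" "hi 0 < inv x B \<Longrightarrow> hi (Suc 0) < inv x2 B"
        using cpos[of B] by (simp_all add: x2_def w_def inv_gen_app[OF BB(1)[unfolded w_def]] inv_gen_app[OF x(1)] far[OF farB(1)] v)
    qed
    then have Th: "(x2, x2 \<circ> ?g) \<in> Th"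
      by (rule forcesD[OF IH' BB(2) n0(2)]) (use 1 qC in \<open>simp add: v x2_def w_def g xv\<close>)
    have "(- C, q) \<in> Inv n (x2 \<circ> ?g)"
      using InvI[OF BB(3) pos(1,4)] qC by (simp add: x2_def w_def g xv)
    moreover have "(q, C) \<in> Inv n x" using InvI[OF x(1) pos(3,2)] qC by (simp add: xv)
    ultimately have "(- C, C) \<in> (Inv n x \<union> Inv n (x2 \<circ> ?g))\<^sup>+" by (meson UnCI r_into_trancl trancl_trans)
    then show ?thesis using goal[OF BB(2,3) Th le] by blast
  next
    case 2
    define w x2 where "w = y \<circ> ?g" and "x2 = w \<circ> gen 0"
    have BB: "w \<in> Bn n" "x2 \<in> Bn n" using y n0 by (simp_all add: w_def x2_def)
    have le: "wle n y w" using wle_ascent[OF y n0(2)] qC by (simp add: v yv w_def)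
    have "contracted x2 0 B"
    proof (rule contracted_transfer[OF cB(1)])
      show "x2 (lo 0) < B" "B < x2 (hi 0)" using 2 BC by (simp_all add: v x2_def w_def g yv)
      have "inv x2 B = inv x B"
      proof -
        have "inv x2 B = gen 0 (inv w B)" by (simp add: x2_def inv_gen_app[OF BB(1)])
        moreover have "inv w B = ?g (inv y B)" by (simp add: w_def inv_gen_app[OF y])
        moreover have "inv y B = gen 0 (inv x B)" by (simp add: y_def inv_gen_app[OF x(1)])
        ultimately show ?thesis using far[OF farB(1)] by simp
      qed
      then show "inv x B < lo 0 \<Longrightarrow> inv x2 B < lo 0" "hi 0 < inv x B \<Longrightarrow> hi 0 < inv x2 B"
        by simp_all
    qed
    then have "(x2, x2 \<circ> gen 0) \<in> Th"
      by (rule forcesD[OF IH' BB(2) n0(1)]) (use 2 qC in \<open>simp add: v x2_def w_def g yv\<close>)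
    then have Th: "(x2, w) \<in> Th" by (simp add: x2_def)
    have "(- C, q) \<in> Ninv n y" using NinvI[OF y pos(2,3)] qC by (simp add: yv)
    moreover have "(q, - q) \<in> Ninv n x2" using NinvI[OF BB(2) pos(1,2)] 2 by (simp add: x2_def w_def g yv)
    moreover have "(- q, C) \<in> Ninv n y" using NinvI[OF y pos(4,1)] qC by (simp add: yv)
    ultimately have "(- C, C) \<in> (Ninv n y \<union> Ninv n x2)\<^sup>+" by (meson UnCI r_into_trancl trancl_trans)
    then show ?thesis using goal'[OF BB(2,1) Th le] by blast
  next
    case 3
    define x2 where "x2 = x \<circ> ?g"
    have BB: "x2 \<in> Bn n" "x2 \<circ> gen 0 \<in> Bn n" using x n0 by (simp_all add: x2_def)
    have le: "wle n x2 x" using wle_descent[OF x(1) n0(2)] qC by (simp add: v xv x2_def)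
    have "contracted x2 0 B"
    proof (rule contracted_transfer[OF cB(1)])
      show "x2 (lo 0) < B" "B < x2 (hi 0)" using 3 BC by (simp_all add: v x2_def g xv)
      show "inv x B < lo 0 \<Longrightarrow> inv x2 B < lo 0" "hi 0 < inv x B \<Longrightarrow> hi 0 < inv x2 B"
        by (simp_all add: x2_def inv_gen_app[OF x(1)] far[OF farB(1)] v)
    qed
    then have Th: "(x2, x2 \<circ> gen 0) \<in> Th"
      by (rule forcesD[OF IH' BB(1) n0(1)]) (use 3 qC in \<open>simp add: v x2_def g xv\<close>)
    have "(- C, - q) \<in> Inv n x" using InvI[OF x(1) pos(1,4)] qC by (simp add: xv)
    moreover have "(- q, q) \<in> Inv n (x2 \<circ> gen 0)" using InvI[OF BB(2) pos(2,1)] 3 by (simp add: x2_def g xv)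
    moreover have "(q, C) \<in> Inv n x" using InvI[OF x(1) pos(3,2)] qC by (simp add: xv)
    ultimately have "(- C, C) \<in> (Inv n x \<union> Inv n (x2 \<circ> gen 0))\<^sup>+" by (meson UnCI r_into_trancl trancl_trans)
    then show ?thesis using goal[OF BB Th le] by blast
  next
    case 4
    define w y2 x2 where "w = y \<circ> ?g" and "y2 = w \<circ> gen 0" and "x2 = y2 \<circ> ?g"
    have BB: "w \<in> Bn n" "y2 \<in> Bn n" "x2 \<in> Bn n" using y n0 by (simp_all add: w_def y2_def x2_def)
    have "wle n y w" using wle_ascent[OF y n0(2)] qC by (simp add: v yv w_def)
    moreover have "wle n w y2" using wle_ascent[OF BB(1) n0(1)] 4 by (simp add: v yv g w_def y2_def)
    ultimately have le: "wle n y y2" using wle_trans by blast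
    have "contracted x2 (Suc 0) (- B)"
    proof (rule contracted_transfer[OF cB(2)])
      show "x2 (lo (Suc 0)) < - B" "- B < x2 (hi (Suc 0))" using 4 BC by (simp_all add: v x2_def y2_def w_def g yv)
      have "inv x2 (- B) = inv x (- B)"
      proof -
        have "inv x2 (- B) = ?g (inv y2 (- B))" by (simp add: x2_def inv_gen_app[OF BB(2)])
        moreover have "inv y2 (- B) = gen 0 (inv w (- B))" by (simp add: y2_def inv_gen_app[OF BB(1)])
        moreover have "inv w (- B) = ?g (inv y (- B))" by (simp add: w_def inv_gen_app[OF y])
        moreover have "inv y (- B) = gen 0 (inv x (- B))" by (simp add: y_def inv_gen_app[OF x(1)])
        ultimately show ?thesis using far[OF farB(2)] by simp
      qed
      then show "inv x (- B) < lo 0 \<Longrightarrow> inv x2 (- B) < lo (Suc 0)" "hi 0 < inv x (- B) \<Longrightarrow> hi (Suc 0) < inv x2 (- B)"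
        using cpos[of "- B"] by (simp_all add: v)
    qed
    then have "(x2, x2 \<circ> ?g) \<in> Th"
      by (rule forcesD[OF IH' BB(3) n0(2)]) (use 4 qC in \<open>simp add: v x2_def y2_def w_def g yv\<close>)
    then have Th: "(x2, y2) \<in> Th" by (simp add: x2_def)
    have "(- C, q) \<in> Ninv n y" using NinvI[OF y pos(2,3)] qC by (simp add: yv)
    moreover have "(q, C) \<in> Ninv n x2" using NinvI[OF BB(3) pos(4,1)] qC by (simp add: x2_def y2_def w_def g yv)
    ultimately have "(- C, C) \<in> (Ninv n y \<union> Ninv n x2)\<^sup>+" by (meson UnCI r_into_trancl trancl_trans)
    then show ?thesis using goal'[OF BB(3,2) Th le] by blast
  qed
qed

end

section \<open>Congruences containing the generating collapses\<close>

locale cambrian_cong = weak_order_cong n up Th for n up Th +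
  assumes gens: "cong_gens n (\<lambda>b. up (int b)) \<subseteq> Th"
begin

lemma Inv_gen: "k < n \<Longrightarrow> Inv n (gen k) = {(lo k, hi k), (- hi k, - lo k)}"
  using Inv_step(1)[of id n k] by simp

lemma force_gen:
  assumes x: "x \<in> Bn n" "k < n" "x (lo k) < x (hi k)" and B: "u \<in> Bn n" "u' \<in> Bn n"
    and Th: "(u, u') \<in> Th" and sub: "Inv n u \<subseteq> Inv n x" and new: "(x (lo k), x (hi k)) \<in> Inv n u'"
  shows "(x, x \<circ> gen k) \<in> Th"
  using force_join[OF x B Th] sub new x(1) B by (simp add: wle_iff r_into_trancl)

lemma gens_pair:
  assumes "1 \<le> b" "b < n"
  shows "up (int b) \<Longrightarrow> 2 \<le> b \<Longrightarrow> (gen (b - 1), gen (b - 1) \<circ> gen b) \<in> Th"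
    and "\<not> up (int b) \<Longrightarrow> 2 \<le> b \<Longrightarrow> (gen b, gen b \<circ> gen (b - 1)) \<in> Th"
    and "up 1 \<Longrightarrow> b = 1 \<Longrightarrow> (gen 0, gen 0 \<circ> gen 1 \<circ> gen 0) \<in> Th"
    and "\<not> up 1 \<Longrightarrow> b = 1 \<Longrightarrow> (gen 1, gen 1 \<circ> gen 0 \<circ> gen 1) \<in> Th"
proof -
  have "(let s = if up (int b) then gen b else gen (b - 1); t = if up (int b) then gen (b - 1) else gen b;
      m = if b = 1 then 4 else 3 in (t, alt t s (m - 1))) \<in> cong_gens n (\<lambda>b. up (int b))"
    unfolding cong_gens_def using assms by (intro CollectI exI[of _ b] conjI) auto
  then have "(let s = if up (int b) then gen b else gen (b - 1); t = if up (int b) then gen (b - 1) else gen b;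
      m = if b = 1 then 4 else 3 in (t, alt t s (m - 1))) \<in> Th" using gens by blast
  then show "up (int b) \<Longrightarrow> 2 \<le> b \<Longrightarrow> (gen (b - 1), gen (b - 1) \<circ> gen b) \<in> Th"
    and "\<not> up (int b) \<Longrightarrow> 2 \<le> b \<Longrightarrow> (gen b, gen b \<circ> gen (b - 1)) \<in> Th"
    and "up 1 \<Longrightarrow> b = 1 \<Longrightarrow> (gen 0, gen 0 \<circ> gen 1 \<circ> gen 0) \<in> Th"
    and "\<not> up 1 \<Longrightarrow> b = 1 \<Longrightarrow> (gen 1, gen 1 \<circ> gen 0 \<circ> gen 1) \<in> Th"
    by (simp_all add: Let_def numeral_eq_Suc o_assoc)
qed

text \<open>With \<open>m = \<bar>b\<bar>\<close>, the lower element of the generating collapse has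
  as inversions only \<open>b\<close> with one of \<open>b - 1\<close>, \<open>b + 1\<close>, and
  the mirror image; these \<open>x\<close> has by contraction. The upper element adds the swapped
  pair.\<close>

lemma force_far_generator:
  assumes x: "x \<in> Bn n" "k < n" and c: "contracted x k b" and k: "0 < k"
    and ac: "x (lo k) = b - 1" "x (hi k) = b + 1" and b: "2 \<le> \<bar>b\<bar>"
  shows "(x, x \<circ> gen k) \<in> Th"
proof -
  have asc: "x (lo k) < x (hi k)" using ac by simp
  have inI: "b - 1 \<in> signed_idx n" "b + 1 \<in> signed_idx n" "b \<in> signed_idx n"
    using x(1) lo_in[OF x(2)] hi_in[OF x(2)] contractedD(3)[OF c] unfolding ac[symmetric] by simp_all
  define m where "m = nat \<bar>b\<bar>"
  have m: "2 \<le> m" "m < n" "int m = \<bar>b\<bar>"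
    using b inI by (auto simp: m_def signed_idx_iff)
  obtain j where j: "m = Suc j" using m(1) by (cases m) auto
  have jn: "0 < j" "j < n" using m j by simp_all
  have v: "lo m = int m" "hi m = int m + 1" "lo j = int m - 1" "hi j = int m"
    using jn j by (auto simp: lo_def hi_def)
  have gv: "gen j (int m) = int m - 1" "gen j (int m + 1) = int m + 1"
    "gen m (int m) = int m + 1" "gen m (int m - 1) = int m - 1"
    using jn(1) by (auto simp: gen_eq lo_def hi_def j)
  have inv_ac: "inv x (b - 1) = lo k" "inv x (b + 1) = hi k"
    using x(1) by (simp_all flip: ac)
  have upb: "up b \<longleftrightarrow> (if 0 < b then up (int m) else \<not> up (int m))"
    using up_minus[OF inI(3)] m(3) b by (auto split: if_splits)
  have left: "(b - 1, b) \<in> Inv n x" if "up b" using c that inI inv_ac by (simp add: contracted_def Inv_iff)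
  have right: "(b, b + 1) \<in> Inv n x" if "\<not> up b" using c that inI inv_ac by (simp add: contracted_def Inv_iff)
  have inv2: "(- b, - b + 1) \<in> Inv n x" if "up b"
    using Inv_sym[OF x(1), of b "b - 1"] left[OF that] by (simp add: add.commute)
  have inv3: "(- b - 1, - b) \<in> Inv n x" if "\<not> up b"
  proof -
    have "- b - 1 = - (b + 1)" by simp
    then show ?thesis using Inv_sym[OF x(1), of "b + 1" b] right[OF that] by (simp only:)
  qed
  have bm: "b = int m \<or> b = - int m" using m(3) by linarith
  show ?thesis
  proof (cases "up (int m)")
    case True
    have t: "gen j \<in> Bn n" "gen j \<circ> gen m \<in> Bn n" using m by (simp_all add: jn)
    have Th: "(gen j, gen j \<circ> gen m) \<in> Th" using gens_pair(1)[of m] True m by (simp add: j)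
    have "gen j (lo m) < gen j (hi m)" by (simp add: v gv)
    from Inv_step(1)[OF t(1) m(2) this]
    have I: "Inv n (gen j \<circ> gen m) = Inv n (gen j) \<union> {(int m - 1, int m + 1), (- int m - 1, - int m + 1)}"
      by (simp add: v gv)
    have "Inv n (gen j) \<subseteq> Inv n x"
      using Inv_gen[OF jn(2)] left right inv2 inv3 upb True bm b by (auto simp: v add.commute[of 1 "int m"])
    moreover have "(x (lo k), x (hi k)) \<in> Inv n (gen j \<circ> gen m)" using I bm ac by auto
    ultimately show ?thesis using force_gen[OF x asc t Th] by blast
  next
    case False
    have t: "gen m \<in> Bn n" "gen m \<circ> gen j \<in> Bn n" using m by (simp_all add: jn)
    have Th: "(gen m, gen m \<circ> gen j) \<in> Th" using gens_pair(2)[of m] False m by (simp add: j)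
    have "gen m (lo j) < gen m (hi j)" by (simp add: v gv)
    from Inv_step(1)[OF t(1) jn(2) this]
    have I: "Inv n (gen m \<circ> gen j) = Inv n (gen m) \<union> {(int m - 1, int m + 1), (- int m - 1, - int m + 1)}"
      by (simp add: v gv)
    have "Inv n (gen m) \<subseteq> Inv n x"
      using Inv_gen[OF m(2)] left right inv2 inv3 upb False bm b by (auto simp: v add.commute[of 1 "int m"])
    moreover have "(x (lo k), x (hi k)) \<in> Inv n (gen m \<circ> gen j)" using I bm ac by auto
    ultimately show ?thesis using force_gen[OF x asc t Th] by blast
  qed
qed

text \<open>The generating collapse for \<open>b = 1\<close> spans two covers, and by convexity each
  collapses. One of them adds the central pair \<open>(-2, 2)\<close>, the other the pairs
  \<open>(-1, 2)\<close> and \<open>(-2, 1)\<close>; the side of \<open>1\<close> decides which of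
  the latter two can be contracted.\<close>

lemma force_central_generator:
  assumes x: "x \<in> Bn n" "k < n" and n: "1 < n" and c: "contracted x k b"
    and cases: "k = 0 \<and> x 1 = 2 \<and> \<bar>b\<bar> = 1 \<or> k = 1 \<and> x 1 = - 1 \<and> x 2 = 2 \<and> b = 1 \<or>
      k = 1 \<and> x 1 = - 2 \<and> x 2 = 1 \<and> b = - 1"
  shows "(x, x \<circ> gen k) \<in> Th"
proof -
  let ?g = "gen (Suc 0)"
  have asc: "x (lo k) < x (hi k)" using contractedD[OF c] by simp
  have v: "lo 0 = -1" "hi 0 = 1" "lo (Suc 0) = 1" "hi (Suc 0) = 2" by (simp_all add: lo_def hi_def)
  have g: "gen 0 1 = -1" "gen 0 (-1) = 1" "gen 0 2 = 2" "gen 0 (-2) = -2"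
    "?g 1 = 2" "?g 2 = 1" "?g (-1) = -2" "?g (-2) = -1"
    by (simp_all add: gen_eq lo_def hi_def)
  have n0: "0 < n" "Suc 0 < n" using n by simp_all
  have inI: "1 \<in> signed_idx n" "2 \<in> signed_idx n" "- 1 \<in> signed_idx n" "- 2 \<in> signed_idx n"
    using n by (auto simp: signed_idx_iff)
  have up1: "up (- 1) \<longleftrightarrow> \<not> up 1" using up_minus[OF inI(1)] .
  have B: "gen 0 \<in> Bn n" "?g \<in> Bn n" "gen 0 \<circ> ?g \<in> Bn n" "?g \<circ> gen 0 \<in> Bn n"
    "gen 0 \<circ> ?g \<circ> gen 0 \<in> Bn n" "?g \<circ> gen 0 \<circ> ?g \<in> Bn n" using n0 by simp_all
  have I0: "Inv n (gen 0) = {(-1, 1)}" using Inv_gen[OF n0(1)] by (simp add: v)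
  have I1: "Inv n ?g = {(1, 2), (-2, -1)}" using Inv_gen[OF n0(2)] by (simp add: v)
  have I01: "Inv n (gen 0 \<circ> ?g) = {(-1, 1), (-1, 2), (-2, 1)}"
    using Inv_step(1)[OF B(1) n0(2)] by (auto simp: v g I0)
  have I010: "Inv n (gen 0 \<circ> ?g \<circ> gen 0) = {(-1, 1), (-1, 2), (-2, 1), (-2, 2)}"
    using Inv_step(1)[OF B(3) n0(1)] by (auto simp: v g I01)
  have I10: "Inv n (?g \<circ> gen 0) = {(1, 2), (-2, -1), (-2, 2)}"
    using Inv_step(1)[OF B(2) n0(1)] by (auto simp: v g I1)
  have I101: "Inv n (?g \<circ> gen 0 \<circ> ?g) = {(1, 2), (-2, -1), (-2, 2), (-2, 1), (-1, 2)}"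
    using Inv_step(1)[OF B(4) n0(2)] by (auto simp: v g I10)
  have sub: "Inv n x \<supseteq> K" if "\<And>a c. (a, c) \<in> K \<Longrightarrow> (a, c) \<in> Inv n x \<or> (- c, - a) \<in> Inv n x" for K
    using that Inv_sym[OF x(1)] by auto
  have b1: "b = 1 \<or> b = - 1" if "\<bar>b\<bar> = 1" using that by linarith
  note iv = inv_odd[OF x(1), of 1] inv_odd[OF x(1), of 2] Bn_odd[OF x(1), of 1]
  show ?thesis
  proof (cases "up 1")
    case True
    have long: "(gen 0, gen 0 \<circ> ?g \<circ> gen 0) \<in> Th" using gens_pair(3)[of 1] True n by simp
    have "wle n (gen 0) (gen 0 \<circ> ?g)" "wle n (gen 0 \<circ> ?g) (gen 0 \<circ> ?g \<circ> gen 0)"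
      using B by (auto simp: wle_iff I0 I01 I010)
    then have Th1: "(gen 0, gen 0 \<circ> ?g) \<in> Th" using Th_between[OF B(1,3,5)] long by blast
    then have Th2: "(gen 0 \<circ> ?g, gen 0 \<circ> ?g \<circ> gen 0) \<in> Th" using long Th_sym Th_trans by blast
    from cases show ?thesis
    proof (elim disjE conjE)
      assume a: "k = 0" "x 1 = 2" "\<bar>b\<bar> = 1"
      have i2: "inv x 2 = 1" "inv x (- 2) = - 1" using a(2) iv x(1) by (simp_all add: inv_eq_conv)
      have i1: "inv x 1 < - 1" "1 < inv x (- 1)"
        using c a(1) True up1 iv b1[OF a(3)] by (auto simp: contracted_def v)
      have "Inv n (gen 0 \<circ> ?g) \<subseteq> Inv n x" unfolding I01 using i1 i2 inI by (auto simp: Inv_iff)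
      moreover have "(x (lo k), x (hi k)) \<in> Inv n (gen 0 \<circ> ?g \<circ> gen 0)"
        using a Bn_odd[OF x(1), of 1] by (simp add: v I010)
      ultimately show ?thesis using force_gen[OF x asc B(3,5) Th2] by blast
    next
      assume a: "k = 1" "x 1 = - 1" "x 2 = 2" "b = 1"
      have "inv x (- 1) = 1" "inv x 1 = - 1" using a(2) iv x(1) by (simp_all add: inv_eq_conv)
      then have "Inv n (gen 0) \<subseteq> Inv n x" unfolding I0 using inI by (auto simp: Inv_iff)
      moreover have "(x (lo k), x (hi k)) \<in> Inv n (gen 0 \<circ> ?g)" using a by (simp add: v I01)
      ultimately show ?thesis using force_gen[OF x asc B(1,3) Th1] by blast
    next
      assume a: "k = 1" "x 1 = - 2" "x 2 = 1" "b = - 1"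
      have "inv x 1 = 2" using a(3) x(1) by (simp add: inv_eq_conv)
      then have "inv x (- 1) = - 2" using iv by simp
      then show ?thesis using c a True up1 by (simp add: contracted_def v)
    qed
  next
    case False
    have long: "(?g, ?g \<circ> gen 0 \<circ> ?g) \<in> Th" using gens_pair(4)[of 1] False n by simp
    have "wle n ?g (?g \<circ> gen 0)" "wle n (?g \<circ> gen 0) (?g \<circ> gen 0 \<circ> ?g)"
      using B by (auto simp: wle_iff I1 I10 I101)
    then have Th1: "(?g, ?g \<circ> gen 0) \<in> Th" using Th_between[OF B(2,4,6)] long by blast
    then have Th2: "(?g \<circ> gen 0, ?g \<circ> gen 0 \<circ> ?g) \<in> Th" using long Th_sym Th_trans by blast
    from cases show ?thesis
    proof (elim disjE conjE)
      assume a: "k = 0" "x 1 = 2" "\<bar>b\<bar> = 1"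
      have i2: "inv x 2 = 1" "inv x (- 2) = - 1" using a(2) iv x(1) by (simp_all add: inv_eq_conv)
      have i1: "1 < inv x 1" "inv x (- 1) < - 1"
        using c a(1) False up1 iv b1[OF a(3)] by (auto simp: contracted_def v)
      have "Inv n ?g \<subseteq> Inv n x" unfolding I1 using i1 i2 inI by (auto simp: Inv_iff)
      moreover have "(x (lo k), x (hi k)) \<in> Inv n (?g \<circ> gen 0)"
        using a Bn_odd[OF x(1), of 1] by (simp add: v I10)
      ultimately show ?thesis using force_gen[OF x asc B(2,4) Th1] by blast
    next
      assume a: "k = 1" "x 1 = - 1" "x 2 = 2" "b = 1"
      have "inv x (- 1) = 1" using a(2) x(1) by (simp add: inv_eq_conv)
      then have "inv x 1 = - 1" using iv by simp
      then show ?thesis using c a False by (simp add: contracted_def v)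
    next
      assume a: "k = 1" "x 1 = - 2" "x 2 = 1" "b = - 1"
      have "inv x 1 = 2" "inv x (- 2) = 1" using a(2,3) x(1) by (simp_all add: inv_eq_conv)
      then have "inv x (- 1) = - 2" "inv x 2 = - 1" using iv by simp_all
      with \<open>inv x 1 = 2\<close> \<open>inv x (- 2) = 1\<close> have "Inv n (?g \<circ> gen 0) \<subseteq> Inv n x"
        unfolding I10 using inI by (auto simp: Inv_iff)
      moreover have "(x (lo k), x (hi k)) \<in> Inv n (?g \<circ> gen 0 \<circ> ?g)" using a by (simp add: v I101)
      ultimately show ?thesis using force_gen[OF x asc B(4,6) Th2] by blast
    qed
  qed
qed

text \<open>Swaps away from the pair carry the entry from position \<open>j\<close> down to position
  \<open>3\<close>, where it is a right neighbor.\<close>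

lemma right_inside:
  assumes "3 \<le> j" "j \<le> n" "x \<in> Bn n" "contracted x (Suc 0) b" "forces (x 2 - x 1)"
    "x 1 < x (int j)" "x (int j) < x 2" "x (int j) \<noteq> b"
  shows "(x, x \<circ> gen (Suc 0)) \<in> Th"
  using assms
proof (induction j arbitrary: x rule: nat_induct_at_least)
  case base
  have v: "lo (Suc 0) = 1" "hi (Suc 0) = 2" by (simp_all add: lo_def hi_def)
  have "x (lo (Suc 0)) < x (hi (Suc 0))" using contractedD[OF \<open>contracted x (Suc 0) b\<close>] by simp
  then have "(x, x \<circ> gen (Suc 0)) \<in> Th"
    using base by (intro right_neighbor[of x "Suc 0" b]) (simp_all add: v)
  then show ?case .
next
  case (Suc j)
  have v: "lo (Suc 0) = 1" "hi (Suc 0) = 2" by (simp_all add: lo_def hi_def)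
  define y where "y = x \<circ> gen j"
  have yv: "y 1 = x 1" "y 2 = x 2" "y (int j) = x (int (Suc j))"
    using Suc.hyps by (simp_all add: y_def gen_eq lo_def hi_def add.commute)
  have y: "y \<in> Bn n" "contracted y (Suc 0) b" using Suc.prems Suc.hyps contracted_far[of x "Suc 0" j b] by (simp_all add: y_def)
  have "(y, y \<circ> gen (Suc 0)) \<in> Th"
    using Suc.prems y by (intro Suc.IH) (simp_all only: yv, simp_all)
  moreover have "x (lo (Suc 0)) < x (hi (Suc 0))"
    using contractedD[OF \<open>contracted x (Suc 0) b\<close>] by simp
  ultimately show ?case
    unfolding y_def using Suc.prems Suc.hyps by (intro move_far[of x "Suc 0" j]) simp_all
qed

text \<open>Once at position \<open>3\<close>, the entry can pass the pair, because its value is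
  outside, and reach position \<open>1\<close>. There \<open>gen 0\<close> changes its sign and
  makes it a left neighbor with a value inside.\<close>

lemma right_outside:
  assumes "3 \<le> j" "j \<le> n" "x \<in> Bn n" "contracted x (Suc 0) b" "forces (x 2 - x 1)"
    "\<not> (x 1 < x (int j) \<and> x (int j) < x 2)" "x 1 < - x (int j)" "- x (int j) < x 2" "- x (int j) \<noteq> b"
  shows "(x, x \<circ> gen (Suc 0)) \<in> Th"
  using assms
proof (induction j arbitrary: x rule: nat_induct_at_least)
  case base
  have v: "lo (Suc 0) = 1" "hi (Suc 0) = 2" "lo (Suc (Suc 0)) = 2" "hi (Suc (Suc 0)) = 3" by (simp_all add: lo_def hi_def)
  have n: "0 < n" "1 < n" "Suc (Suc 0) < n" using base by simp_all
  note x = \<open>x \<in> Bn n\<close>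
  have nb: "x 3 \<noteq> b" using base contractedD[of x 1 b] by (auto simp: v)
  define y where "y = x \<circ> gen (Suc (Suc 0)) \<circ> gen (Suc 0)"
  define z where "z = y \<circ> gen 0"
  have B: "y \<in> Bn n" "z \<in> Bn n" using x n by (simp_all add: y_def z_def)
  have yv: "y 1 = x 3" "y 2 = x 1" "y 3 = x 2" by (simp_all add: y_def gen_eq lo_def hi_def)
  have "z 1 = y (- 1)" "z 2 = y 2" "z 3 = y 3" by (simp_all add: z_def gen_eq lo_def hi_def)
  then have zv: "z 1 = - x 3" "z 2 = x 1" "z 3 = x 2" using Bn_odd[OF B(1), of 1] yv by simp_all
  have cy: "contracted y (Suc (Suc 0)) b"
    using contracted_shift_right[of x "Suc 0" b] x base n nb by (simp add: y_def)
  then have cz: "contracted z (Suc (Suc 0)) b" using contracted_far[of y "Suc (Suc 0)" 0 b] B by (simp add: z_def)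
  have asc: "x 1 < x 2" using contractedD[OF \<open>contracted x (Suc 0) b\<close>] by (simp add: v)
  have "(z, z \<circ> gen (Suc (Suc 0))) \<in> Th"
    using left_neighbor[of z "Suc 0" b] B n cz base asc by (simp add: v zv)
  then have "(y, y \<circ> gen (Suc (Suc 0))) \<in> Th"
    using move_far[of y "Suc (Suc 0)" 0] B n asc by (simp add: z_def v yv)
  moreover have "x 3 < x 1 \<or> x 2 < x 3"
  proof -
    have "x 3 \<noteq> x 1" "x 3 \<noteq> x 2" using x by simp_all
    moreover have "\<not> (x 1 < x 3 \<and> x 3 < x 2)" using base by simp
    ultimately show ?thesis by linarith
  qed
  ultimately have "(x, x \<circ> gen (Suc 0)) \<in> Th"
    unfolding y_def using x n asc by (intro shift_right[of x "Suc 0"]) (simp_all add: v)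
  then show ?case .
next
  case (Suc j)
  have v: "lo (Suc 0) = 1" "hi (Suc 0) = 2" by (simp_all add: lo_def hi_def)
  define y where "y = x \<circ> gen j"
  have yv: "y 1 = x 1" "y 2 = x 2" "y (int j) = x (int (Suc j))"
    using Suc.hyps by (simp_all add: y_def gen_eq lo_def hi_def add.commute)
  have y: "y \<in> Bn n" "contracted y (Suc 0) b" using Suc.prems Suc.hyps contracted_far[of x "Suc 0" j b] by (simp_all add: y_def)
  have asc: "x 1 < x 2" using contractedD[OF \<open>contracted x (Suc 0) b\<close>] by (simp add: v)
  have "(y, y \<circ> gen (Suc 0)) \<in> Th"
    using Suc.prems y by (intro Suc.IH) (simp_all only: yv, simp_all)
  then show ?case
    unfolding y_def using Suc.prems Suc.hyps asc by (intro move_far[of x "Suc 0" j]) (simp_all add: v)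
qed

text \<open>If no shorter contraction gives the collapse, the values strictly between
  \<open>a\<close> and \<open>d\<close> are among \<open>b\<close>, \<open>- a\<close> and
  \<open>- d\<close>: any other one stands away from the pair and is handled by
  \<open>right_inside\<close> or \<open>right_outside\<close>. The few remaining configurations come
  from the generators.\<close>

lemma force_first:
  assumes x: "x \<in> Bn n" "1 < n" and c: "contracted x (Suc 0) b" and IH: "forces (x 2 - x 1)"
  shows "(x, x \<circ> gen (Suc 0)) \<in> Th"
proof -
  have v: "lo (Suc 0) = 1" "hi (Suc 0) = 2" "lo 0 = - 1" by (simp_all add: lo_def hi_def)
  have n: "Suc 0 < n" using x by simp
  define a d where "a = x 1" and "d = x 2"
  have asc: "x (lo (Suc 0)) < x (hi (Suc 0))" using contractedD[OF c] by simp
  have b: "a < b" "b < d" "b \<in> signed_idx n" using contractedD[OF c] by (simp_all add: v a_def d_def)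
  have "1 \<in> signed_idx n" "2 \<in> signed_idx n" using x(2) by (simp_all add: signed_idx_iff)
  then have adI: "a \<in> signed_idx n" "d \<in> signed_idx n" using x(1) by (simp_all add: a_def d_def)
  have iad: "inv x a = 1" "inv x d = 2" "inv x (- a) = - 1" "inv x (- d) = - 2"
    using x(1) by (simp_all add: a_def d_def inv_odd)
  have IH': "forces (x (hi (Suc 0)) - x (lo (Suc 0)))" using IH by (simp add: v)
  show ?thesis
  proof (rule ccontr)
    assume no: "(x, x \<circ> gen (Suc 0)) \<notin> Th"
    have inside: "x (int j) = b'" if "3 \<le> j" "j \<le> n" "a < x (int j)" "x (int j) < d" "contracted x (Suc 0) b'" for j b'
      using right_inside[OF that(1,2) x(1) that(5) IH] that(3,4) no by (auto simp: a_def d_def)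
    have outside: "- x (int j) = b" if "3 \<le> j" "j \<le> n" "a < - x (int j)" "- x (int j) < d"
        "\<not> (a < x (int j) \<and> x (int j) < d)" for j
      using right_outside[OF that(1,2) x(1) c IH] that(3-5) no by (auto simp: a_def d_def)
    \<comment> \<open>Otherwise \<open>b\<close> and \<open>- b\<close> stand away from the pair. If
      \<open>b\<close> is to the right, \<open>- b\<close> is a witness too, and
      \<open>inside\<close> with this witness identifies the entry \<open>b\<close> with
      \<open>- b\<close>; if \<open>b\<close> is to the left, \<open>inside\<close> applies to the
      entry \<open>- b\<close>.\<close>
    have opposite: "b = - a \<or> b = - d" if mb: "a < - b" "- b < d"
    proof (rule ccontr)
      assume nb: "\<not> (b = - a \<or> b = - d)"
      define p where "p = inv x b"
      have p: "x p = b" "p \<in> signed_idx n" using x(1) b by (simp_all add: p_def)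
      have "p \<noteq> 1" "p \<noteq> 2" "p \<noteq> - 1" "p \<noteq> - 2"
        using p(1) b nb Bn_odd[OF x(1), of 1] Bn_odd[OF x(1), of 2] by (auto simp: a_def d_def)
      then consider "3 \<le> p" "p \<le> int n" | "3 \<le> - p" "- p \<le> int n"
        using p(2) unfolding signed_idx_iff by linarith
      then show False
      proof cases
        case 1
        then have "\<not> up b" using c by (auto simp: contracted_def v p_def)
        then have "contracted x (Suc 0) (- b)"
          using 1 up_minus[OF b(3)] mb b x(1) by (auto simp: contracted_def v a_def d_def inv_odd p_def)
        then have "x (int (nat p)) = - b" using 1 p(1) b by (intro inside) auto
        then show False using 1 p(1) b(3) by (auto simp: signed_idx_iff)
      next
        case 2
        have "x (- p) = - b" using p(1) Bn_odd[OF x(1)] by simp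
        then have "x (int (nat (- p))) = b" using 2 mb c by (intro inside) auto
        then show False using 2 \<open>x (- p) = - b\<close> b(3) by (auto simp: signed_idx_iff)
      qed
    qed
    have between: "q = b \<or> q = - a \<or> q = - d" if q: "q \<in> signed_idx n" "a < q" "q < d" for q
    proof (rule ccontr)
      assume nq: "\<not> (q = b \<or> q = - a \<or> q = - d)"
      define p where "p = inv x q"
      have p: "x p = q" "p \<in> signed_idx n" using x(1) q by (simp_all add: p_def)
      have "p \<noteq> 1" "p \<noteq> 2" "p \<noteq> - 1" "p \<noteq> - 2"
        using p(1) q nq Bn_odd[OF x(1), of 1] Bn_odd[OF x(1), of 2] by (auto simp: a_def d_def)
      then consider "3 \<le> p" "p \<le> int n" | "3 \<le> - p" "- p \<le> int n"
        using p(2) unfolding signed_idx_iff by linarith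
      then show False
      proof cases
        case 1
        then have "x (int (nat p)) = b" using p(1) q c by (intro inside) auto
        then show False using 1 p(1) nq by auto
      next
        case 2
        have mp: "x (- p) = - q" using p(1) Bn_odd[OF x(1)] by simp
        show False
        proof (cases "a < - q \<and> - q < d")
          case True
          then have "x (int (nat (- p))) = b" using 2 mp c by (intro inside) auto
          then have "- q = b" using 2 mp by simp
          then have "b = - a \<or> b = - d" using q by (intro opposite) auto
          then show False using \<open>- q = b\<close> q b by auto
        next
          case False
          then have "- x (int (nat (- p))) = b" using 2 mp q by (intro outside) auto
          then show False using 2 mp nq by auto
        qed
      qed
    qed
    have central: False if "a = - 1 \<and> d = 2 \<and> b = 1 \<or> a = - 2 \<and> d = 1 \<and> b = - 1"
      using force_central_generator[OF x(1) n x(2) c] that no by (auto simp: a_def d_def)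
    \<comment> \<open>At \<open>k = 1\<close> the left neighbor comes from the pair itself:
      \<open>- d\<close> after the swap, \<open>- a\<close> before it.\<close>
    have lower: False if "a < - d" "b < - d" "- d < d"
    proof -
      have "(x \<circ> gen (Suc 0)) (lo 0) = - d"
        using Bn_odd[OF x(1), of 2] by (simp add: gen_eq lo_def hi_def d_def)
      then show False using left_neighbor_above[OF x(1) n asc c IH', of "- d"] that no by (simp add: v d_def)
    qed
    have upper: False if "a < - a" "- a < b" "- a < d"
    proof -
      have "x (lo 0) = - a" using Bn_odd[OF x(1), of 1] by (simp add: v a_def)
      then show False using left_neighbor_below[OF x(1) n asc c IH'] that no by (simp add: v a_def)
    qed
    have bounds: "\<bar>a\<bar> \<le> int n" "\<bar>d\<bar> \<le> int n" "a \<noteq> 0" "d \<noteq> 0" "b \<noteq> 0"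
      using adI b(3) by (auto simp: signed_idx_iff)
    have btw: "q = b \<or> q = - a \<or> q = - d" if "a < q" "q < d" "q \<noteq> 0" for q
      using between[of q] that bounds by (auto simp: signed_idx_iff)
    consider "b = - a" | "b = - d" "b \<noteq> - a" | "b \<noteq> - a" "b \<noteq> - d" by blast
    then show False
    proof cases
      case 1
      have "b = 1" using btw[of 1] 1 b bounds by auto
      moreover have "d = 2" using btw[of 2] 1 b bounds \<open>b = 1\<close> by (cases "2 < d") auto
      ultimately show False using central 1 by auto
    next
      case 2
      have "b = - 1" using btw[of "- 1"] 2 b bounds by auto
      moreover have "a = - 2" using btw[of "- 2"] 2 b bounds \<open>b = - 1\<close> by (cases "a < - 2") auto
      ultimately show False using central 2 by auto
    next
      case 3
      have nopp: "\<not> (a < - b \<and> - b < d)" using opposite 3 by blast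
      have nd: "\<not> (a < - d \<and> - d < d)" using lower nopp 3 b by fastforce
      have na: "\<not> (a < - a \<and> - a < d)" using upper nopp 3 b by fastforce
      have only: "q = b" if "a < q" "q < d" "q \<noteq> 0" for q
        using btw[OF that] that nd na by auto
      have "\<bar>b\<bar> \<noteq> 1"
      proof
        assume "\<bar>b\<bar> = 1"
        then consider "b = 1" | "b = - 1" by linarith
        then show False
        proof cases
          case 1
          then have "a < - 1" using b bounds 3 by auto
          then show False using only[of "- 1"] 1 b by auto
        next
          case 2
          then have "1 < d" using b bounds 3 by auto
          then show False using only[of 1] 2 b by auto
        qed
      qed
      then have b2: "2 \<le> \<bar>b\<bar>" using bounds by linarith
      have "a = b - 1" using only[of "b - 1"] b b2 by fastforce
      moreover have "d = b + 1" using only[of "b + 1"] b b2 by fastforce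
      ultimately show False
        using force_far_generator[OF x(1) n c _ _ _ b2] no by (simp add: v a_def d_def)
    qed
  qed
qed

text \<open>The pair is shifted left until \<open>k = 1\<close>, unless a left neighbor between the
  two values already gives a shorter contraction.\<close>

lemma force_positive:
  assumes "x \<in> Bn n" "Suc m < n" "contracted x (Suc m) b" "forces (x (hi (Suc m)) - x (lo (Suc m)))"
  shows "(x, x \<circ> gen (Suc m)) \<in> Th"
  using assms
proof (induction m arbitrary: x)
  case 0
  then have "forces (x 2 - x 1)" by (simp add: lo_def hi_def)
  then show ?case using 0 by (intro force_first[of x b]) simp_all
next
  case (Suc m)
  define a d where "a = x (lo (Suc (Suc m)))" and "d = x (hi (Suc (Suc m)))"
  have x: "x \<in> Bn n" and asc: "a < d" using Suc.prems contractedD[OF Suc.prems(3)] by (auto simp: a_def d_def)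
  have mn: "Suc m < n" "m < n" using Suc.prems by simp_all
  have v: "lo (Suc (Suc m)) = int m + 2" "hi (Suc (Suc m)) = int m + 3" "lo (Suc m) = int m + 1" "hi (Suc m) = int m + 2"
    by (simp_all add: lo_def hi_def)
  have main: "(y, y \<circ> gen (Suc (Suc m))) \<in> Th"
    if y: "y \<in> Bn n" "contracted y (Suc (Suc m)) b" "y (lo (Suc (Suc m))) = a" "y (hi (Suc (Suc m))) = d"
      and nb: "y (int m + 1) \<noteq> b" for y
  proof -
    have IHy: "forces (y (hi (Suc (Suc m))) - y (lo (Suc (Suc m))))"
      using Suc.prems(4) y by (simp add: a_def d_def)
    have ascy: "y (lo (Suc (Suc m))) < y (hi (Suc (Suc m)))" using y asc by simp
    have sm: "int (Suc m) = int m + 1" by simp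
    show ?thesis
    proof (cases "a < y (int m + 1) \<and> y (int m + 1) < d")
      case True
      then show ?thesis
        using left_neighbor[OF y(1) Suc.prems(2) ascy _ y(2) IHy] nb y(3,4) unfolding sm by blast
    next
      case False
      have "y (int m + 1) \<noteq> y (int m + 2)" "y (int m + 1) \<noteq> y (int m + 3)" using y(1) by simp_all
      then have "y (int m + 1) \<noteq> a" "y (int m + 1) \<noteq> d" using y(3,4) by (simp_all only: v, auto)
      then have out: "y (int m + 1) < a \<or> d < y (int m + 1)" using False by linarith
      define y' where "y' = y \<circ> gen (Suc m) \<circ> gen (Suc (Suc m))"
      have y': "y' \<in> Bn n" using y mn Suc.prems by (simp add: y'_def)
      have "gen (Suc m) (gen (Suc (Suc m)) (int m + 1)) = int m + 2"
        "gen (Suc m) (gen (Suc (Suc m)) (int m + 2)) = int m + 3"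
        by (simp_all add: gen_eq lo_def hi_def)
      then have y'v: "y' (lo (Suc m)) = a" "y' (hi (Suc m)) = d"
        using y(3,4) by (simp_all add: y'_def v)
      have "contracted y' (Suc m) b"
        unfolding y'_def using y mn nb sm by (intro contracted_shift_left) (simp_all add: add.commute)
      moreover have "forces (y' (hi (Suc m)) - y' (lo (Suc m)))"
        using Suc.prems(4) by (simp add: y'v a_def d_def)
      ultimately have "(y', y' \<circ> gen (Suc m)) \<in> Th" using Suc.IH[OF y' mn(1)] by blast
      then show ?thesis
        unfolding y'_def using shift_left[OF y(1) Suc.prems(2) ascy] out y(3,4) unfolding sm by simp
    qed
  qed
  show ?case
  proof (cases "x (int m + 1) = b")
    case False
    then show ?thesis using x Suc.prems by (intro main[of x]) (simp_all add: a_def d_def)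
  next
    case True
    \<comment> \<open>The witness must not pass the pair; a swap further left, which does not touch
      the pair, first puts another entry next to it.\<close>
    define y where "y = x \<circ> gen m"
    have y: "y \<in> Bn n" using x mn by (simp add: y_def)
    have "gen m (int m + 1) = lo m" by (simp add: gen_eq hi_def)
    then have "y (int m + 1) = x (lo m)" by (simp add: y_def)
    moreover have "lo m \<noteq> int m + 1" by (simp add: lo_def)
    then have "x (lo m) \<noteq> x (int m + 1)" using x by simp
    ultimately have nb: "y (int m + 1) \<noteq> b" using True by simp
    have far: "Suc (Suc m) + 2 \<le> m \<or> m + 2 \<le> Suc (Suc m)" by simp
    have "(y, y \<circ> gen (Suc (Suc m))) \<in> Th"
      using y nb contracted_far[OF x far Suc.prems(3)] gen_far(1,2)[OF far]
      by (intro main) (simp_all add: y_def a_def d_def)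
    then show ?thesis
      unfolding y_def using asc by (intro move_far[OF x Suc.prems(2) _ mn(2) far]) (simp_all add: a_def d_def)
  qed
qed

lemma force_zero_neighbor:
  assumes "2 \<le> j" "j \<le> n" "x \<in> Bn n" "contracted x 0 b" "forces (x (hi 0) - x (lo 0))"
    "\<bar>x (int j)\<bar> < x 1" "\<bar>x (int j)\<bar> \<noteq> \<bar>b\<bar>"
  shows "(x, x \<circ> gen 0) \<in> Th"
  using assms
proof (induction j arbitrary: x rule: nat_induct_at_least)
  case base
  have "x (lo 0) < x (hi 0)" using contractedD[OF \<open>contracted x 0 b\<close>] by simp
  then show ?case using base by (intro center_neighbor[of x b]) simp_all
next
  case (Suc j)
  have far: "0 + 2 \<le> j \<or> j + 2 \<le> 0" using Suc.hyps by simp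
  have v: "lo 0 = - 1" "hi 0 = 1" by (simp_all add: lo_def hi_def)
  define y where "y = x \<circ> gen j"
  have "gen j 1 = 1" "gen j (- 1) = - 1" "gen j (int j) = int (Suc j)"
    using Suc.hyps by (simp_all add: gen_eq lo_def hi_def)
  then have yv: "y 1 = x 1" "y (- 1) = x (- 1)" "y (int j) = x (int (Suc j))" by (simp_all only: y_def comp_apply)
  have jn: "j < n" "j \<le> n" using Suc.prems by simp_all
  have y: "y \<in> Bn n" using Suc.prems(2) jn by (simp add: y_def)
  have cy: "contracted y 0 b" unfolding y_def by (rule contracted_far[OF Suc.prems(2) far Suc.prems(3)])
  have "(y, y \<circ> gen 0) \<in> Th"
    using Suc.prems(4-6) by (intro Suc.IH[OF jn(2) y cy]) (simp_all only: yv v not_False_eq_True)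
  moreover have "x (lo 0) < x (hi 0)" using contractedD[OF Suc.prems(3)] by simp
  ultimately show ?case
    unfolding y_def using jn by (intro move_far[OF Suc.prems(2) _ _ jn(1) far]) simp_all
qed

text \<open>By \<open>force_zero_neighbor\<close>, failure would leave \<open>\<bar>b\<bar>\<close>
  as the only positive value below \<open>x 1\<close>; the pair is then \<open>(-2, 2)\<close>,
  which a generator collapses.\<close>

lemma force_zero:
  assumes x: "x \<in> Bn n" "0 < n" and c: "contracted x 0 b" and IH: "forces (x (hi 0) - x (lo 0))"
  shows "(x, x \<circ> gen 0) \<in> Th"
proof (rule ccontr)
  assume no: "(x, x \<circ> gen 0) \<notin> Th"
  have v: "lo 0 = - 1" "hi 0 = 1" by (simp_all add: lo_def hi_def)
  have b: "\<bar>b\<bar> < x 1" "b \<noteq> 0"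
    using contractedD[OF c] Bn_odd[OF x(1), of 1] by (auto simp: v signed_idx_iff)
  have "1 \<in> signed_idx n" using x(2) by (simp add: signed_idx_iff)
  then have "x 1 \<in> signed_idx n" using x(1) by simp
  then have x1: "x 1 \<le> int n" unfolding signed_idx_iff by linarith
  have all: "m = \<bar>b\<bar>" if m: "0 < m" "m < x 1" for m
  proof -
    define p where "p = inv x m"
    have "m \<in> signed_idx n" using m x1 by (auto simp: signed_idx_iff)
    then have p: "x p = m" "p \<in> signed_idx n" using x(1) by (simp_all add: p_def)
    have "p \<noteq> 1" "p \<noteq> - 1" using p(1) m Bn_odd[OF x(1), of 1] by auto
    then have j: "2 \<le> nat \<bar>p\<bar>" "nat \<bar>p\<bar> \<le> n" using p(2) unfolding signed_idx_iff by linarith+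
    have "\<bar>x (int (nat \<bar>p\<bar>))\<bar> = m" using p(1) m Bn_odd[OF x(1), of p] by (cases "0 \<le> p") auto
    then show ?thesis using force_zero_neighbor[OF j x(1) c IH] no m by auto
  qed
  have "x 1 = 2" "\<bar>b\<bar> = 1" using all[of 1] all[of 2] b by linarith+
  then show False using force_central_generator[OF x(1,2) _ c] no x1 by auto
qed

lemma forces_step:
  assumes "x \<in> Bn n" "k < n" "contracted x k b" "forces (x (hi k) - x (lo k))"
  shows "(x, x \<circ> gen k) \<in> Th"
  using assms force_zero[of x b] force_positive[of x "k - 1" b] by (cases k) auto

lemma forces_all: "forces (int N)"
proof (induction N)
  case 0
  then show ?case by (auto simp: forces_def)
next
  case (Suc N)
  show ?case
    unfolding forces_def
  proof (intro allI impI)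
    fix x k b assume x: "x \<in> Bn n" "k < n" "x (lo k) < x (hi k)" "contracted x k b" "x (hi k) - x (lo k) < int (Suc N)"
    have "forces (x (hi k) - x (lo k))"
      using Suc x(5) unfolding forces_def by fastforce
    then show "(x, x \<circ> gen k) \<in> Th" using forces_step x by blast
  qed
qed

lemma contracted_Th:
  assumes "x \<in> Bn n" "k < n" "contracted x k b"
  shows "(x, x \<circ> gen k) \<in> Th"
proof -
  have "0 < x (hi k) - x (lo k)" using contractedD[OF assms(3)] by simp
  then have "forces (x (hi k) - x (lo k))" using forces_all[of "nat (x (hi k) - x (lo k))"] by simp
  then show ?thesis using forces_step assms by blast
qed

end

section \<open>The Cambrian congruence\<close>

context cambrian_cong
begin

text \<open>On a chain of ascents from \<open>x\<close> to \<open>y\<close> the edges stay constant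
  by convexity, so each ascent has a witness and collapses in \<open>Th\<close>.\<close>

lemma edge_cong_le:
  assumes "x \<in> Bn n" "y \<in> Bn n" "wle n x y" "edges x = edges y"
  shows "(x, y) \<in> Th"
  using assms
proof (induction "card (Inv n y - Inv n x)" arbitrary: x rule: less_induct)
  case less
  show ?case
  proof (cases "Inv n x = Inv n y")
    case True
    then have "x = y" using Inv_inject less.prems by blast
    then show ?thesis using Th_refl less.prems by simp
  next
    case False
    then have "Inv n x \<subset> Inv n y" using less.prems by (auto simp: wle_iff)
    from biclosed_step[OF less.prems(1) biclosed_Inv[OF less.prems(2)] this]
    obtain k where k: "k < n" "x (lo k) < x (hi k)" "Inv n (x \<circ> gen k) \<subseteq> Inv n y" by blast
    define x' where "x' = x \<circ> gen k"
    have x': "x' \<in> Bn n" "wle n x x'" "wle n x' y"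
      using less.prems k wle_ascent[of x n k] by (auto simp: x'_def wle_iff)
    have "edges x \<subseteq> edges x'"
      using bn_edges_convex[OF less.prems(1) x'(1) less.prems(2) x'(2,3)] less.prems(4) by auto
    then have eq: "edges x = edges x'"
      unfolding bn_edges_def by (rule path_edges_subset_eq[OF inj_inv[OF less.prems(1)]])
    then obtain b where "contracted x k b"
      using not_contracted_edges[OF less.prems(1) k(1,2)] unfolding x'_def by blast
    then have 1: "(x, x') \<in> Th" using contracted_Th less.prems(1) k(1) unfolding x'_def by blast
    have "Inv n y - Inv n x' \<subset> Inv n y - Inv n x"
      using Inv_step[OF less.prems(1) k(1,2)] k(3) unfolding x'_def by blast
    then have "card (Inv n y - Inv n x') < card (Inv n y - Inv n x)" by (intro psubset_card_mono) auto
    then have "(x', y) \<in> Th" using less.hyps[of x'] x' less.prems eq by auto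
    then show ?thesis using 1 Th_trans by blast
  qed
qed

lemma edge_cong_subset: "edge_cong n up \<subseteq> Th"
proof (rule subrelI)
  fix x y assume xy: "(x, y) \<in> edge_cong n up"
  then have B: "x \<in> Bn n" "y \<in> Bn n" and eq: "edges x = edges y" by (auto simp: edge_cong_def)
  define m where "m = wmeet n x y"
  have m: "m \<in> Bn n" "wle n m x" "wle n m y"
    using wmeet_Ninv[OF B] wmeet_lower[OF B] by (auto simp: m_def)
  have "edges x \<subseteq> edges m" using bn_edges_wmeet[OF B] eq by (auto simp: m_def)
  then have "edges x = edges m" unfolding bn_edges_def by (rule path_edges_subset_eq[OF inj_inv[OF B(1)]])
  then have "(m, x) \<in> Th" "(m, y) \<in> Th" using edge_cong_le m B eq by auto
  then show "(x, y) \<in> Th" using Th_sym Th_trans by blast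
qed

end

context signed_orientation
begin

text \<open>For \<open>b \<ge> 2\<close> the generating pair is one ascent with witness
  \<open>b\<close>; for \<open>b = 1\<close> it consists of two ascents with witnesses
  \<open>1\<close> or \<open>- 1\<close>.\<close>

lemma cong_gens_edge_cong: "cong_gens n (\<lambda>b. up (int b)) \<subseteq> edge_cong n up"
proof
  fix p assume "p \<in> cong_gens n (\<lambda>b. up (int b))"
  then obtain b where b: "1 \<le> b" "b < n" and p: "p = (let s = if up (int b) then gen b else gen (b - 1);
      t = if up (int b) then gen (b - 1) else gen b; m = if b = 1 then 4 else 3 in (t, alt t s (m - 1)))"
    unfolding cong_gens_def by auto
  have step: "edges x = edges (x \<circ> gen k)" if "x \<in> Bn n" "k < n" "contracted x k c" for x k c
    using contracted_edges[OF that(1,2) _ that(3)] that(3) by (auto simp: contracted_def)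
  let ?g = "gen (Suc 0)"
  show "p \<in> edge_cong n up"
  proof (cases "b = 1")
    case False
    then obtain j where j: "b = Suc j" "0 < j" using b by (cases b) auto
    have n: "j < n" "b < n" using b j by simp_all
    have bI: "int b \<in> signed_idx n" using b by (simp add: signed_idx_iff)
    have v: "lo b = int b" "hi b = int b + 1" "lo j = int b - 1" "hi j = int b"
      using j by (simp_all add: lo_def hi_def)
    have g: "gen j (int b) = int b - 1" "gen j (int b + 1) = int b + 1"
      "gen b (int b) = int b + 1" "gen b (int b - 1) = int b - 1"
      using j(2) by (auto simp: gen_eq lo_def hi_def j(1))
    show ?thesis
    proof (cases "up (int b)")
      case True
      have "contracted (gen j) b (int b)" using True bI by (simp add: contracted_def v g)
      then have "edges (gen j) = edges (gen j \<circ> gen b)" using step n by simp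
      then show ?thesis using True j n by (simp add: p edge_cong_def numeral_eq_Suc Let_def)
    next
      case up: False
      have "contracted (gen b) j (int b)" using up bI by (simp add: contracted_def v g)
      then have "edges (gen b) = edges (gen b \<circ> gen j)" using step n by simp
      then show ?thesis using up j n by (simp add: p edge_cong_def numeral_eq_Suc Let_def)
    qed
  next
    case True
    have n: "0 < n" "Suc 0 < n" using b True by simp_all
    have inI: "1 \<in> signed_idx n" "- 1 \<in> signed_idx n" using n by (auto simp: signed_idx_iff)
    have v: "lo 0 = -1" "hi 0 = 1" "lo (Suc 0) = 1" "hi (Suc 0) = 2" by (simp_all add: lo_def hi_def)
    have g: "gen 0 1 = -1" "gen 0 (-1) = 1" "gen 0 2 = 2" "gen 0 (-2) = -2"
      "?g 1 = 2" "?g 2 = 1" "?g (-1) = -2" "?g (-2) = -1"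
      by (simp_all add: gen_eq lo_def hi_def)
    have B: "gen 0 \<in> Bn n" "?g \<in> Bn n" "gen 0 \<circ> ?g \<in> Bn n" "?g \<circ> gen 0 \<in> Bn n"
      "gen 0 \<circ> ?g \<circ> gen 0 \<in> Bn n" "?g \<circ> gen 0 \<circ> ?g \<in> Bn n" using n by simp_all
    show ?thesis
    proof (cases "up 1")
      case up: True
      have "contracted (gen 0) (Suc 0) 1" using up inI by (simp add: contracted_def v g)
      moreover have "contracted (gen 0 \<circ> ?g) 0 1"
        using up inI by (simp add: contracted_def v g inv_comp_gen[OF B(1)])
      ultimately have "edges (gen 0) = edges (gen 0 \<circ> ?g \<circ> gen 0)" using step B n by metis
      then have "(gen 0, gen 0 \<circ> ?g \<circ> gen 0) \<in> edge_cong n up" using B by (simp add: edge_cong_def)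
      then show ?thesis using up True by (simp add: p numeral_eq_Suc Let_def o_assoc)
    next
      case up: False
      have up': "up (- 1)" using up_minus[OF inI(1)] up by simp
      have "contracted ?g 0 1" using up inI by (simp add: contracted_def v g)
      moreover have "contracted (?g \<circ> gen 0) (Suc 0) (- 1)"
        using up' inI by (simp add: contracted_def v g inv_comp_gen[OF B(2)])
      ultimately have "edges ?g = edges (?g \<circ> gen 0 \<circ> ?g)" using step B n by metis
      then have "(?g, ?g \<circ> gen 0 \<circ> ?g) \<in> edge_cong n up" using B by (simp add: edge_cong_def)
      then show ?thesis using up True by (simp add: p numeral_eq_Suc Let_def o_assoc)
    qed
  qed
qed

lemma camb_cong_eq:
  assumes "\<And>b. 1 \<le> b \<Longrightarrow> b \<le> n - 1 \<Longrightarrow> ori b = up (int b)"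
  shows "camb_cong n ori = edge_cong n up"
proof -
  have gens: "cong_gens n ori = cong_gens n (\<lambda>b. up (int b))"
    unfolding cong_gens_def using assms by (intro Collect_cong ex_cong1) auto
  have "edge_cong n up \<subseteq> Th" if "lattice_cong n Th" "cong_gens n ori \<subseteq> Th" for Th
  proof -
    interpret cambrian_cong n up Th
      using that by unfold_locales (auto simp: gens)
    show ?thesis by (rule edge_cong_subset)
  qed
  then show ?thesis
    unfolding camb_cong_def using lattice_cong_edge_cong[of n up] cong_gens_edge_cong gens by blast
qed

section \<open>The order on the classes\<close>

definition forced_set :: "(int \<Rightarrow> int) \<Rightarrow> (int \<times> int) set" where
  "forced_set x = forced n up (inv x)"

lemma forced_set_mono:
  assumes "x \<in> Bn n" "y \<in> Bn n" "wle n x y"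
  shows "forced_set x \<subseteq> forced_set y"
proof (rule subrelI)
  fix a c assume ac: "(a, c) \<in> forced_set x"
  have "inv y q < inv y p" if "p \<in> signed_idx n" "q \<in> signed_idx n" "p < q" "inv x q < inv x p" for p q
    using that assms by (auto simp: wle_iff Inv_def)
  then show "(a, c) \<in> forced_set y" using ac unfolding forced_set_def forced_def by blast
qed

lemma forced_set_wmeet:
  "x \<in> Bn n \<Longrightarrow> y \<in> Bn n \<Longrightarrow> forced_set (wmeet n x y) = forced_set x \<inter> forced_set y"
  unfolding forced_set_def by (rule forced_wmeet)

lemma edges_eq_iff: "x \<in> Bn n \<Longrightarrow> y \<in> Bn n \<Longrightarrow> edges x = edges y \<longleftrightarrow> forced_set x = forced_set y"
  unfolding forced_set_def by (rule bn_edges_eq_iff(1))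

text \<open>Meets provide comparable representatives with the same forced sets, to which
  \<open>bn_edges_convex\<close> applies.\<close>

lemma edges_between:
  assumes B: "x \<in> Bn n" "w \<in> Bn n" "y \<in> Bn n"
    and sub: "forced_set x \<subseteq> forced_set w" "forced_set w \<subseteq> forced_set y"
  shows "edges x \<inter> edges y \<subseteq> edges w"
proof -
  define w' where "w' = wmeet n w y"
  define x' where "x' = wmeet n x w'"
  have w': "w' \<in> Bn n" using wmeet_Ninv B by (simp add: w'_def)
  have x': "x' \<in> Bn n" using wmeet_Ninv B w' by (simp add: x'_def)
  have "forced_set w' = forced_set w" using B sub by (auto simp: w'_def forced_set_wmeet)
  moreover from this have "forced_set x' = forced_set x" using B w' sub by (auto simp: x'_def forced_set_wmeet)
  ultimately have eq: "edges w' = edges w" "edges x' = edges x" using edges_eq_iff B w' x' by auto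
  have le: "wle n x' w'" "wle n w' y"
    using wmeet_lower[OF B(1) w'] wmeet_lower[OF B(2,3)] by (auto simp: x'_def w'_def)
  show ?thesis using bn_edges_convex[OF x' w' B(3) le, where up = up] unfolding eq by (intro subrelI) blast
qed

end

section \<open>The isomorphism\<close>

context signed_polygon
begin

lemma is_diagonal_neg_diag:
  assumes "is_diagonal n v d"
  shows "is_diagonal n v (neg_diag d)"
proof -
  obtain i j where d: "d = {i, j}" "i \<in> poly_verts n" "j \<in> poly_verts n" "i \<noteq> j" "\<not> adjacent n v i j"
    using assms by (auto simp: is_diagonal_def)
  have "adjacent n v i j" if "adjacent n v (- i) (- j)"
  proof -
    have eq: "cross (v (- i)) (v (- j)) (v (- k)) = cross (v i) (v j) (v k)" if "k \<in> poly_verts n" for k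
      using d that by (simp add: v_minus cross_def algebra_simps)
    have mem: "- k \<in> poly_verts n - {- i, - j}" if "k \<in> poly_verts n - {i, j}" for k
      using that by (auto simp: poly_verts_iff)
    show ?thesis using that mem eq unfolding adjacent_def by (metis DiffD1)
  qed
  then have "\<not> adjacent n v (- i) (- j)" using d by blast
  moreover have "- i \<in> poly_verts n" "- j \<in> poly_verts n" using d by (auto simp: poly_verts_iff)
  ultimately show ?thesis unfolding is_diagonal_def using d by (metis neg_diag_pair neg_equal_iff_equal)
qed

lemma tri_cs:
  assumes x: "x \<in> Bn n"
  shows "tri (inv x) \<in> cs_triangulations n v"
proof -
  have sub: "neg_diag d \<in> tri (inv x)" if d: "d \<in> tri (inv x)" for d
  proof -
    obtain u w where uw: "d = {u, w}" "(u, w) \<in> edges x" "is_diagonal n v d"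
      using d unfolding tri_def bn_edges_def by blast
    have "neg_diag d = {- w, - u}" using uw by (auto simp: neg_diag_pair)
    moreover have "(- w, - u) \<in> path_edges n up (inv x)"
      using edges_minus[OF x uw(2)] by (simp add: bn_edges_def)
    ultimately show ?thesis using is_diagonal_neg_diag[OF uw(3)] unfolding tri_def by auto
  qed
  have "neg_diag ` tri (inv x) = tri (inv x)"
  proof
    show "neg_diag ` tri (inv x) \<subseteq> tri (inv x)" using sub by blast
    show "tri (inv x) \<subseteq> neg_diag ` tri (inv x)" using sub by (metis imageI neg_diag_neg_diag subsetI)
  qed
  then show ?thesis using triangulation_tri[OF inj_inv[OF x]] by (simp add: cs_triangulations_def)
qed

text \<open>Central symmetry of \<open>T\<close> is what allows \<open>noncrossing_realized\<close>
  to produce a signed permutation; maximality of \<open>T\<close> turns inclusion into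
  equality.\<close>

lemma tri_surj:
  assumes T: "T \<in> cs_triangulations n v"
  obtains x where "x \<in> Bn n" "tri (inv x) = T"
proof -
  have tri: "triangulation n v T" and sym: "\<And>d. d \<in> T \<Longrightarrow> neg_diag d \<in> T"
    using T by (auto simp: cs_triangulations_def)
  define P where "P = {(u, w). u < w \<and> {u, w} \<in> T}"
  have P: "u \<in> poly_verts n \<and> w \<in> poly_verts n \<and> u < w" if "(u, w) \<in> P" for u w
  proof -
    have "is_diagonal n v {u, w}" using that triangulationD(1)[OF tri] by (auto simp: P_def)
    then show ?thesis using that by (auto simp: P_def is_diagonal_def doubleton_eq_iff)
  qed
  have noncross: "\<not> xing up u w u' w'" if "(u, w) \<in> P" "(u', w') \<in> P" for u w u' w'
  proof -
    have "\<not> crossing v {u, w} {u', w'}" using that triangulationD(2)[OF tri] by (simp add: P_def)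
    then show ?thesis using crossing_iff_xing P[OF that(1)] P[OF that(2)] by blast
  qed
  have "(- w, - u) \<in> P" if "(u, w) \<in> P" for u w
    using that sym[of "{u, w}"] by (simp add: P_def neg_diag_pair insert_commute)
  then obtain x where x: "x \<in> Bn n" "P \<subseteq> edges x"
    using noncrossing_realized[of P] P noncross by blast
  have "T \<subseteq> tri (inv x)"
  proof
    fix d assume d: "d \<in> T"
    then have diag: "is_diagonal n v d" using triangulationD(1)[OF tri] by blast
    then obtain u w where uw: "d = {u, w}" "u < w" using is_diagonalE by metis
    then have "(u, w) \<in> path_edges n up (inv x)" using x d by (auto simp: P_def bn_edges_def)
    then show "d \<in> tri (inv x)" using tri_iff[OF uw(2)] diag uw(1) by blast
  qed
  then have "T = tri (inv x)" using triangulation_subset_eq tri triangulation_tri inj_inv x(1) by blast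
  then show ?thesis using that x by blast
qed

lemma tri_edges_iff:
  "x \<in> Bn n \<Longrightarrow> y \<in> Bn n \<Longrightarrow> tri (inv x) = tri (inv y) \<longleftrightarrow> edges x = edges y"
  unfolding bn_edges_def by (rule tri_eq_iff[OF inj_inv inj_inv])

lemma tri_mono_edges: "path_edges n up pos \<inter> path_edges n up pos' \<subseteq> path_edges n up pos'' \<Longrightarrow>
    tri pos \<inter> tri pos' \<subseteq> tri pos''"
proof
  fix d assume sub: "path_edges n up pos \<inter> path_edges n up pos' \<subseteq> path_edges n up pos''" and d: "d \<in> tri pos \<inter> tri pos'"
  then obtain u w where uw: "d = {u, w}" "(u, w) \<in> path_edges n up pos" by (auto simp: tri_def)
  have "u < w" using path_edgesD(3)[OF uw(2)] .
  then show "d \<in> tri pos''" using d sub tri_iff uw(1) by auto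
qed

text \<open>The lost and the gained edge cross, so both are diagonals and the change is visible in
  the triangulations.\<close>

lemma tri_flip:
  assumes inj: "inj_on pos (signed_idx n)" "inj_on pos' (signed_idx n)"
    and D: "path_edges n up pos - path_edges n up pos' = {(u, w)}"
      "path_edges n up pos' - path_edges n up pos = {(u', w')}" and x: "xing_up up u w u' w'"
  shows "flip n v (tri pos) {u, w} {u', w'} (tri pos')" "slope v {u, w} < slope v {u', w'}"
proof -
  have e: "(u, w) \<in> path_edges n up pos" "(u', w') \<in> path_edges n up pos'"
    "(u, w) \<notin> path_edges n up pos'" "(u', w') \<notin> path_edges n up pos" using D by auto
  note V = path_edgesD(1-3)[OF e(1)] path_edgesD(1-3)[OF e(2)]
  show "slope v {u, w} < slope v {u', w'}" using xing_up_slope V x by blast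
  have diag: "is_diagonal n v {u, w}" "is_diagonal n v {u', w'}"
    using xing_is_diagonal V xing_up_xing[OF x] xing_sym by blast+
  have "tri pos' = insert {u', w'} (tri pos - {{u, w}})"
  proof (intro set_eqI iffI)
    fix d assume d: "d \<in> tri pos'"
    then obtain y z where yz: "d = {y, z}" "(y, z) \<in> path_edges n up pos'" "is_diagonal n v d" by (auto simp: tri_def)
    have less: "y < z" using path_edgesD(3)[OF yz(2)] .
    show "d \<in> insert {u', w'} (tri pos - {{u, w}})"
    proof (cases "(y, z) \<in> path_edges n up pos")
      case True
      then have "d \<in> tri pos" using tri_iff[OF less] yz by blast
      moreover have "d \<noteq> {u, w}" using d tri_iff[OF V(3)] e(3) by blast
      ultimately show ?thesis by blast
    next
      case False
      then have "(y, z) = (u', w')" using D(2) yz(2) by blast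
      then show ?thesis using yz(1) by simp
    qed
  next
    fix d assume d: "d \<in> insert {u', w'} (tri pos - {{u, w}})"
    show "d \<in> tri pos'"
    proof (cases "d = {u', w'}")
      case True
      then show ?thesis using tri_iff[OF V(6)] e(2) diag(2) by blast
    next
      case False
      then obtain y z where yz: "d = {y, z}" "(y, z) \<in> path_edges n up pos" "is_diagonal n v d" "d \<noteq> {u, w}"
        using d by (auto simp: tri_def)
      have "(y, z) \<noteq> (u, w)" using yz by auto
      then have "(y, z) \<in> path_edges n up pos'" using D(1) yz(2) by blast
      then show ?thesis using tri_iff path_edgesD(3) yz by blast
    qed
  qed
  moreover have "{u, w} \<in> tri pos" "{u', w'} \<notin> tri pos" using tri_iff V e diag by auto
  ultimately show "flip n v (tri pos) {u, w} {u', w'} (tri pos')"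
    unfolding flip_def using triangulation_tri[OF inj(1)] triangulation_tri[OF inj(2)] by blast
qed

lemma step_flip_up:
  assumes x: "x \<in> Bn n" "k < n" "x (lo k) < x (hi k)" and neq: "edges x \<noteq> edges (x \<circ> gen k)"
  shows "(tri (inv x), tri (inv (x \<circ> gen k))) \<in> flip_up n v"
proof -
  let ?y = "x \<circ> gen k"
  have y: "?y \<in> Bn n" using x by simp
  note cs = tri_cs[OF x(1)] tri_cs[OF y]
  show ?thesis
  proof (cases "k = 0")
    case True
    have asc: "x (lo 0) < x (hi 0)" "edges x \<noteq> edges (x \<circ> gen 0)" "0 < n" using x neq True by auto
    obtain w w' where f: "edges x - edges (x \<circ> gen 0) = {(- w, w)}" "edges (x \<circ> gen 0) - edges x = {(- w', w')}"
      "xing_up up (- w) w (- w') w'" using central_swap[OF x(1) asc(3,1,2)] by metis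
    have "flip n v (tri (inv x)) {- w, w} {- w', w'} (tri (inv ?y))" "slope v {- w, w} < slope v {- w', w'}"
      using tri_flip[OF inj_inv[OF x(1)] inj_inv[OF y]] f unfolding bn_edges_def True by blast+
    moreover have "is_diameter {- w, w}" unfolding is_diameter_def by (rule exI[of _ w]) (rule insert_commute)
    ultimately show ?thesis using cs unfolding flip_up_def by blast
  next
    case False
    obtain u w u' w' pos where f: "inj_on pos (signed_idx n)"
      "edges x - path_edges n up pos = {(u, w)}" "path_edges n up pos - edges x = {(u', w')}"
      "path_edges n up pos - edges ?y = {(- w, - u)}" "edges ?y - path_edges n up pos = {(- w', - u')}"
      "xing_up up u w u' w'" "xing_up up (- w) (- u) (- w') (- u')" "u \<noteq> - w"
      using half_swap[OF x(1) _ x(2,3) neq] False by (metis gr0I)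
    have 1: "flip n v (tri (inv x)) {u, w} {u', w'} (tri pos)" "slope v {u, w} < slope v {u', w'}"
      using tri_flip[OF inj_inv[OF x(1)] f(1)] f(2,3,6) unfolding bn_edges_def by blast+
    have neg: "neg_diag {u, w} = {- w, - u}" "neg_diag {u', w'} = {- w', - u'}" by (auto simp: neg_diag_pair)
    have 2: "flip n v (tri pos) (neg_diag {u, w}) (neg_diag {u', w'}) (tri (inv ?y))"
      "slope v (neg_diag {u, w}) < slope v (neg_diag {u', w'})"
      unfolding neg using tri_flip[OF f(1) inj_inv[OF y]] f(4,5,7) unfolding bn_edges_def by blast+
    have "u < w" using f(6) by (auto simp: xing_up_def)
    then have "\<not> is_diameter {u, w}" using f(8) by (auto simp: is_diameter_def doubleton_eq_iff)
    then show ?thesis using 1 2 cs unfolding flip_up_def by blast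
  qed
qed

text \<open>A symmetric \<open>U\<close> containing \<open>T \<inter> T'\<close> but not
  \<open>d\<close> contains a diagonal crossing \<open>d\<close>. By \<open>flip_unique\<close> this
  is \<open>d'\<close>, since any other would cross an element of \<open>T\<close> that
  \<open>U\<close> retains. Symmetry supplies the mirror image.\<close>

lemma flip_upD:
  assumes fu: "(T, T') \<in> flip_up n v"
  obtains d d' where "T \<in> cs_triangulations n v" "T' \<in> cs_triangulations n v"
    "T - T' \<subseteq> {d, neg_diag d}" "T' - T \<subseteq> {d', neg_diag d'}" "d \<in> T - T'" "d' \<in> T' - T"
    "slope v d < slope v d'" "\<And>U. U \<in> cs_triangulations n v \<Longrightarrow> T \<inter> T' \<subseteq> U \<Longrightarrow> U = T \<or> U = T'"
proof -
  have cs: "T \<in> cs_triangulations n v" "T' \<in> cs_triangulations n v" using fu by (auto simp: flip_up_def)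
  have tri: "triangulation n v U" and sym: "\<And>d. d \<in> U \<Longrightarrow> neg_diag d \<in> U" if "U \<in> cs_triangulations n v" for U
    using that by (auto simp: cs_triangulations_def)
  \<comment> \<open>The condition on \<open>neg_diag d\<close> guarantees that an element of
    \<open>T\<close> sharing an endpoint with \<open>d\<close>, other than \<open>d\<close>, is
    still in \<open>U\<close>.\<close>
  have complete: "U = T \<or> d' \<in> U" if fl: "flip n v T d d' T1" and U: "U \<in> cs_triangulations n v"
    and sub: "T - {d, neg_diag d} \<subseteq> U" and disj: "neg_diag d = d \<or> neg_diag d \<inter> d = {}" for d d' T1 U
  proof (cases "d \<in> U")
    case True
    then have "T \<subseteq> U" using sub sym[OF U True] by blast
    then show ?thesis using triangulation_subset_eq tri cs U by blast
  next
    case False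
    have dT: "d \<in> T" using fl by (auto simp: flip_def)
    then have "is_diagonal n v d" using triangulationD(1)[OF tri[OF cs(1)]] by blast
    then obtain e where e: "e \<in> U" "crossing v d e" using False triangulationD(3)[OF tri[OF U]] by blast
    have "is_diagonal n v e" using triangulationD(1)[OF tri[OF U]] e(1) by blast
    moreover have "crossing v e d" using e crossing_sym by blast
    moreover have "\<not> crossing v e g" if "g \<in> T" "g \<noteq> d" "g \<inter> d \<noteq> {}" for g
    proof -
      have "g \<in> U" using that sub disj by auto
      then show ?thesis using triangulationD(2)[OF tri[OF U]] e(1) by blast
    qed
    ultimately have "e = d'" using flip_unique[OF fl] by metis
    then show ?thesis using e by blast
  qed
  from fu consider (diam) d d' where "is_diameter d" "flip n v T d d' T'" "slope v d < slope v d'"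
    | (pair) d d' T1 where "\<not> is_diameter d" "flip n v T d d' T1"
        "flip n v T1 (neg_diag d) (neg_diag d') T'" "slope v d < slope v d'"
    unfolding flip_up_def by blast
  then show ?thesis
  proof cases
    case diam
    have T': "T' = insert d' (T - {d})" "d \<in> T" "d' \<notin> T" using diam(2) by (auto simp: flip_def)
    have nd: "neg_diag d = d" using diam(1) by (auto simp: is_diameter_def neg_diag_pair)
    have "U = T \<or> U = T'" if U: "U \<in> cs_triangulations n v" "T \<inter> T' \<subseteq> U" for U
    proof -
      have "U = T \<or> d' \<in> U" using complete[OF diam(2) U(1)] U(2) T' nd by blast
      moreover have "U = T'" if "d' \<in> U"
      proof -
        have "T' \<subseteq> U" using that T' U(2) by blast
        then show ?thesis using triangulation_subset_eq tri cs U(1) by blast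
      qed
      ultimately show ?thesis by blast
    qed
    then show ?thesis using that[of d d'] cs T' diam(3) by blast
  next
    case pair
    define e e' where "e = neg_diag d" and "e' = neg_diag d'"
    have T1: "T1 = insert d' (T - {d})" "d \<in> T" "d' \<notin> T" using pair(2) by (auto simp: flip_def)
    have T': "T' = insert e' (T1 - {e})" "e \<in> T1" "e' \<notin> T1" using pair(3) by (auto simp: flip_def e_def e'_def)
    have eT: "e \<in> T" using sym[OF cs(1) T1(2)] by (simp add: e_def)
    have dd: "d' \<noteq> e" "e' \<noteq> d" "e' \<noteq> d'"
    proof -
      show "d' \<noteq> e" using eT T1 by blast
      show "e' \<noteq> d"
      proof
        assume "e' = d"
        then have "d' = e" by (metis e_def e'_def neg_diag_neg_diag)
        then show False using eT T1 by blast
      qed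
      show "e' \<noteq> d'" using T' T1 by blast
    qed
    have diag: "is_diagonal n v d" using triangulationD(1)[OF tri[OF cs(1)]] T1(2) by blast
    obtain i j where ij: "d = {i, j}" "i < j" "i \<in> poly_verts n" "j \<in> poly_verts n" using is_diagonalE[OF diag] by metis
    have "i \<noteq> - j" using pair(1) ij unfolding is_diameter_def by (metis insert_commute)
    then have disj: "neg_diag d \<inter> d = {}" using ij by (auto simp: neg_diag_pair poly_verts_iff)
    have dT': "d' \<in> T' - T" "d \<in> T - T'" using T1 T' dd eT disj by (auto simp: e_def)
    have "U = T \<or> U = T'" if U: "U \<in> cs_triangulations n v" "T \<inter> T' \<subseteq> U" for U
    proof -
      have sub: "T - {d, e} \<subseteq> U" using U(2) T1 T' by blast
      then have "U = T \<or> d' \<in> U" using complete[OF pair(2) U(1)] disj by (simp add: e_def)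
      moreover have "U = T'" if d': "d' \<in> U"
      proof -
        have "e' \<in> U" using sym[OF U(1) d'] by (simp add: e'_def)
        then have "T' \<subseteq> U" using d' sub T1 T' by blast
        then show ?thesis using triangulation_subset_eq tri cs U(1) by blast
      qed
      ultimately show ?thesis by blast
    qed
    moreover have "T - T' \<subseteq> {d, neg_diag d}" "T' - T \<subseteq> {d', neg_diag d'}"
      using T1 T' by (auto simp: e_def e'_def)
    ultimately show ?thesis using that[of d d'] cs dT' pair(4) by blast
  qed
qed

text \<open>\<open>T\<close> and \<open>T'\<close> determine the exchanged diagonals up to negation,
  and negation preserves slopes.\<close>

lemma flip_up_asym:
  assumes 1: "(T, T') \<in> flip_up n v" and 2: "(T', T) \<in> flip_up n v"
  shows False
proof -
  obtain d d' where d: "T - T' \<subseteq> {d, neg_diag d}" "T' - T \<subseteq> {d', neg_diag d'}" "d \<in> T - T'" "d' \<in> T' - T"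
    "slope v d < slope v d'" "T \<in> cs_triangulations n v" "T' \<in> cs_triangulations n v"
    using flip_upD[OF 1] by metis
  obtain e e' where e: "T' - T \<subseteq> {e, neg_diag e}" "T - T' \<subseteq> {e', neg_diag e'}" "e \<in> T' - T" "e' \<in> T - T'"
    "slope v e < slope v e'" using flip_upD[OF 2] by metis
  have "is_diagonal n v e" "is_diagonal n v e'"
    using d(6,7) e(3,4) by (auto simp: cs_triangulations_def triangulation_def)
  then have "slope v (neg_diag e) = slope v e" "slope v (neg_diag e') = slope v e'" using slope_neg_diag by auto
  moreover have "d' \<in> {e, neg_diag e}" "d \<in> {e', neg_diag e'}" using d e by blast+
  ultimately show False using d(5) e(5) by auto
qed

text \<open>Climbing along ascents yields a flip whenever the triangulation changes. If no class
  lies strictly between those of \<open>x\<close> and \<open>y\<close>, the first change already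
  reaches the class of \<open>y\<close>.\<close>

lemma wle_flips:
  assumes "x \<in> Bn n" "y \<in> Bn n" "wle n x y"
  shows "(tri (inv x), tri (inv y)) \<in> (flip_up n v)\<^sup>* \<and>
    (tri (inv x) \<noteq> tri (inv y) \<longrightarrow>
      (\<forall>w\<in>Bn n. forced_set x \<subseteq> forced_set w \<longrightarrow> forced_set w \<subseteq> forced_set y \<longrightarrow>
        tri (inv w) = tri (inv x) \<or> tri (inv w) = tri (inv y)) \<longrightarrow>
      (tri (inv x), tri (inv y)) \<in> flip_up n v)"
  using assms
proof (induction "card (Inv n y - Inv n x)" arbitrary: x rule: less_induct)
  case less
  show ?case
  proof (cases "Inv n x = Inv n y")
    case True
    then have "x = y" using Inv_inject less.prems by blast
    then show ?thesis by simp
  next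
    case False
    then have "Inv n x \<subset> Inv n y" using less.prems by (auto simp: wle_iff)
    from biclosed_step[OF less.prems(1) biclosed_Inv[OF less.prems(2)] this]
    obtain k where k: "k < n" "x (lo k) < x (hi k)" "Inv n (x \<circ> gen k) \<subseteq> Inv n y" by blast
    define x' where "x' = x \<circ> gen k"
    have x': "x' \<in> Bn n" "wle n x x'" "wle n x' y"
      using less.prems k wle_ascent[of x n k] by (auto simp: x'_def wle_iff)
    have F: "forced_set x \<subseteq> forced_set x'" "forced_set x' \<subseteq> forced_set y"
      using forced_set_mono less.prems x' by auto
    have "Inv n y - Inv n x' \<subset> Inv n y - Inv n x"
      using Inv_step[OF less.prems(1) k(1,2)] k(3) unfolding x'_def by blast
    then have "card (Inv n y - Inv n x') < card (Inv n y - Inv n x)" by (intro psubset_card_mono) auto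
    note IH = less.hyps[OF this x'(1) less.prems(2) x'(3)]
    show ?thesis
    proof (cases "edges x = edges x'")
      case True
      then have "tri (inv x) = tri (inv x')" "forced_set x = forced_set x'"
        using tri_edges_iff[OF less.prems(1) x'(1)] edges_eq_iff[OF less.prems(1) x'(1)] by simp_all
      then show ?thesis using IH by simp
    next
      case False
      then have step: "(tri (inv x), tri (inv x')) \<in> flip_up n v"
        using step_flip_up[OF less.prems(1) k(1,2)] by (simp add: x'_def)
      have neq: "tri (inv x') \<noteq> tri (inv x)" using False tri_edges_iff less.prems(1) x'(1) by blast
      show ?thesis
      proof (intro conjI impI)
        show "(tri (inv x), tri (inv y)) \<in> (flip_up n v)\<^sup>*" using step IH by (meson converse_rtrancl_into_rtrancl)
        assume "\<forall>w\<in>Bn n. forced_set x \<subseteq> forced_set w \<longrightarrow> forced_set w \<subseteq> forced_set y \<longrightarrow>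
          tri (inv w) = tri (inv x) \<or> tri (inv w) = tri (inv y)"
        then have "tri (inv x') = tri (inv y)" using neq x'(1) F by blast
        then show "(tri (inv x), tri (inv y)) \<in> flip_up n v" using step by simp
      qed
    qed
  qed
qed

text \<open>If the inclusion holds, \<open>wmeet n x y\<close> is a representative of the class of
  \<open>x\<close> below \<open>y\<close>.\<close>

lemma forced_set_le_iff_wle:
  assumes B: "x \<in> Bn n" "y \<in> Bn n"
  shows "forced_set x \<subseteq> forced_set y \<longleftrightarrow>
    (\<exists>x'\<in>Bn n. \<exists>y'\<in>Bn n. edges x' = edges x \<and> edges y' = edges y \<and> wle n x' y')"
proof
  assume sub: "forced_set x \<subseteq> forced_set y"
  let ?m = "wmeet n x y"
  have m: "?m \<in> Bn n" "wle n ?m y" using wmeet_Ninv[OF B] wmeet_lower[OF B] by auto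
  have "forced_set ?m = forced_set x" using sub B by (auto simp: forced_set_wmeet)
  then have "edges ?m = edges x" using edges_eq_iff m(1) B(1) by blast
  then show "\<exists>x'\<in>Bn n. \<exists>y'\<in>Bn n. edges x' = edges x \<and> edges y' = edges y \<and> wle n x' y'" using m B(2) by blast
next
  assume "\<exists>x'\<in>Bn n. \<exists>y'\<in>Bn n. edges x' = edges x \<and> edges y' = edges y \<and> wle n x' y'"
  then show "forced_set x \<subseteq> forced_set y" using forced_set_mono edges_eq_iff B by metis
qed

lemma forced_set_flips:
  assumes B: "x \<in> Bn n" "y \<in> Bn n" and sub: "forced_set x \<subseteq> forced_set y"
  shows "(tri (inv x), tri (inv y)) \<in> (flip_up n v)\<^sup>*"
    and "tri (inv x) \<noteq> tri (inv y) \<Longrightarrow>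
      (\<And>w. w \<in> Bn n \<Longrightarrow> forced_set x \<subseteq> forced_set w \<Longrightarrow> forced_set w \<subseteq> forced_set y \<Longrightarrow>
        tri (inv w) = tri (inv x) \<or> tri (inv w) = tri (inv y)) \<Longrightarrow>
      (tri (inv x), tri (inv y)) \<in> flip_up n v"
proof -
  obtain x' y' where xy: "x' \<in> Bn n" "y' \<in> Bn n" "edges x' = edges x" "edges y' = edges y" "wle n x' y'"
    using forced_set_le_iff_wle[OF B] sub by blast
  then have eq: "tri (inv x') = tri (inv x)" "tri (inv y') = tri (inv y)"
    "forced_set x' = forced_set x" "forced_set y' = forced_set y"
    using tri_edges_iff[OF xy(1) B(1)] tri_edges_iff[OF xy(2) B(2)]
      edges_eq_iff[OF xy(1) B(1)] edges_eq_iff[OF xy(2) B(2)] by simp_all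
  note W = wle_flips[OF xy(1,2,5), unfolded eq]
  show "(tri (inv x), tri (inv y)) \<in> (flip_up n v)\<^sup>*" using W by blast
  show "(tri (inv x), tri (inv y)) \<in> flip_up n v" if "tri (inv x) \<noteq> tri (inv y)"
    "\<And>w. w \<in> Bn n \<Longrightarrow> forced_set x \<subseteq> forced_set w \<Longrightarrow> forced_set w \<subseteq> forced_set y \<Longrightarrow>
        tri (inv w) = tri (inv x) \<or> tri (inv w) = tri (inv y)"
    using W that by blast
qed

lemma flip_up_between:
  assumes B: "x \<in> Bn n" "y \<in> Bn n" "w \<in> Bn n"
    and fu: "(tri (inv x), tri (inv y)) \<in> flip_up n v \<or> (tri (inv y), tri (inv x)) \<in> flip_up n v"
    and sub: "tri (inv x) \<inter> tri (inv y) \<subseteq> tri (inv w)"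
  shows "tri (inv w) = tri (inv x) \<or> tri (inv w) = tri (inv y)"
  using fu
proof
  assume 1: "(tri (inv x), tri (inv y)) \<in> flip_up n v"
  show ?thesis using flip_upD[OF 1] tri_cs[OF B(3)] sub by metis
next
  assume 1: "(tri (inv y), tri (inv x)) \<in> flip_up n v"
  show ?thesis using flip_upD[OF 1] tri_cs[OF B(3)] sub by (metis Int_commute)
qed

lemma forced_between:
  assumes B: "x \<in> Bn n" "y \<in> Bn n" "w \<in> Bn n"
    and fu: "(tri (inv x), tri (inv y)) \<in> flip_up n v \<or> (tri (inv y), tri (inv x)) \<in> flip_up n v"
    and sub: "forced_set x \<subseteq> forced_set w" "forced_set w \<subseteq> forced_set y"
  shows "tri (inv w) = tri (inv x) \<or> tri (inv w) = tri (inv y)"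
  using flip_up_between[OF B fu] edges_between[OF B(1,3,2) sub] tri_mono_edges unfolding bn_edges_def by blast

text \<open>The meet contains the common edges, so its triangulation is one of the two and the
  classes are comparable. If they were comparable the wrong way, having nothing in between, they
  would be joined by an upward flip in the reverse direction, contrary to
  \<open>flip_up_asym\<close>.\<close>

lemma flip_up_forced_set:
  assumes B: "x \<in> Bn n" "y \<in> Bn n" and fu: "(tri (inv x), tri (inv y)) \<in> flip_up n v"
  shows "forced_set x \<subseteq> forced_set y"
proof -
  let ?m = "wmeet n x y"
  have m: "?m \<in> Bn n" using wmeet_Ninv[OF B] by blast
  have "edges x \<inter> edges y \<subseteq> edges ?m" using bn_edges_wmeet[OF B] by auto
  then have "tri (inv x) \<inter> tri (inv y) \<subseteq> tri (inv ?m)" unfolding bn_edges_def by (rule tri_mono_edges)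
  then have "tri (inv ?m) = tri (inv x) \<or> tri (inv ?m) = tri (inv y)" using flip_up_between[OF B m] fu by blast
  then have "forced_set ?m = forced_set x \<or> forced_set ?m = forced_set y"
    using tri_edges_iff[OF m B(1)] tri_edges_iff[OF m B(2)] edges_eq_iff[OF m B(1)] edges_eq_iff[OF m B(2)] by simp
  then have "forced_set x \<subseteq> forced_set y \<or> forced_set y \<subseteq> forced_set x" using forced_set_wmeet[OF B] by blast
  moreover have False if le: "forced_set y \<subseteq> forced_set x"
  proof -
    have "tri (inv y) \<noteq> tri (inv x)" using flip_upD[OF fu] by (metis DiffE)
    then have "(tri (inv y), tri (inv x)) \<in> flip_up n v"
      using forced_set_flips(2)[OF B(2,1) le] forced_between[OF B(2,1)] fu by blast
    then show False using flip_up_asym fu by blast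
  qed
  ultimately show ?thesis by blast
qed

lemma flips_forced_set:
  assumes B: "x \<in> Bn n" "y \<in> Bn n" and r: "(tri (inv x), tri (inv y)) \<in> (flip_up n v)\<^sup>*"
  shows "forced_set x \<subseteq> forced_set y"
proof -
  have "\<exists>y'\<in>Bn n. tri (inv y') = T \<and> forced_set x \<subseteq> forced_set y'" if "(tri (inv x), T) \<in> (flip_up n v)\<^sup>*" for T
    using that
  proof (induction rule: rtrancl_induct)
    case base
    then show ?case using B(1) by blast
  next
    case (step T T')
    then obtain y' where y': "y' \<in> Bn n" "tri (inv y') = T" "forced_set x \<subseteq> forced_set y'" by blast
    have "T' \<in> cs_triangulations n v" using step.hyps(2) by (auto simp: flip_up_def)
    then obtain z where z: "z \<in> Bn n" "tri (inv z) = T'" using tri_surj by blast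
    then have "forced_set y' \<subseteq> forced_set z" using flip_up_forced_set[OF y'(1) z(1)] step.hyps(2) y'(2) by simp
    then show ?case using z y' by blast
  qed
  then obtain y' where y': "y' \<in> Bn n" "tri (inv y') = tri (inv y)" "forced_set x \<subseteq> forced_set y'" using r by blast
  then show ?thesis using tri_edges_iff[OF y'(1) B(2)] edges_eq_iff[OF y'(1) B(2)] by simp
qed

lemma cambrian_isomorphism:
  fixes ori :: "nat \<Rightarrow> bool"
  assumes ori: "\<And>b. 1 \<le> b \<Longrightarrow> b \<le> n - 1 \<Longrightarrow> ori b = up (int b)"
  shows "\<exists>f. bij_betw f (camb_classes n ori) (cs_triangulations n v) \<and>
    (\<forall>X\<in>camb_classes n ori. \<forall>Y\<in>camb_classes n ori. camb_le n X Y \<longleftrightarrow> (f X, f Y) \<in> (flip_up n v)\<^sup>*) \<and>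
    (\<forall>X\<in>camb_classes n ori. \<forall>Y\<in>camb_classes n ori.
        covers (camb_le n) (camb_classes n ori) X Y \<longleftrightarrow> (f X, f Y) \<in> flip_up n v)"
proof -
  define cls where "cls x = {y \<in> Bn n. edges y = edges x}" for x
  have cong: "camb_cong n ori = edge_cong n up" by (rule camb_cong_eq) (rule ori)
  have "camb_cong n ori `` {x} = cls x" if "x \<in> Bn n" for x
    using that unfolding cong by (auto simp: edge_cong_def cls_def)
  then have classes: "camb_classes n ori = cls ` Bn n"
    unfolding camb_classes_def quotient_def by auto
  \<comment> \<open>Any representative serves, as triangulations are constant on classes.\<close>
  define f where "f X = tri (inv (SOME x. x \<in> X))" for X
  have f: "f (cls x) = tri (inv x)" if x: "x \<in> Bn n" for x
  proof -
    have "x \<in> cls x" using x by (simp add: cls_def)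
    then have "(SOME y. y \<in> cls x) \<in> cls x" by (rule someI[where P = "\<lambda>y. y \<in> cls x"])
    then show ?thesis using tri_edges_iff x by (auto simp: f_def cls_def)
  qed
  have cls_eq: "cls x = cls y \<longleftrightarrow> tri (inv x) = tri (inv y)" if "x \<in> Bn n" "y \<in> Bn n" for x y
    using that tri_edges_iff[OF that] by (auto simp: cls_def)
  have le: "camb_le n (cls x) (cls y) \<longleftrightarrow> forced_set x \<subseteq> forced_set y" if "x \<in> Bn n" "y \<in> Bn n" for x y
    unfolding forced_set_le_iff_wle[OF that] camb_le_def cls_def by blast
  have bij: "bij_betw f (camb_classes n ori) (cs_triangulations n v)"
    unfolding bij_betw_def
  proof
    show "inj_on f (camb_classes n ori)" unfolding classes by (auto simp: inj_on_def f cls_eq)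
    show "f ` camb_classes n ori = cs_triangulations n v"
    proof
      show "f ` camb_classes n ori \<subseteq> cs_triangulations n v" unfolding classes using f tri_cs by auto
      show "cs_triangulations n v \<subseteq> f ` camb_classes n ori"
      proof
        fix T assume "T \<in> cs_triangulations n v"
        then obtain x where "x \<in> Bn n" "tri (inv x) = T" by (rule tri_surj)
        then show "T \<in> f ` camb_classes n ori" unfolding classes using f by (metis imageI)
      qed
    qed
  qed
  have order: "camb_le n (cls x) (cls y) \<longleftrightarrow> (f (cls x), f (cls y)) \<in> (flip_up n v)\<^sup>*"
    if "x \<in> Bn n" "y \<in> Bn n" for x y
    unfolding le[OF that] f[OF that(1)] f[OF that(2)]
    using forced_set_flips(1)[OF that] flips_forced_set[OF that] by blast
  have cover: "covers (camb_le n) (camb_classes n ori) (cls x) (cls y) \<longleftrightarrow> (f (cls x), f (cls y)) \<in> flip_up n v"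
    if B: "x \<in> Bn n" "y \<in> Bn n" for x y
  proof -
    have iff: "covers (camb_le n) (camb_classes n ori) (cls x) (cls y) \<longleftrightarrow>
      forced_set x \<subseteq> forced_set y \<and> tri (inv x) \<noteq> tri (inv y) \<and>
      (\<forall>w\<in>Bn n. forced_set x \<subseteq> forced_set w \<longrightarrow> forced_set w \<subseteq> forced_set y \<longrightarrow>
        tri (inv w) = tri (inv x) \<or> tri (inv w) = tri (inv y))"
      unfolding covers_def classes using le cls_eq B by auto
    show ?thesis
      unfolding iff f[OF B(1)] f[OF B(2)]
    proof (intro iffI conjI ballI impI)
      assume "(tri (inv x), tri (inv y)) \<in> flip_up n v"
      note fu = this
      show "forced_set x \<subseteq> forced_set y" using flip_up_forced_set[OF B fu] .
      show "tri (inv x) \<noteq> tri (inv y)" using flip_upD[OF fu] by (metis DiffE)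
      show "tri (inv w) = tri (inv x) \<or> tri (inv w) = tri (inv y)"
        if "w \<in> Bn n" "forced_set x \<subseteq> forced_set w" "forced_set w \<subseteq> forced_set y" for w
        using forced_between[OF B that(1)] fu that by blast
    qed (use forced_set_flips(2)[OF B] in blast)
  qed
  show ?thesis using bij order cover unfolding classes by (intro exI[of _ f]) auto
qed

end

theorem theorem7p4:
  fixes n :: nat and ori :: "nat \<Rightarrow> bool" and upn :: bool
    and v :: "int \<Rightarrow> real \<times> real"
  assumes "n \<ge> 1"
    and "Qpoly n (is_up n ori upn) v"
  shows "\<exists>f. bij_betw f (camb_classes n ori) (cs_triangulations n v) \<and>
    (\<forall>X\<in>camb_classes n ori. \<forall>Y\<in>camb_classes n ori.
        camb_le n X Y \<longleftrightarrow> (f X, f Y) \<in> (flip_up n v)\<^sup>*) \<and>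
    (\<forall>X\<in>camb_classes n ori. \<forall>Y\<in>camb_classes n ori.
        covers (camb_le n) (camb_classes n ori) X Y \<longleftrightarrow> (f X, f Y) \<in> flip_up n v)"
proof -
  interpret signed_polygon n "is_up n ori upn" v
  proof
    show "is_up n ori upn (- i) \<longleftrightarrow> \<not> is_up n ori upn i" if "i \<in> signed_idx n" for i
      using that by (auto simp: is_up_def signed_idx_iff Let_def)
    show "Qpoly n (is_up n ori upn) v" by (rule assms(2))
  qed
  show ?thesis by (rule cambrian_isomorphism) (auto simp: is_up_def)
qed

end
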